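(* Let $r$ be an integer and let $M$ be a finitely generated graded $S$-module which is generated in degrees $\leq r-(t-1)(n+1)$. Suppose that $M_1,M_2,\dots,M_d$ form an approximation system for $M$ of degree $t$ such that $\operatorname{reg}(M_i)\leq r-(t-1)(n+1)-1$ for all $i$. Then $\operatorname{reg}(M)\leq r$.
   Context: $S=k[x_0,\ldots,x_n]$ is the standard graded polynomial ring over an infinite field $k$, and $\mathfrak m=(x_0,\ldots,x_n)$. All modules are finitely generated graded $S$-modules and morphisms are graded. Regularity: a finitely generated graded module $M$ with minimal graded free resolution $0\to F_l\to\cdots\to F_0\to M\to 0$ is $r$-regular if each $F_i$ is generated by elements of degree $\leq r+i$. $\operatorname{reg}(M)$ is the least integer $r$ such that $M$ is $r$-regular ($-\infty$ for $M=0$). Approximation: a finitely generated graded module $M'$ is an approximation of $M$ if there is a surjective morphism $\phi:M\to M'$ with $\ker\phi$ annihilated by a proper homogeneous ideal of $S$. Approximation system: finitely generated graded modules $M_1,\dots,M_d$ form an approximation system for $M$ of degree $t$ if there are surjective morphisms $\phi_i:M\to M_i$ and proper homogeneous ideals $I_1,\dots,I_d$ of $S$ with $I_i\cdot\ker\phi_i=0$ for each $i$, and $\sum_i I_i\supseteq\mathfrak m^t$, where $t$ is an integer (necessarily $t\ge 1$, since the $I_i$ are proper). *)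

theory Defs
  imports
    "HOL-Algebra.Module"
    "HOL-Algebra.Ideal_Product"
    "HOL-Library.Poly_Mapping"
    "HOL-Library.Extended"
begin

section \<open>The standard graded polynomial ring\<close>

text \<open>Polynomials in variables indexed by the naturals: finitely supported coefficient functions on
  monomials, which are themselves finitely supported exponent functions. The multiplication of
  \<^type>\<open>poly_mapping\<close> is the convolution product.\<close>

type_synonym 'k mpol = "(nat \<Rightarrow>\<^sub>0 nat) \<Rightarrow>\<^sub>0 'k"

definition poly_ring :: "nat \<Rightarrow> ('k::field) mpol ring" where
  "poly_ring n =
    \<lparr>carrier = {p. \<forall>m \<in> Poly_Mapping.keys p. Poly_Mapping.keys m \<subseteq> {0..n}},
     mult = (*), one = 1, zero = 0, add = (+)\<rparr>"

definition var :: "nat \<Rightarrow> ('k::field) mpol" where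
  "var j = Poly_Mapping.single (Poly_Mapping.single j 1) 1"

definition mono_degree :: "(nat \<Rightarrow>\<^sub>0 nat) \<Rightarrow> nat" where
  "mono_degree m = (\<Sum>j \<in> Poly_Mapping.keys m. Poly_Mapping.lookup m j)"

text \<open>The integer indexing gives \<open>{0}\<close> in negative degrees.\<close>

definition hom_part :: "nat \<Rightarrow> int \<Rightarrow> ('k::field) mpol set" where
  "hom_part n a =
    {p \<in> carrier (poly_ring n). \<forall>m \<in> Poly_Mapping.keys p. int (mono_degree m) = a}"

definition irrelevant_ideal :: "nat \<Rightarrow> ('k::field) mpol set" where
  "irrelevant_ideal n = Idl\<^bsub>poly_ring n\<^esub> (var ` {0..n})"

definition homogeneous_ideal :: "nat \<Rightarrow> ('k::field) mpol set \<Rightarrow> bool" where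
  "homogeneous_ideal n I \<longleftrightarrow>
    ideal I (poly_ring n) \<and> (\<exists>A \<subseteq> (\<Union>a. hom_part n a). I = Idl\<^bsub>poly_ring n\<^esub> A)"

definition proper_homogeneous_ideal :: "nat \<Rightarrow> ('k::field) mpol set \<Rightarrow> bool" where
  "proper_homogeneous_ideal n I \<longleftrightarrow> homogeneous_ideal n I \<and> I \<noteq> carrier (poly_ring n)"

definition ideal_sum :: "('a, 'm) ring_scheme \<Rightarrow> 'i set \<Rightarrow> ('i \<Rightarrow> 'a set) \<Rightarrow> 'a set" where
  "ideal_sum R A I = {finsum R p A | p. \<forall>i \<in> A. p i \<in> I i}"


section \<open>Graded modules\<close>

record ('a, 'b) graded_module = "('a, 'b) module" +
  graded_part :: "int \<Rightarrow> 'b set"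

text \<open>As for modules in HOL-Algebra, the record fields \<^const>\<open>mult\<close> and \<^const>\<open>one\<close> of a graded
  module carry no meaning.\<close>

locale graded_module = Module.module "poly_ring n" M
  for n :: nat and M :: "(('k::field) mpol, 'b) graded_module" (structure) +
  assumes graded_part_subgroup: "additive_subgroup (graded_part M e) M"
    and graded_part_smult:
      "\<lbrakk>p \<in> hom_part n a; x \<in> graded_part M e\<rbrakk> \<Longrightarrow> p \<odot>\<^bsub>M\<^esub> x \<in> graded_part M (a + e)"
    and direct_sum:
      "x \<in> carrier M \<Longrightarrow>
        \<exists>!f. (\<forall>e. f e \<in> graded_part M e) \<and> finite {e. f e \<noteq> \<zero>\<^bsub>M\<^esub>} \<and>
             (\<Oplus>\<^bsub>M\<^esub>e \<in> {e. f e \<noteq> \<zero>\<^bsub>M\<^esub>}. f e) = x"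

definition submodule_generated ::
    "nat \<Rightarrow> (('k::field) mpol, 'b) graded_module \<Rightarrow> 'b set \<Rightarrow> 'b set" where
  "submodule_generated n M A = \<Inter>{N. submodule N (poly_ring n) M \<and> A \<subseteq> N}"

definition fg_graded_module :: "nat \<Rightarrow> (('k::field) mpol, 'b) graded_module \<Rightarrow> bool" where
  "fg_graded_module n M \<longleftrightarrow>
    graded_module n M \<and>
    (\<exists>A. finite A \<and> A \<subseteq> carrier M \<and> submodule_generated n M A = carrier M)"

definition generated_in_degrees_le ::
    "nat \<Rightarrow> (('k::field) mpol, 'b) graded_module \<Rightarrow> int \<Rightarrow> bool" where
  "generated_in_degrees_le n M s \<longleftrightarrow>
    submodule_generated n M (\<Union>e \<in> {..s}. graded_part M e) = carrier M"

definition graded_hom ::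
    "nat \<Rightarrow> (('k::field) mpol, 'b) graded_module \<Rightarrow> ('k mpol, 'c) graded_module \<Rightarrow> ('b \<Rightarrow> 'c) set"
  where
  "graded_hom n M N =
    {f \<in> hom (add_monoid M) (add_monoid N).
      (\<forall>p \<in> carrier (poly_ring n). \<forall>x \<in> carrier M. f (p \<odot>\<^bsub>M\<^esub> x) = p \<odot>\<^bsub>N\<^esub> f x) \<and>
      (\<forall>e. f ` graded_part M e \<subseteq> graded_part N e)}"

definition ideal_smult ::
    "nat \<Rightarrow> ('k::field) mpol set \<Rightarrow> ('k mpol, 'b) graded_module \<Rightarrow> 'b set" where
  "ideal_smult n I M = submodule_generated n M {p \<odot>\<^bsub>M\<^esub> x | p x. p \<in> I \<and> x \<in> carrier M}"


section \<open>Minimal graded free resolutions and regularity\<close>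

text \<open>The graded free module \<open>\<Oplus>\<^sub>j S(-D\<^sub>j)\<close>, whose \<open>j\<close>-th basis vector is homogeneous of degree
  \<open>D ! j\<close>. Its elements are coordinate vectors, extended by \<open>0\<close> beyond the rank; up to isomorphism
  these are all the finitely generated graded free modules.\<close>

definition free_module :: "nat \<Rightarrow> int list \<Rightarrow> (('k::field) mpol, nat \<Rightarrow> 'k mpol) graded_module" where
  "free_module n D =
    \<lparr>carrier = {v. (\<forall>j < length D. v j \<in> carrier (poly_ring n)) \<and> (\<forall>j \<ge> length D. v j = 0)},
     mult = undefined, one = undefined, zero = (\<lambda>_. 0), add = (\<lambda>v w j. v j + w j),
     smult = (\<lambda>p v j. p * v j),
     graded_part =
       (\<lambda>e. {v. (\<forall>j < length D. v j \<in> hom_part n (e - D ! j)) \<and> (\<forall>j \<ge> length D. v j = 0)})\<rparr>"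

text \<open>The complex is \<open>0 \<rightarrow> F\<^sub>l \<rightarrow> \<dots> \<rightarrow> F\<^sub>0 \<rightarrow> M \<rightarrow> 0\<close> with \<open>F\<^sub>i = free_module n (D i)\<close>, augmentation
  \<open>\<epsilon> : F\<^sub>0 \<rightarrow> M\<close> and differentials \<open>\<delta> i : F\<^bsub>i+1\<^esub> \<rightarrow> F\<^sub>i\<close>. Minimality is
  \<open>\<delta> i (F\<^bsub>i+1\<^esub>) \<subseteq> \<mm> F\<^sub>i\<close>.\<close>

definition minimal_graded_free_resolution ::
    "nat \<Rightarrow> (('k::field) mpol, 'b) graded_module \<Rightarrow> nat \<Rightarrow> (nat \<Rightarrow> int list) \<Rightarrow>
     ((nat \<Rightarrow> 'k mpol) \<Rightarrow> 'b) \<Rightarrow> (nat \<Rightarrow> (nat \<Rightarrow> 'k mpol) \<Rightarrow> (nat \<Rightarrow> 'k mpol)) \<Rightarrow> bool" where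
  "minimal_graded_free_resolution n M l D \<epsilon> \<delta> \<longleftrightarrow>
    (let F = (\<lambda>i. free_module n (D i) :: ('k mpol, nat \<Rightarrow> 'k mpol) graded_module);
         ker = (\<lambda>i. if i = 0 then a_kernel (F 0) M \<epsilon> else a_kernel (F i) (F (i - 1)) (\<delta> (i - 1)))
     in \<epsilon> \<in> graded_hom n (F 0) M \<and>
        (\<forall>i < l. \<delta> i \<in> graded_hom n (F (Suc i)) (F i)) \<and>
        \<epsilon> ` carrier (F 0) = carrier M \<and>
        (\<forall>i < l. \<delta> i ` carrier (F (Suc i)) = ker i) \<and>
        ker l = {\<zero>\<^bsub>F l\<^esub>} \<and>
        (\<forall>i < l. \<delta> i ` carrier (F (Suc i)) \<subseteq> ideal_smult n (irrelevant_ideal n) (F i)))"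

definition regular :: "nat \<Rightarrow> (('k::field) mpol, 'b) graded_module \<Rightarrow> int \<Rightarrow> bool" where
  "regular n M r \<longleftrightarrow>
    (\<exists>l D \<epsilon> \<delta>. minimal_graded_free_resolution n M l D \<epsilon> \<delta> \<and>
      (\<forall>i \<le> l. generated_in_degrees_le n
        (free_module n (D i) :: ('k mpol, nat \<Rightarrow> 'k mpol) graded_module) (r + int i)))"

definition reg :: "nat \<Rightarrow> (('k::field) mpol, 'b) graded_module \<Rightarrow> int extended" where
  "reg n M = (if carrier M = {\<zero>\<^bsub>M\<^esub>} then -\<infinity> else Fin (LEAST r. regular n M r))"


section \<open>Approximation systems\<close>

definition approximation_via ::
    "nat \<Rightarrow> (('k::field) mpol, 'b) graded_module \<Rightarrow> ('k mpol, 'c) graded_module \<Rightarrow>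
     ('b \<Rightarrow> 'c) \<Rightarrow> 'k mpol set \<Rightarrow> bool" where
  "approximation_via n M M' \<phi> I \<longleftrightarrow>
    \<phi> \<in> graded_hom n M M' \<and> \<phi> ` carrier M = carrier M' \<and>
    proper_homogeneous_ideal n I \<and>
    (\<forall>p \<in> I. \<forall>x \<in> a_kernel M M' \<phi>. p \<odot>\<^bsub>M\<^esub> x = \<zero>\<^bsub>M\<^esub>)"

definition approximation_system ::
    "nat \<Rightarrow> (('k::field) mpol, 'b) graded_module \<Rightarrow> nat \<Rightarrow>
     (nat \<Rightarrow> ('k mpol, 'c) graded_module) \<Rightarrow> nat \<Rightarrow> bool" where
  "approximation_system n M d Ms t \<longleftrightarrow>
    (\<forall>i \<in> {1..d}. fg_graded_module n (Ms i)) \<and>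
    (\<exists>\<phi> I. (\<forall>i \<in> {1..d}. approximation_via n M (Ms i) (\<phi> i) (I i)) \<and>
      irrelevant_ideal n [^]\<^bsub>ideals_set (poly_ring n)\<^esub> t \<subseteq> ideal_sum (poly_ring n) {1..d} I)"

end

theory Submission
  imports Defs "HOL-Library.Function_Algebras" HOL.Modules HOL.Topological_Spaces
begin

text \<open>Write \<open>N = n + 1\<close> and \<open>s = r - (t - 1) * N\<close>. The proof goes through a description of regularity by hyperplane
  sections. Let \<open>y\<^sub>0, \<dots>, y\<^sub>n\<close> be general linear forms and \<open>A\<^sub>i = M / (y\<^sub>0, \<dots>, y\<^bsub>i-1\<^esub>) M\<close>. Call an element of \<open>A\<^sub>i\<close>
  torsion if a power of every \<open>y\<^sub>l\<close> kills it. Then \<open>M\<close> is \<open>c\<close>-regular if and only if it is generated in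
  degrees at most \<open>c\<close> and no \<open>A\<^sub>i\<close> has nonzero torsion in degrees above \<open>c\<close>.

  Given this, the theorem is a short descending induction on \<open>i\<close>
  (\<open>torsion_vanishing_by_approximation\<close>). Torsion of \<open>A\<^sub>i\<close> in degree at least \<open>s\<close> maps to \<open>0\<close> in the
  corresponding section of every approximating module, because these have no torsion above \<open>s - 1\<close>; so it is
  killed by every \<open>I\<^sub>a\<close>, hence by \<open>y\<^sub>i\<^sup>t\<close>, an element of the sum of the \<open>I\<^sub>a\<close>. On the other hand, above the bound
  already known for \<open>A\<^bsub>i+1\<^esub>\<close> a torsion element of \<open>A\<^sub>i\<close> restricts to \<open>0\<close>, so it is \<open>y\<^sub>i\<close> times a torsion
  element. Dividing \<open>t\<close> times by \<open>y\<^sub>i\<close> costs \<open>t - 1\<close> degrees and shows that the element is \<open>0\<close>. The induction starts at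
  \<open>A\<^sub>N = M / \<mm> M\<close>, where the bound \<open>s\<close> is the hypothesis on generators; \<open>N\<close> steps lead to \<open>s + (t - 1) * N = r\<close>.

  The equivalence is read off a free resolution \<open>F\<close>. Since the \<open>y\<^sub>l\<close> form a regular sequence on free modules, the
  complexes \<open>F / (y\<^sub>0, \<dots>, y\<^bsub>i-1\<^esub>) F\<close> are linked by long exact sequences for multiplication by \<open>y\<^sub>i\<close>. Going down
  from \<open>i = N\<close>, where the degrees of \<open>F\<close> bound everything, gives the torsion bounds (\<open>torsion_vanishing\<close>). Going up
  from \<open>i = 0\<close>, where the complex is exact, bounds the homology at \<open>i = N\<close> (\<open>homology_degree_bound\<close>), and for a minimal
  resolution this homology is \<open>F / \<mm> F\<close>. The same ascent shows that a minimal resolution has length at most \<open>N\<close>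
  (\<open>homology_zero_above\<close>), so that every module is regular in some degree and \<open>reg\<close> is a genuine minimum.

  General forms exist because \<open>k\<close> is infinite and submodules of free modules are finitely generated
  (\<open>graded_submodule_fg\<close>, proved with leading terms). They are taken triangular,
  \<open>y\<^sub>i = x\<^sub>i + c x\<^bsub>i+1\<^esub> + c\<^sup>2 x\<^bsub>i+2\<^esub> + \<dots>\<close>: triangularity makes regularity on free modules elementary, and the moment
  curve shape lets a Vandermonde argument exclude all but finitely many \<open>c\<close> (\<open>finitely_many_bad_forms\<close>).\<close>

section \<open>Polynomials and their homogeneous parts\<close>

lemma mono_degree_superset:
  "finite A \<Longrightarrow> Poly_Mapping.keys m \<subseteq> A \<Longrightarrow> mono_degree m = (\<Sum>j\<in>A. Poly_Mapping.lookup m j)"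
  unfolding mono_degree_def by (rule sum.mono_neutral_left) (auto simp: in_keys_iff)

lemma mono_degree_add: "mono_degree (a + b) = mono_degree a + mono_degree b"
proof -
  let ?A = "Poly_Mapping.keys a \<union> Poly_Mapping.keys b"
  have "mono_degree (a + b) = (\<Sum>j\<in>?A. Poly_Mapping.lookup (a + b) j)"
    by (rule mono_degree_superset) (use keys_add[of a b] in auto)
  also have "\<dots> = mono_degree a + mono_degree b"
    by (simp add: lookup_add sum.distrib mono_degree_superset[of ?A a] mono_degree_superset[of ?A b])
  finally show ?thesis .
qed

lemma mono_degree_0 [simp]: "mono_degree 0 = 0"
  by (simp add: mono_degree_def)

lemma mono_degree_single [simp]: "mono_degree (Poly_Mapping.single l c) = c"
  by (simp add: mono_degree_def)

lemma mono_degree_eq_0_iff: "mono_degree m = 0 \<longleftrightarrow> m = 0"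
proof
  assume "mono_degree m = 0"
  then show "m = 0"
    by (intro poly_mapping_eqI) (auto simp: mono_degree_def in_keys_iff)
qed simp

lemma keys_add_nat: "Poly_Mapping.keys (a + b :: nat \<Rightarrow>\<^sub>0 nat) = Poly_Mapping.keys a \<union> Poly_Mapping.keys b"
  by (auto simp: in_keys_iff lookup_add)

lemma in_keys_mult:
  assumes "m \<in> Poly_Mapping.keys (p * q)"
  obtains a b where "m = a + b" "a \<in> Poly_Mapping.keys p" "b \<in> Poly_Mapping.keys q"
  using assms keys_mult[of p q] by blast

lemma sum_monomials: "p = (\<Sum>m\<in>Poly_Mapping.keys p. Poly_Mapping.single m (Poly_Mapping.lookup p m))"
proof (rule poly_mapping_eqI)
  fix k
  have "(\<Sum>m\<in>Poly_Mapping.keys p. Poly_Mapping.lookup (Poly_Mapping.single m (Poly_Mapping.lookup p m)) k)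
      = (\<Sum>m\<in>Poly_Mapping.keys p. if m = k then Poly_Mapping.lookup p k else 0)"
    by (rule sum.cong) (auto simp: lookup_single)
  also have "\<dots> = Poly_Mapping.lookup p k"
    by (auto simp: in_keys_iff)
  finally show "Poly_Mapping.lookup p k = Poly_Mapping.lookup (\<Sum>m\<in>Poly_Mapping.keys p. Poly_Mapping.single m (Poly_Mapping.lookup p m)) k"
    by (simp add: lookup_sum)
qed

lemma carrier_poly_ring_iff:
  "p \<in> carrier (poly_ring n) \<longleftrightarrow> (\<forall>m \<in> Poly_Mapping.keys p. Poly_Mapping.keys m \<subseteq> {0..n})"
  by (simp add: poly_ring_def)

lemma poly_ring_ops [simp]:
  "mult (poly_ring n) = (*)" "one (poly_ring n) = 1" "zero (poly_ring n) = 0" "add (poly_ring n) = (+)"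
  by (simp_all add: poly_ring_def)

lemma poly_carrier_0 [simp]: "0 \<in> carrier (poly_ring n)"
  and poly_carrier_1 [simp]: "1 \<in> carrier (poly_ring n)"
  by (simp_all add: carrier_poly_ring_iff)

lemma poly_carrier_add [intro]:
  "p \<in> carrier (poly_ring n) \<Longrightarrow> q \<in> carrier (poly_ring n) \<Longrightarrow> p + q \<in> carrier (poly_ring n)"
  using keys_add[of p q] by (fastforce simp: carrier_poly_ring_iff)

lemma poly_carrier_uminus [intro]:
  "p \<in> carrier (poly_ring n) \<Longrightarrow> - p \<in> carrier (poly_ring n)"
  by (auto simp: carrier_poly_ring_iff in_keys_iff)

lemma poly_carrier_mult [intro]:
  assumes "p \<in> carrier (poly_ring n)" "q \<in> carrier (poly_ring n)" shows "p * q \<in> carrier (poly_ring n)"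
  unfolding carrier_poly_ring_iff
proof
  fix m assume "m \<in> Poly_Mapping.keys (p * q)"
  then obtain a b where "m = a + b" "a \<in> Poly_Mapping.keys p" "b \<in> Poly_Mapping.keys q"
    by (rule in_keys_mult)
  then show "Poly_Mapping.keys m \<subseteq> {0..n}"
    using assms by (auto simp: carrier_poly_ring_iff keys_add_nat)
qed

lemma poly_carrier_sum [intro]:
  "(\<And>i. i \<in> A \<Longrightarrow> f i \<in> carrier (poly_ring n)) \<Longrightarrow> sum f A \<in> carrier (poly_ring n)"
  by (induction A rule: infinite_finite_induct) auto

lemma cring_poly_ring: "cring (poly_ring n :: ('k::field) mpol ring)" (is "cring ?R")
proof (rule cringI)
  show "abelian_group ?R"
  proof (rule abelian_groupI)
    fix x assume "x \<in> carrier ?R"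
    then show "\<exists>y\<in>carrier ?R. y \<oplus>\<^bsub>?R\<^esub> x = \<zero>\<^bsub>?R\<^esub>"
      by (intro bexI[of _ "-x"]) auto
  qed (auto simp: ac_simps)
  show "Group.comm_monoid ?R"
    by (rule comm_monoidI) (auto simp: ac_simps)
qed (auto simp: distrib_right)

lemma hom_part_iff:
  "p \<in> hom_part n a \<longleftrightarrow>
    (\<forall>m \<in> Poly_Mapping.keys p. Poly_Mapping.keys m \<subseteq> {0..n} \<and> int (mono_degree m) = a)"
  by (auto simp: hom_part_def carrier_poly_ring_iff)

lemma hom_part_carrier: "p \<in> hom_part n a \<Longrightarrow> p \<in> carrier (poly_ring n)"
  by (simp add: hom_part_def)

lemma hom_part_0 [simp]: "0 \<in> hom_part n a"
  by (simp add: hom_part_iff)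

lemma hom_part_add [intro]: "p \<in> hom_part n a \<Longrightarrow> q \<in> hom_part n a \<Longrightarrow> p + q \<in> hom_part n a"
  using keys_add[of p q] unfolding hom_part_iff by blast

lemma hom_part_uminus [intro]: "p \<in> hom_part n a \<Longrightarrow> - p \<in> hom_part n a"
  by (auto simp: hom_part_iff in_keys_iff)

lemma hom_part_diff [intro]: "p \<in> hom_part n a \<Longrightarrow> q \<in> hom_part n a \<Longrightarrow> p - q \<in> hom_part n a"
  using hom_part_add[of p n a "-q"] by auto

lemma hom_part_sum [intro]:
  "(\<And>i. i \<in> A \<Longrightarrow> f i \<in> hom_part n a) \<Longrightarrow> sum f A \<in> hom_part n a"
  by (induction A rule: infinite_finite_induct) auto

lemma hom_part_mult [intro]:
  assumes "p \<in> hom_part n a" "q \<in> hom_part n b" shows "p * q \<in> hom_part n (a + b)"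
  unfolding hom_part_iff
proof
  fix m assume "m \<in> Poly_Mapping.keys (p * q)"
  then obtain u v where "m = u + v" "u \<in> Poly_Mapping.keys p" "v \<in> Poly_Mapping.keys q"
    by (rule in_keys_mult)
  then show "Poly_Mapping.keys m \<subseteq> {0..n} \<and> int (mono_degree m) = a + b"
    using assms by (auto simp: hom_part_iff keys_add_nat mono_degree_add)
qed

lemma hom_part_single: 
  "Poly_Mapping.keys m \<subseteq> {0..n} \<Longrightarrow> Poly_Mapping.single m c \<in> hom_part n (int (mono_degree m))"
  by (auto simp: hom_part_iff)

lemma hom_part_const [simp]: "Poly_Mapping.single 0 c \<in> hom_part n 0"
  using hom_part_single[of 0 n c] by simp

lemma hom_part_1 [simp]: "1 \<in> hom_part n 0"
  using hom_part_const[of 1 n] by simp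

lemma hom_part_var [simp]: "l \<le> n \<Longrightarrow> var l \<in> hom_part n 1"
  using hom_part_single[of "Poly_Mapping.single l 1" n 1] by (simp add: var_def)

lemma hom_part_power: "p \<in> hom_part n a \<Longrightarrow> p ^ k \<in> hom_part n (int k * a)"
  by (induction k) (auto simp: algebra_simps dest: hom_part_mult)

lemma hom_part_power1: "p \<in> hom_part n 1 \<Longrightarrow> p ^ k \<in> hom_part n (int k)"
  using hom_part_power[of p n 1 k] by simp

lemma hom_part_neg: "a < 0 \<Longrightarrow> hom_part n a = {0}"
  by (auto simp: hom_part_iff intro!: hom_part_0)

lemma hom_part_deg0: "p \<in> hom_part n 0 \<Longrightarrow> p = Poly_Mapping.single 0 (Poly_Mapping.lookup p 0)"
proof (rule poly_mapping_eqI)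
  fix k assume "p \<in> hom_part n 0"
  then show "Poly_Mapping.lookup p k = Poly_Mapping.lookup (Poly_Mapping.single 0 (Poly_Mapping.lookup p 0)) k"
    by (cases "k = 0") (auto simp: lookup_single hom_part_iff in_keys_iff mono_degree_eq_0_iff)
qed

lemma hom_part_lookup_0: "p \<in> hom_part n a \<Longrightarrow> a \<noteq> 0 \<Longrightarrow> Poly_Mapping.lookup p 0 = 0"
  unfolding hom_part_iff by (metis mono_degree_0 of_nat_0 in_keys_iff)

text \<open>The constant coefficient is multiplicative because the exponent \<open>0\<close> is a sum of exponents only as \<open>0 + 0\<close>.\<close>

lemma lookup_mult_0: "Poly_Mapping.lookup (p * q :: ('k::field) mpol) 0 = Poly_Mapping.lookup p 0 * Poly_Mapping.lookup q 0"
proof -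
  have p: "p = (p - Poly_Mapping.single 0 (Poly_Mapping.lookup p 0)) + Poly_Mapping.single 0 (Poly_Mapping.lookup p 0)"
    by simp
  have z: "0 \<notin> Poly_Mapping.keys (u * v)" if u: "0 \<notin> Poly_Mapping.keys u" for u v :: "'k mpol"
  proof
    assume "0 \<in> Poly_Mapping.keys (u * v)"
    then obtain a b where "0 = a + b" "a \<in> Poly_Mapping.keys u" by (rule in_keys_mult)
    then have "a = 0" by (metis add_eq_0_iff_both_eq_0 mono_degree_0 mono_degree_add mono_degree_eq_0_iff)
    then show False using u \<open>a \<in> _\<close> by simp
  qed
  define u where "u = p - Poly_Mapping.single 0 (Poly_Mapping.lookup p 0)"
  define w where "w = q - Poly_Mapping.single 0 (Poly_Mapping.lookup q 0)"
  have "p * q = u * q + (w * Poly_Mapping.single 0 (Poly_Mapping.lookup p 0) + 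
      Poly_Mapping.single 0 (Poly_Mapping.lookup p 0 * Poly_Mapping.lookup q 0))"
    unfolding u_def w_def mult_single[of 0 _ 0, simplified, symmetric] by (simp add: algebra_simps)
  moreover have "Poly_Mapping.lookup (u * q) 0 = 0"
    using z[of u q] by (simp add: in_keys_iff u_def lookup_minus)
  moreover have "Poly_Mapping.lookup (w * Poly_Mapping.single 0 (Poly_Mapping.lookup p 0)) 0 = 0"
    using z[of w] by (simp add: in_keys_iff w_def lookup_minus)
  ultimately show ?thesis by (simp add: lookup_add)
qed

definition hcomp :: "int \<Rightarrow> ('k::field) mpol \<Rightarrow> 'k mpol" where
  "hcomp a p = Poly_Mapping.mapp (\<lambda>m c. if int (mono_degree m) = a then c else 0) p"

lemma lookup_hcomp: "Poly_Mapping.lookup (hcomp a p) m = (if int (mono_degree m) = a then Poly_Mapping.lookup p m else 0)"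
  by (auto simp: hcomp_def lookup_mapp when_def in_keys_iff)

lemma hcomp_add: "hcomp a (p + q) = hcomp a p + hcomp a q"
  by (rule poly_mapping_eqI) (simp add: lookup_hcomp lookup_add)

lemma hcomp_0 [simp]: "hcomp a 0 = 0"
  by (rule poly_mapping_eqI) (simp add: lookup_hcomp)

lemma hcomp_sum: "hcomp a (sum f A) = (\<Sum>i\<in>A. hcomp a (f i))"
  by (induction A rule: infinite_finite_induct) (auto simp: hcomp_add)

lemma hcomp_mem: "p \<in> carrier (poly_ring n) \<Longrightarrow> hcomp a p \<in> hom_part n a"
  by (auto simp: hom_part_iff carrier_poly_ring_iff in_keys_iff lookup_hcomp split: if_splits)

lemma hcomp_hom: "p \<in> hom_part n b \<Longrightarrow> hcomp a p = (if a = b then p else 0)"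
  by (rule poly_mapping_eqI) (auto simp: lookup_hcomp hom_part_iff in_keys_iff)

lemma hcomp_sum_all:
  assumes "finite A" "(\<lambda>m. int (mono_degree m)) ` Poly_Mapping.keys p \<subseteq> A"
  shows "p = (\<Sum>a\<in>A. hcomp a p)"
proof (rule poly_mapping_eqI)
  fix k
  have "(\<Sum>a\<in>A. Poly_Mapping.lookup (hcomp a p) k) = Poly_Mapping.lookup p k"
    using assms by (auto simp: lookup_hcomp in_keys_iff image_subset_iff)
  then show "Poly_Mapping.lookup p k = Poly_Mapping.lookup (\<Sum>a\<in>A. hcomp a p) k"
    by (simp add: lookup_sum)
qed

lemma hcomp_mult:
  assumes "q \<in> hom_part n b" shows "hcomp a (q * p) = q * hcomp (a - b) p"
proof -
  let ?A = "insert (a - b) ((\<lambda>m. int (mono_degree m)) ` Poly_Mapping.keys p)"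
  have p: "p = (\<Sum>c\<in>?A. hcomp c p)" by (rule hcomp_sum_all) auto
  have *: "hcomp a (q * hcomp c p) = (if c = a - b then q * hcomp c p else 0)" for c
  proof (rule poly_mapping_eqI)
    fix k
    show "Poly_Mapping.lookup (hcomp a (q * hcomp c p)) k = Poly_Mapping.lookup (if c = a - b then q * hcomp c p else 0) k"
    proof (cases "Poly_Mapping.lookup (q * hcomp c p) k = 0")
      case False
      then have "k \<in> Poly_Mapping.keys (q * hcomp c p)" by (simp add: in_keys_iff)
      then obtain u v where "k = u + v" "u \<in> Poly_Mapping.keys q" "v \<in> Poly_Mapping.keys (hcomp c p)"
        by (rule in_keys_mult)
      then have "int (mono_degree k) = b + c"
        using assms by (auto simp: mono_degree_add hom_part_iff in_keys_iff lookup_hcomp split: if_splits)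
      then show ?thesis by (auto simp: lookup_hcomp)
    qed (auto simp: lookup_hcomp)
  qed
  have "hcomp a (q * p) = hcomp a (\<Sum>c\<in>?A. q * hcomp c p)"
    by (subst (1) p) (simp add: sum_distrib_left)
  also have "\<dots> = (\<Sum>c\<in>?A. if c = a - b then q * hcomp c p else 0)"
    by (simp only: hcomp_sum *)
  also have "\<dots> = q * hcomp (a - b) p"
    by (subst sum.delta) auto
  finally show ?thesis .
qed

text \<open>Each monomial gives up one variable of \<open>T\<close>. With \<open>T\<close> all variables this says that \<open>\<mm>\<close> is generated by the variables; proper subsets \<open>T\<close> describe the monomial ideals in the proof that the variables form a regular sequence.\<close>

lemma hom_part_var_decomp:
  assumes p: "p \<in> hom_part n a" and T: "finite T" and meet: "\<And>m. m \<in> Poly_Mapping.keys p \<Longrightarrow> Poly_Mapping.keys m \<inter> T \<noteq> {}"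
  shows "\<exists>q. (\<forall>l\<in>T. q l \<in> hom_part n (a - 1)) \<and> p = (\<Sum>l\<in>T. var l * q l)"
proof -
  define P where "P p \<longleftrightarrow> (\<exists>q. (\<forall>l\<in>T. q l \<in> hom_part n (a - 1)) \<and> p = (\<Sum>l\<in>T. var l * q l))" for p :: "'a mpol"
  have P0: "P 0" unfolding P_def by (rule exI[of _ "\<lambda>_. 0"]) simp
  have Padd: "P (p + q)" if "P p" "P q" for p q
  proof -
    from that(1) obtain f where "\<forall>l\<in>T. f l \<in> hom_part n (a - 1)" "p = (\<Sum>l\<in>T. var l * f l)"
      unfolding P_def by blast
    moreover from that(2) obtain g where "\<forall>l\<in>T. g l \<in> hom_part n (a - 1)" "q = (\<Sum>l\<in>T. var l * g l)"
      unfolding P_def by blast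
    ultimately show ?thesis unfolding P_def
      by (intro exI[of _ "\<lambda>l. f l + g l"]) (auto simp: distrib_left sum.distrib)
  qed
  have Psingle: "P (Poly_Mapping.single m c)"
    if m: "Poly_Mapping.keys m \<subseteq> {0..n}" "int (mono_degree m) = a" "Poly_Mapping.keys m \<inter> T \<noteq> {}" for m c
  proof -
    obtain l where l: "l \<in> Poly_Mapping.keys m" "l \<in> T" using m(3) by blast
    define m' where "m' = m - Poly_Mapping.single l 1"
    have mm: "m = Poly_Mapping.single l 1 + m'"
      using l by (intro poly_mapping_eqI) (auto simp: m'_def lookup_add lookup_minus lookup_single in_keys_iff when_def)
    have "mono_degree m = 1 + mono_degree m'" by (subst mm) (simp add: mono_degree_add)
    moreover have "Poly_Mapping.keys m' \<subseteq> {0..n}" using m mm by (metis keys_add_nat le_sup_iff)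
    ultimately have m': "Poly_Mapping.single m' c \<in> hom_part n (a - 1)"
      using hom_part_single[of m' n c] m by auto
    have "Poly_Mapping.single m c = var l * Poly_Mapping.single m' c"
      by (subst mm) (simp add: var_def mult_single)
    also have "\<dots> = (\<Sum>i\<in>T. if i = l then var i * Poly_Mapping.single m' c else 0)"
      using l T by auto
    also have "\<dots> = (\<Sum>i\<in>T. var i * (if i = l then Poly_Mapping.single m' c else 0))"
      by (rule sum.cong) auto
    finally show ?thesis unfolding P_def using m' by (intro exI[of _ "\<lambda>i. if i = l then Poly_Mapping.single m' c else 0"]) auto
  qed
  have "P (\<Sum>m\<in>A. Poly_Mapping.single m (Poly_Mapping.lookup p m))" if "A \<subseteq> Poly_Mapping.keys p" for A
    using finite_subset[OF that finite_keys] that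
  proof (induction A rule: finite_induct)
    case (insert m A)
    have "Poly_Mapping.keys m \<subseteq> {0..n}" "int (mono_degree m) = a" "Poly_Mapping.keys m \<inter> T \<noteq> {}"
      using insert.prems p meet[of m] by (auto simp: hom_part_iff)
    then show ?case using insert by (auto intro!: Padd Psingle)
  qed (simp add: P0)
  from this[of "Poly_Mapping.keys p"] show ?thesis
    using sum_monomials[of p] by (simp add: P_def)
qed

lemma lookup_single_mult:
  "Poly_Mapping.lookup (Poly_Mapping.single k c * p :: ('k::field) mpol) (k + m) = c * Poly_Mapping.lookup p m"
proof -
  have "Poly_Mapping.single k c * p =
      (\<Sum>m\<in>Poly_Mapping.keys p. Poly_Mapping.single (k + m) (c * Poly_Mapping.lookup p m))"
    by (subst (1) sum_monomials[of p]) (simp add: sum_distrib_left mult_single)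
  then have "Poly_Mapping.lookup (Poly_Mapping.single k c * p) (k + m) =
      (\<Sum>m'\<in>Poly_Mapping.keys p. if m' = m then c * Poly_Mapping.lookup p m else 0)"
    by (simp only: lookup_sum, intro sum.cong) (auto simp: lookup_single)
  then show ?thesis by (auto simp: in_keys_iff)
qed

lemma keys_single_mult:
  "Poly_Mapping.keys (Poly_Mapping.single k c * p :: ('k::field) mpol) \<subseteq> (+) k ` Poly_Mapping.keys p"
  using keys_mult[of "Poly_Mapping.single k c" p] by (auto split: if_splits)

section \<open>Graded families of vectors\<close>

type_synonym 'k vec = "nat \<Rightarrow> 'k mpol"

definition vscale :: "('k::field) mpol \<Rightarrow> 'k vec \<Rightarrow> 'k vec" (infixr "\<bullet>" 75) where
  "p \<bullet> v = (\<lambda>j. p * v j)"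

interpretation vec: Modules.module "vscale :: ('k::field) mpol \<Rightarrow> 'k vec \<Rightarrow> 'k vec"
  by unfold_locales (auto simp: vscale_def fun_eq_iff algebra_simps)

text \<open>Graded submodules are handled through their homogeneous parts \<open>W e\<close> only, so that all later arguments concern homogeneous elements and never decompose an element into components.\<close>

definition graded_sub :: "nat \<Rightarrow> (int \<Rightarrow> ('k::field) vec set) \<Rightarrow> bool" where
  "graded_sub n W \<longleftrightarrow> (\<forall>e. 0 \<in> W e) \<and> (\<forall>e. \<forall>v\<in>W e. \<forall>w\<in>W e. v + w \<in> W e) \<and>
    (\<forall>a e. \<forall>p\<in>hom_part n a. \<forall>v\<in>W e. p \<bullet> v \<in> W (a + e))"

lemma gs_0: "graded_sub n W \<Longrightarrow> 0 \<in> W e"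
  and gs_add: "graded_sub n W \<Longrightarrow> v \<in> W e \<Longrightarrow> w \<in> W e \<Longrightarrow> v + w \<in> W e"
  by (auto simp: graded_sub_def)

lemma gs_scale: "graded_sub n W \<Longrightarrow> p \<in> hom_part n a \<Longrightarrow> v \<in> W e \<Longrightarrow> b = a + e \<Longrightarrow> p \<bullet> v \<in> W b"
  by (auto simp: graded_sub_def)

lemma gs_lin: "graded_sub n W \<Longrightarrow> p \<in> hom_part n 1 \<Longrightarrow> v \<in> W e \<Longrightarrow> b = e + 1 \<Longrightarrow> p \<bullet> v \<in> W b"
  by (rule gs_scale[of n W p 1 v e]) auto

lemma gs_power: "graded_sub n W \<Longrightarrow> p \<in> hom_part n 1 \<Longrightarrow> v \<in> W e \<Longrightarrow> b = e + int k \<Longrightarrow> p ^ k \<bullet> v \<in> W b"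
  by (erule gs_scale[OF _ hom_part_power1]) auto

lemma gs_uminus: "graded_sub n W \<Longrightarrow> v \<in> W e \<Longrightarrow> - v \<in> W e"
  using gs_scale[of n W "-1" 0 v e e] hom_part_uminus[of 1 n 0] by simp

lemma gs_diff: "graded_sub n W \<Longrightarrow> v \<in> W e \<Longrightarrow> w \<in> W e \<Longrightarrow> v - w \<in> W e"
  using gs_add[of n W v e "-w"] gs_uminus[of n W w e] by simp

lemma gs_sum: "graded_sub n W \<Longrightarrow> (\<And>i. i \<in> A \<Longrightarrow> f i \<in> W e) \<Longrightarrow> sum f A \<in> W e"
  by (induction A rule: infinite_finite_induct) (auto intro: gs_0 gs_add)

text \<open>The part of degree \<open>e\<close> of the submodule \<open>(z\<^sub>l : l \<in> T) E\<close>; the shift by \<open>1\<close> is the degree of the linear forms.\<close>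

definition multiples :: "(nat \<Rightarrow> ('k::field) mpol) \<Rightarrow> nat set \<Rightarrow> (int \<Rightarrow> 'k vec set) \<Rightarrow> int \<Rightarrow> 'k vec set" where
  "multiples z T E e = {(\<Sum>l\<in>T. z l \<bullet> g l) | g. \<forall>l\<in>T. g l \<in> E (e - 1)}"

lemma multiples_empty [simp]: "multiples z {} E e = {0}"
  by (auto simp: multiples_def)

lemma multiples_insert:
  assumes "finite T" "a \<notin> T"
  shows "v \<in> multiples z (insert a T) E e \<longleftrightarrow> (\<exists>u\<in>multiples z T E e. \<exists>b\<in>E (e - 1). v = u + z a \<bullet> b)"
proof
  assume "v \<in> multiples z (insert a T) E e"
  then obtain g where "\<forall>l\<in>insert a T. g l \<in> E (e - 1)" "v = (\<Sum>l\<in>insert a T. z l \<bullet> g l)"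
    unfolding multiples_def by blast
  then show "\<exists>u\<in>multiples z T E e. \<exists>b\<in>E (e - 1). v = u + z a \<bullet> b"
    using assms unfolding multiples_def
    by (intro bexI[of _ "\<Sum>l\<in>T. z l \<bullet> g l"] bexI[of _ "g a"] CollectI exI[of _ g]) (auto simp: add.commute)
next
  assume "\<exists>u\<in>multiples z T E e. \<exists>b\<in>E (e - 1). v = u + z a \<bullet> b"
  then obtain g b where g: "\<forall>l\<in>T. g l \<in> E (e - 1)" "b \<in> E (e - 1)" "v = (\<Sum>l\<in>T. z l \<bullet> g l) + z a \<bullet> b"
    by (auto simp: multiples_def)
  have "(\<Sum>l\<in>T. z l \<bullet> (g(a := b)) l) = (\<Sum>l\<in>T. z l \<bullet> g l)"
    using assms(2) by (intro sum.cong) auto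
  then show "v \<in> multiples z (insert a T) E e"
    unfolding multiples_def using g assms by (intro CollectI exI[of _ "g(a := b)"]) (auto simp: add.commute)
qed

lemma multiples_cong: "(\<And>l. l \<in> T \<Longrightarrow> z l = z' l) \<Longrightarrow> multiples z T E e = multiples z' T E e"
  by (auto simp: multiples_def cong: sum.cong)

lemma graded_sub_multiples:
  fixes E :: "int \<Rightarrow> ('k::field) vec set"
  assumes E: "graded_sub n E"
  shows "graded_sub n (multiples z T E)"
  unfolding graded_sub_def
proof (intro conjI allI ballI)
  show "0 \<in> multiples z T E e" for e
    unfolding multiples_def by (intro CollectI exI[of _ "\<lambda>_. 0"]) (auto intro: gs_0[OF E])
  fix e v assume "v \<in> multiples z T E e"
  then obtain g where g: "\<forall>l\<in>T. g l \<in> E (e - 1)" "v = (\<Sum>l\<in>T. z l \<bullet> g l)"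
    by (auto simp: multiples_def)
  { fix w assume "w \<in> multiples z T E e"
    then obtain h where h: "\<forall>l\<in>T. h l \<in> E (e - 1)" "w = (\<Sum>l\<in>T. z l \<bullet> h l)"
      by (auto simp: multiples_def)
    show "v + w \<in> multiples z T E e" unfolding multiples_def
      by (intro CollectI exI[of _ "\<lambda>l. g l + h l"]) (use g h in \<open>auto simp: vec.scale_right_distrib sum.distrib intro: gs_add[OF E]\<close>) }
  { fix a and p :: "'k mpol" assume p: "p \<in> hom_part n a"
    have "p \<bullet> v = (\<Sum>l\<in>T. z l \<bullet> (p \<bullet> g l))"
      using g by (simp add: vec.scale_sum_right mult.commute)
    then show "p \<bullet> v \<in> multiples z T E (a + e)" unfolding multiples_def
      by (intro CollectI exI[of _ "\<lambda>l. p \<bullet> g l"]) (use g p in \<open>auto intro!: gs_scale[OF E p]\<close>) }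
qed

lemma multiples_subset:
  assumes "graded_sub n E" "\<And>l. l \<in> T \<Longrightarrow> z l \<in> hom_part n 1"
  shows "multiples z T E e \<subseteq> E e"
  using assms by (auto simp: multiples_def intro!: gs_sum gs_lin)

lemma multiples_single:
  assumes "graded_sub n E" "finite T" "a \<in> T" "b \<in> E (e - 1)"
  shows "z a \<bullet> b \<in> multiples z T E e"
proof -
  have "z a \<bullet> b = (\<Sum>l\<in>T. if l = a then z l \<bullet> b else 0)" using assms by auto
  also have "\<dots> = (\<Sum>l\<in>T. z l \<bullet> (if l = a then b else 0))" by (rule sum.cong) auto
  finally show ?thesis unfolding multiples_def
    using assms gs_0[OF assms(1)] by (intro CollectI exI[of _ "\<lambda>l. if l = a then b else 0"]) auto
qed

lemma multiples_mono:
  assumes E: "graded_sub n E" and "finite T'" "T \<subseteq> T'"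
  shows "multiples z T E e \<subseteq> multiples z T' E e"
  using assms(2,3) 
  by (auto simp: multiples_def[of z T] intro!: gs_sum[OF graded_sub_multiples[OF E]] multiples_single[OF E])

lemma multiples_lessThan_Suc:
  "v \<in> multiples z {..<Suc i} E e \<longleftrightarrow> (\<exists>u\<in>multiples z {..<i} E e. \<exists>b\<in>E (e - 1). v = u + z i \<bullet> b)"
  by (simp add: lessThan_Suc multiples_insert)

text \<open>If the forms \<open>y\<^sub>l\<close> span the linear forms, this is the zeroth local cohomology of the quotient by \<open>W\<close>. The exponent may depend on \<open>l\<close>, which saves all bookkeeping with powers of the maximal ideal.\<close>

definition torsion :: "(nat \<Rightarrow> ('k::field) mpol) \<Rightarrow> nat \<Rightarrow> (int \<Rightarrow> 'k vec set) \<Rightarrow> int \<Rightarrow> 'k vec set" where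
  "torsion y N W e = {v. \<forall>l<N. \<exists>k. y l ^ k \<bullet> v \<in> W (e + int k)}"

lemma torsionI: "(\<And>l. l < N \<Longrightarrow> \<exists>k. y l ^ k \<bullet> v \<in> W (e + int k)) \<Longrightarrow> v \<in> torsion y N W e"
  by (simp add: torsion_def)

lemma torsionD: "v \<in> torsion y N W e \<Longrightarrow> l < N \<Longrightarrow> \<exists>k. y l ^ k \<bullet> v \<in> W (e + int k)"
  by (simp add: torsion_def)

lemma torsion_mono: "(\<And>e. W e \<subseteq> W' e) \<Longrightarrow> v \<in> torsion y N W e \<Longrightarrow> v \<in> torsion y N W' e"
  unfolding torsion_def by blast

lemma torsion_of_mem: "v \<in> W e \<Longrightarrow> v \<in> torsion y N W e"
  by (auto intro!: torsionI exI[of _ 0])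

lemma torsion_add:
  assumes W: "graded_sub n W" and y: "\<And>l. l < N \<Longrightarrow> y l \<in> hom_part n 1"
    and v: "v \<in> torsion y N W e" and w: "w \<in> torsion y N W e"
  shows "v + w \<in> torsion y N W e"
proof (rule torsionI)
  fix l assume l: "l < N"
  obtain a b where a: "y l ^ a \<bullet> v \<in> W (e + int a)" and b: "y l ^ b \<bullet> w \<in> W (e + int b)"
    using v w l by (meson torsionD)
  have "y l ^ b \<bullet> y l ^ a \<bullet> v \<in> W (e + int (a + b))" "y l ^ a \<bullet> y l ^ b \<bullet> w \<in> W (e + int (a + b))"
    by (rule gs_power[OF W y[OF l] a]; simp) (rule gs_power[OF W y[OF l] b]; simp)
  then have "y l ^ (a + b) \<bullet> (v + w) \<in> W (e + int (a + b))"
    using gs_add[OF W] by (simp add: vec.scale_right_distrib power_add mult.commute)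
  then show "\<exists>k. y l ^ k \<bullet> (v + w) \<in> W (e + int k)" by blast
qed

text \<open>Applied to the powers of \<open>y\<^sub>l\<close> times \<open>v\<close>: once \<open>p\<close> times such an element lies in \<open>W\<close>, the element itself is torsion, and two exponents add up.\<close>

lemma torsion_colon:
  assumes W: "graded_sub n W" and E: "graded_sub n E" and y: "\<And>l. l < N \<Longrightarrow> y l \<in> hom_part n 1"
    and almost: "\<And>v e. v \<in> E e \<Longrightarrow> p \<bullet> v \<in> W (e + 1) \<Longrightarrow> v \<in> torsion y N W e"
    and v: "v \<in> E e" "p \<bullet> v \<in> torsion y N W (e + 1)"
  shows "v \<in> torsion y N W e"
proof (rule torsionI)
  fix l assume l: "l < N"
  obtain k where "y l ^ k \<bullet> p \<bullet> v \<in> W (e + 1 + int k)" using torsionD[OF v(2) l] by blast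
  then have "p \<bullet> y l ^ k \<bullet> v \<in> W (e + int k + 1)" by (simp add: mult.commute add.commute add.left_commute)
  then have "y l ^ k \<bullet> v \<in> torsion y N W (e + int k)"
    by (intro almost gs_power[OF E y[OF l] v(1)]) auto
  from torsionD[OF this l] obtain k' where "y l ^ k' \<bullet> y l ^ k \<bullet> v \<in> W (e + int k + int k')" by blast
  then have "y l ^ (k' + k) \<bullet> v \<in> W (e + int (k' + k))" by (simp add: power_add add.commute add.left_commute)
  then show "\<exists>k. y l ^ k \<bullet> v \<in> W (e + int k)" by blast
qed

section \<open>Hyperplane sections of a free resolution\<close>

locale graded_resolution =
  fixes n N :: nat and E :: "nat \<Rightarrow> int \<Rightarrow> ('k::field) vec set" and d :: "nat \<Rightarrow> 'k vec \<Rightarrow> 'k vec"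
    and y :: "nat \<Rightarrow> 'k mpol"
  assumes E: "graded_sub n (E p)"
    and y: "l < N \<Longrightarrow> y l \<in> hom_part n 1"
    and d_in: "v \<in> E (Suc p) e \<Longrightarrow> d p v \<in> E p e"
    and d_add: "v \<in> E (Suc p) e \<Longrightarrow> w \<in> E (Suc p) e \<Longrightarrow> d p (v + w) = d p v + d p w"
    and d_scale: "q \<in> hom_part n a \<Longrightarrow> v \<in> E (Suc p) e \<Longrightarrow> d p (q \<bullet> v) = q \<bullet> d p v"
    and d_d: "v \<in> E (Suc (Suc p)) e \<Longrightarrow> d p (d (Suc p) v) = 0"
    and exact: "v \<in> E (Suc p) e \<Longrightarrow> d p v = 0 \<Longrightarrow> \<exists>w\<in>E (Suc (Suc p)) e. d (Suc p) w = v"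
    and regular: "i < N \<Longrightarrow> v \<in> E p e \<Longrightarrow> y i \<bullet> v \<in> multiples y {..<i} (E p) (e + 1) \<Longrightarrow>
      v \<in> multiples y {..<i} (E p) e"
begin

abbreviation J :: "nat \<Rightarrow> nat \<Rightarrow> int \<Rightarrow> 'k vec set" where "J p i \<equiv> multiples y {..<i} (E p)"

text \<open>\<open>Z p i\<close> and \<open>B p i\<close> are the preimages in \<open>E p\<close> of cycles and boundaries of the complex modulo \<open>y\<^sub>0, \<dots>, y\<^bsub>i-1\<^esub>\<close>. At \<open>p = 0\<close> everything is a cycle, so the quotient is the section of the resolved module.\<close>

definition Z :: "nat \<Rightarrow> nat \<Rightarrow> int \<Rightarrow> 'k vec set" where
  "Z p i e = {v \<in> E p e. \<forall>p'. p = Suc p' \<longrightarrow> d p' v \<in> J p' i e}"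

definition B :: "nat \<Rightarrow> nat \<Rightarrow> int \<Rightarrow> 'k vec set" where
  "B p i e = {d p g + h | g h. g \<in> E (Suc p) e \<and> h \<in> J p i e}"

lemma J: "graded_sub n (J p i)"
  by (rule graded_sub_multiples[OF E])

lemma J_E: "i \<le> N \<Longrightarrow> v \<in> J p i e \<Longrightarrow> v \<in> E p e"
  using multiples_subset[OF E, of "{..<i}" y p e] y by auto

lemma d_0 [simp]: "d p 0 = 0"
  using d_add[of 0 p 0 0] gs_0[OF E] by auto

lemma d_uminus: "v \<in> E (Suc p) e \<Longrightarrow> d p (- v) = - d p v"
  using d_add[of v p e "-v"] gs_uminus[OF E] by (simp add: add_eq_0_iff)

lemma d_diff: "v \<in> E (Suc p) e \<Longrightarrow> w \<in> E (Suc p) e \<Longrightarrow> d p (v - w) = d p v - d p w"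
  using d_add[of v p e "-w"] gs_uminus[OF E] by (simp add: d_uminus)

lemma d_J: "i \<le> N \<Longrightarrow> v \<in> J (Suc p) i e \<Longrightarrow> d p v \<in> J p i e"
proof (induction i arbitrary: v)
  case (Suc i)
  then obtain u b where ub: "u \<in> J (Suc p) i e" "b \<in> E (Suc p) (e - 1)" "v = u + y i \<bullet> b"
    by (auto simp: multiples_lessThan_Suc)
  have "y i \<bullet> b \<in> E (Suc p) e" using Suc.prems ub by (intro gs_lin[OF E y]) auto
  then have "d p v = d p u + y i \<bullet> d p b"
    using d_add[of u p e "y i \<bullet> b"] d_scale[OF y[of i] ub(2)] ub(1,3) Suc.prems(1) J_E[of i u "Suc p" e] by simp
  moreover have "d p u \<in> J p i e" "d p b \<in> E p (e - 1)" using Suc.IH[OF _ ub(1)] Suc.prems(1) d_in[OF ub(2)] by auto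
  ultimately show ?case unfolding multiples_lessThan_Suc by blast
qed simp

lemma B: "graded_sub n (B p i)"
  unfolding graded_sub_def
proof (intro conjI allI ballI)
  show "0 \<in> B p i e" for e
    unfolding B_def using gs_0[OF E] gs_0[OF J] by (intro CollectI exI[of _ 0]) auto
  fix e v assume "v \<in> B p i e"
  then obtain g h where v: "g \<in> E (Suc p) e" "h \<in> J p i e" "v = d p g + h" by (auto simp: B_def)
  { fix w assume "w \<in> B p i e"
    then obtain g' h' where w: "g' \<in> E (Suc p) e" "h' \<in> J p i e" "w = d p g' + h'" by (auto simp: B_def)
    show "v + w \<in> B p i e" unfolding B_def
      by (intro CollectI exI[of _ "g + g'"] exI[of _ "h + h'"])
        (use v w in \<open>auto simp: d_add intro: gs_add[OF E] gs_add[OF J]\<close>) }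
  { fix a and q :: "'k mpol" assume "q \<in> hom_part n a"
    then show "q \<bullet> v \<in> B p i (a + e)" unfolding B_def
      by (intro CollectI exI[of _ "q \<bullet> g"] exI[of _ "q \<bullet> h"])
        (use v in \<open>auto simp: d_scale vec.scale_right_distrib intro: gs_scale[OF E] gs_scale[OF J]\<close>) }
qed

lemma J_B: "v \<in> J p i e \<Longrightarrow> v \<in> B p i e"
  unfolding B_def using gs_0[OF E] by (intro CollectI exI[of _ 0] exI[of _ v]) auto

lemma d_B: "v \<in> E (Suc p) e \<Longrightarrow> d p v \<in> B p i e"
  unfolding B_def using gs_0[OF J] by (intro CollectI exI[of _ v] exI[of _ 0]) auto

lemma B_mono: assumes "i \<le> i'" shows "B p i e \<subseteq> B p i' e"
  unfolding B_def using multiples_mono[OF E, of "{..<i'}" "{..<i}" y p e] assms by auto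

lemma y_B_Suc: "i < N \<Longrightarrow> v \<in> E p e \<Longrightarrow> b = e + 1 \<Longrightarrow> y i \<bullet> v \<in> B p (Suc i) b"
  by (auto intro!: J_B multiples_single[OF E])

lemma B_Suc:
  assumes "v \<in> B p (Suc i) e" obtains u b where "u \<in> B p i e" "b \<in> E p (e - 1)" "v = u + y i \<bullet> b"
proof -
  obtain g h where v: "g \<in> E (Suc p) e" "h \<in> J p (Suc i) e" "v = d p g + h" using assms by (auto simp: B_def)
  obtain u b where "u \<in> J p i e" "b \<in> E p (e - 1)" "h = u + y i \<bullet> b" using v(2) by (auto simp: multiples_lessThan_Suc)
  with v show thesis by (intro that[of "d p g + u" b]) (auto simp: B_def add.assoc)
qed

lemma Z_E: "v \<in> Z p i e \<Longrightarrow> v \<in> E p e"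
  by (simp add: Z_def)

lemma Z_scale: "q \<in> hom_part n a \<Longrightarrow> v \<in> Z p i e \<Longrightarrow> b = a + e \<Longrightarrow> q \<bullet> v \<in> Z p i b"
  by (auto simp: Z_def d_scale intro: gs_scale[OF E] gs_scale[OF J])

lemma Z_exact: "v \<in> Z (Suc p) 0 e \<Longrightarrow> v \<in> B (Suc p) 0 e"
  using exact[of v p e] d_B[of _ "Suc p" e 0] by (auto simp: Z_def)

text \<open>The connecting map of \<open>0 \<rightarrow> F/J\<^sub>i(-1) \<rightarrow> F/J\<^sub>i \<rightarrow> F/J\<^bsub>i+1\<^esub> \<rightarrow> 0\<close>: the class of \<open>g\<close> is the image of the class of \<open>v\<close>. Regularity of \<open>y\<^sub>i\<close> is what makes \<open>g\<close> a cycle.\<close>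

lemma connecting:
  assumes i: "i < N" and v: "v \<in> Z (Suc p) (Suc i) e"
  obtains g h where "g \<in> Z p i (e - 1)" "h \<in> J p i e" "d p v = h + y i \<bullet> g" "y i \<bullet> g \<in> B p i e"
proof -
  have vE: "v \<in> E (Suc p) e" and "d p v \<in> J p (Suc i) e" using v by (auto simp: Z_def)
  then obtain h g where hg: "h \<in> J p i e" "g \<in> E p (e - 1)" "d p v = h + y i \<bullet> g"
    by (auto simp: multiples_lessThan_Suc)
  have "d p' g \<in> J p' i (e - 1)" if p: "p = Suc p'" for p'
  proof -
    have yg: "y i \<bullet> g \<in> E p e" using hg i by (intro gs_lin[OF E y]) auto
    have hE: "h \<in> E p e" using J_E[OF _ hg(1)] i by simp
    have "0 = d p' (d p v)" using d_d[of v p' e] vE p by simp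
    also have "\<dots> = d p' h + y i \<bullet> d p' g"
      using hg yg hE i y[OF i] by (simp add: d_add[of h p' e] p d_scale[of _ 1 _ _ "e - 1"])
    finally have "y i \<bullet> d p' g = - d p' h" using minus_unique[of "d p' h" "y i \<bullet> d p' g"] by simp
    moreover have "d p' h \<in> J p' i e" using d_J[of i h p'] hg i p by simp
    ultimately have "y i \<bullet> d p' g \<in> J p' i (e - 1 + 1)" using gs_uminus[OF J] by simp
    moreover have "d p' g \<in> E p' (e - 1)" using hg(2) p d_in by simp
    ultimately show ?thesis using regular[OF i] by blast
  qed
  then have gZ: "g \<in> Z p i (e - 1)" using hg by (simp add: Z_def)
  have "y i \<bullet> g = d p v - h" using hg by simp
  also have "\<dots> \<in> B p i e" using hg vE by (intro gs_diff[OF B] d_B J_B)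
  finally show thesis using that[OF gZ hg(1,3)] by blast
qed

text \<open>If \<open>y\<^sub>l\<^sup>k\<close> kills the image of \<open>v\<close> under the connecting map, then \<open>y\<^sub>l\<^sup>k v\<close> comes from a cycle of the previous section. The case \<open>k = 0\<close> is plain exactness.\<close>

lemma connecting_lift:
  assumes i: "i < N" and l: "l < N" and v: "v \<in> E (Suc p) e" and g: "g \<in> E p (e - 1)" "h \<in> J p i e" "d p v = h + y i \<bullet> g"
    and k: "y l ^ k \<bullet> g \<in> B p i (e - 1 + int k)"
  obtains g' where "g' \<in> E (Suc p) (e - 1 + int k)" "y l ^ k \<bullet> v - y i \<bullet> g' \<in> Z (Suc p) i (e + int k)"
proof -
  obtain g' h' where g': "g' \<in> E (Suc p) (e - 1 + int k)" "h' \<in> J p i (e - 1 + int k)" "y l ^ k \<bullet> g = d p g' + h'"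
    using k by (auto simp: B_def)
  have 1: "y l ^ k \<bullet> v \<in> E (Suc p) (e + int k)" by (rule gs_power[OF E y[OF l] v]) simp
  have 2: "y i \<bullet> g' \<in> E (Suc p) (e + int k)" using i g' by (intro gs_lin[OF E y]) auto
  have "d p (y l ^ k \<bullet> v - y i \<bullet> g') = y l ^ k \<bullet> (h + y i \<bullet> g) - y i \<bullet> d p g'"
    using d_diff[OF 1 2] d_scale[OF hom_part_power1[OF y[OF l]] v] d_scale[OF y[OF i] g'(1)] g(3) by simp
  also have "\<dots> = y l ^ k \<bullet> h + y i \<bullet> (y l ^ k \<bullet> g - d p g')"
    by (simp add: vec.scale_right_distrib vec.scale_right_diff_distrib mult.commute)
  also have "\<dots> = y l ^ k \<bullet> h + y i \<bullet> h'" using g' by simp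
  also have "\<dots> \<in> J p i (e + int k)"
    using i l g g' by (intro gs_add[OF J] gs_power[OF J y] gs_lin[OF J y]) auto
  finally show thesis using that[OF g'(1)] gs_diff[OF E 1 2] by (simp add: Z_def)
qed

lemma homology_vanishing_step:
  assumes i: "i < N" and v: "v \<in> Z (Suc p) (Suc i) e"
    and colon: "\<And>g. g \<in> Z p i (e - 1) \<Longrightarrow> y i \<bullet> g \<in> B p i e \<Longrightarrow> g \<in> B p i (e - 1)"
    and van: "Z (Suc p) i e \<subseteq> B (Suc p) i e"
  shows "v \<in> B (Suc p) (Suc i) e"
proof -
  obtain g h where g: "g \<in> Z p i (e - 1)" "h \<in> J p i e" "d p v = h + y i \<bullet> g" "y i \<bullet> g \<in> B p i e"
    using connecting[OF i v] .
  have "y i ^ 0 \<bullet> g \<in> B p i (e - 1 + int 0)" using colon[OF g(1,4)] by simp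
  from connecting_lift[OF i i Z_E[OF v] Z_E[OF g(1)] g(2,3) this]
  obtain g' where g': "g' \<in> E (Suc p) (e - 1)" "v - y i \<bullet> g' \<in> Z (Suc p) i e" by auto
  then have "v - y i \<bullet> g' \<in> B (Suc p) (Suc i) e" using van B_mono[of i "Suc i" "Suc p" e] by auto
  moreover have "y i \<bullet> g' \<in> B (Suc p) (Suc i) e" using g' i by (intro y_B_Suc) auto
  ultimately have "v - y i \<bullet> g' + y i \<bullet> g' \<in> B (Suc p) (Suc i) e" by (rule gs_add[OF B])
  then show ?thesis by simp
qed

text \<open>Hilbert's bound on the length of minimal resolutions: each hyperplane section raises the top homological degree by at most one.\<close>

lemma homology_zero_above: "i \<le> N \<Longrightarrow> i < p \<Longrightarrow> Z p i e \<subseteq> B p i e"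
proof (induction i arbitrary: p e)
  case 0
  then show ?case using Z_exact by (cases p) auto
next
  case (Suc i)
  then obtain p' where p: "p = Suc p'" "i < p'" by (cases p) auto
  show ?case unfolding p(1)
  proof
    fix v assume "v \<in> Z (Suc p') (Suc i) e"
    then show "v \<in> B (Suc p') (Suc i) e"
      using Suc.IH[of p' "e - 1"] Suc.IH[of "Suc p'" e] Suc.prems(1) p(2)
      by (intro homology_vanishing_step) (simp_all, blast)
  qed
qed

text \<open>Only the step from \<open>p = 0\<close> to \<open>p = 1\<close> meets the modules \<open>A\<^sub>i\<close> themselves, and there the assumption says that \<open>y\<^sub>i\<close> is injective in the relevant degrees.\<close>

lemma homology_degree_bound:
  assumes colon: "\<And>i v e. i < N \<Longrightarrow> v \<in> E 0 e \<Longrightarrow> c < e \<Longrightarrow> y i \<bullet> v \<in> B 0 i (e + 1) \<Longrightarrow> v \<in> B 0 i e"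
  shows "i \<le> N \<Longrightarrow> c + int (Suc p) < e \<Longrightarrow> Z (Suc p) i e \<subseteq> B (Suc p) i e"
proof (induction i arbitrary: p e)
  case 0
  then show ?case using Z_exact by auto
next
  case (Suc i)
  show ?case
  proof
    fix v assume v: "v \<in> Z (Suc p) (Suc i) e"
    show "v \<in> B (Suc p) (Suc i) e"
    proof (rule homology_vanishing_step[OF _ v])
      fix g assume g: "g \<in> Z p i (e - 1)" "y i \<bullet> g \<in> B p i e"
      show "g \<in> B p i (e - 1)"
      proof (cases p)
        case 0
        then show ?thesis using colon[of i g "e - 1"] g Suc.prems Z_E[OF g(1)] by simp
      next
        case (Suc p')
        then have "Z p i (e - 1) \<subseteq> B p i (e - 1)" using Suc.IH[of p' "e - 1"] Suc.prems by simp
        then show ?thesis using g(1) by blast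
      qed
    next
      show "i < N" using Suc.prems by simp
      show "Z (Suc p) i e \<subseteq> B (Suc p) i e" using Suc.IH Suc.prems by simp
    qed
  qed
qed

text \<open>Almost regularity makes the kernel of \<open>y\<^sub>i\<close> on \<open>A\<^sub>i\<close> torsion, and this propagates to the higher homology, one long exact sequence at a time.\<close>

lemma homology_torsion:
  assumes almost: "\<And>i v e. i < N \<Longrightarrow> v \<in> E 0 e \<Longrightarrow> y i \<bullet> v \<in> B 0 i (e + 1) \<Longrightarrow> v \<in> torsion y N (B 0 i) e"
  shows "i \<le> N \<Longrightarrow> Z (Suc p) i e \<subseteq> torsion y N (B (Suc p) i) e"
proof (induction i arbitrary: p e)
  case 0
  then show ?case using Z_exact torsion_of_mem by blast
next
  case (Suc i)
  then have i: "i < N" by simp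
  show ?case
  proof (intro subsetI torsionI)
    fix v l assume v: "v \<in> Z (Suc p) (Suc i) e" and l: "l < N"
    obtain g h where g: "g \<in> Z p i (e - 1)" "h \<in> J p i e" "d p v = h + y i \<bullet> g" "y i \<bullet> g \<in> B p i e"
      using connecting[OF i v] .
    have "g \<in> torsion y N (B p i) (e - 1)"
    proof (cases p)
      case 0
      then show ?thesis using almost[of i g "e - 1"] g i Z_E[OF g(1)] by simp
    next
      case (Suc p')
      then have "Z p i (e - 1) \<subseteq> torsion y N (B p i) (e - 1)" using Suc.IH[of p' "e - 1"] i by simp
      then show ?thesis using g(1) by blast
    qed
    from torsionD[OF this l] obtain k where k: "y l ^ k \<bullet> g \<in> B p i (e - 1 + int k)" by blast
    obtain g' where g': "g' \<in> E (Suc p) (e - 1 + int k)" "y l ^ k \<bullet> v - y i \<bullet> g' \<in> Z (Suc p) i (e + int k)"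
      using connecting_lift[OF i l Z_E[OF v] Z_E[OF g(1)] g(2,3) k] .
    have "y l ^ k \<bullet> v - y i \<bullet> g' \<in> torsion y N (B (Suc p) i) (e + int k)"
      using Suc.IH[of p "e + int k"] g'(2) i by fastforce
    from torsionD[OF this l] obtain k' where
      "y l ^ k' \<bullet> (y l ^ k \<bullet> v - y i \<bullet> g') \<in> B (Suc p) i (e + int k + int k')" by blast
    then have 1: "y l ^ k' \<bullet> (y l ^ k \<bullet> v - y i \<bullet> g') \<in> B (Suc p) (Suc i) (e + int k + int k')"
      using B_mono[of i "Suc i"] by auto
    have 2: "y l ^ k' \<bullet> y i \<bullet> g' \<in> B (Suc p) (Suc i) (e + int k + int k')"
      by (rule gs_power[OF B y[OF l] y_B_Suc[OF i g'(1)]]) auto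
    have "y l ^ (k' + k) \<bullet> v = y l ^ k' \<bullet> (y l ^ k \<bullet> v - y i \<bullet> g') + y l ^ k' \<bullet> y i \<bullet> g'"
      by (simp add: vec.scale_right_diff_distrib power_add)
    also have "\<dots> \<in> B (Suc p) (Suc i) (e + int (k' + k))"
      using gs_add[OF B 1 2] by (simp add: add.commute add.left_commute)
    finally show "\<exists>k. y l ^ k \<bullet> v \<in> B (Suc p) (Suc i) (e + int k)" by blast
  qed
qed

text \<open>Descending in \<open>i\<close>: vanishing for \<open>i + 1\<close> in homological degree \<open>p + 1\<close> makes \<open>y\<^sub>i\<close> injective on the homology for \<open>i\<close> in homological degree \<open>p\<close>, and an injective operator has no torsion.\<close>

lemma torsion_vanishing:
  assumes gen: "\<And>p e. c + int p < e \<Longrightarrow> E p e \<subseteq> J p N e"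
    and almost: "\<And>i v e. i < N \<Longrightarrow> v \<in> E 0 e \<Longrightarrow> y i \<bullet> v \<in> B 0 i (e + 1) \<Longrightarrow> v \<in> torsion y N (B 0 i) e"
  shows "i \<le> N \<Longrightarrow> c + int p < e \<Longrightarrow> v \<in> Z p i e \<Longrightarrow> v \<in> torsion y N (B p i) e \<Longrightarrow> v \<in> B p i e"
proof (induction i arbitrary: p e v rule: inc_induct)
  case base
  have "v \<in> J p N e" using gen[OF base(1)] Z_E[OF base(2)] by auto
  then show ?case by (rule J_B)
next
  case (step i)
  then have i: "i < N" by simp
  have inj: "g \<in> B p i e" if e: "c + int p < e" and g: "g \<in> Z p i e" and yg: "y i \<bullet> g \<in> B p i (e + 1)" for g e
  proof -
    obtain f h where f: "f \<in> E (Suc p) (e + 1)" "h \<in> J p i (e + 1)" "y i \<bullet> g = d p f + h" using yg by (auto simp: B_def)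
    then have "d p f = - h + y i \<bullet> g" by simp
    moreover have "g \<in> E p (e + 1 - 1)" using Z_E[OF g] by simp
    ultimately have "d p f \<in> J p (Suc i) (e + 1)"
      unfolding multiples_lessThan_Suc using gs_uminus[OF J f(2)] by blast
    then have fZ: "f \<in> Z (Suc p) (Suc i) (e + 1)" using f by (simp add: Z_def)
    then have "f \<in> torsion y N (B (Suc p) (Suc i)) (e + 1)"
      using homology_torsion[OF almost, of "Suc i" p "e + 1"] i by auto
    then have "f \<in> B (Suc p) (Suc i) (e + 1)" using step.IH[of "Suc p" "e + 1" f] fZ e by auto
    then obtain u b where ub: "u \<in> B (Suc p) i (e + 1)" "b \<in> E (Suc p) (e + 1 - 1)" "f = u + y i \<bullet> b" by (rule B_Suc)
    have b: "b \<in> E (Suc p) e" using ub by simp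
    obtain f' h' where f': "f' \<in> E (Suc (Suc p)) (e + 1)" "h' \<in> J (Suc p) i (e + 1)" "u = d (Suc p) f' + h'"
      using ub(1) by (auto simp: B_def)
    have h'E: "h' \<in> E (Suc p) (e + 1)" using J_E[OF _ f'(2)] i by simp
    have yb: "y i \<bullet> b \<in> E (Suc p) (e + 1)" by (rule gs_lin[OF E y[OF i] b]) simp
    have "d p f = d p h' + y i \<bullet> d p b"
      using d_add[OF gs_add[OF E d_in[OF f'(1)] h'E] yb] d_add[OF d_in[OF f'(1)] h'E] d_d[OF f'(1)]
        d_scale[OF y[OF i] b] ub(3) f'(3) by simp
    then have "y i \<bullet> (g - d p b) = d p h' + h" using f(3) by (simp add: vec.scale_right_diff_distrib)
    moreover have "d p h' + h \<in> J p i (e + 1)" using f f' i by (intro gs_add[OF J] d_J) auto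
    ultimately have "g - d p b \<in> J p i e"
      using regular[OF i gs_diff[OF E Z_E[OF g] d_in[OF b]]] by simp
    then have "g - d p b + d p b \<in> B p i e" by (intro gs_add[OF B] J_B d_B[OF b])
    then show ?thesis by simp
  qed
  have "g \<in> B p i e" if "c + int p < e" "g \<in> Z p i e" "y i ^ k \<bullet> g \<in> B p i (e + int k)" for g e k
    using that
  proof (induction k arbitrary: g e)
    case (Suc k)
    have "y i ^ k \<bullet> y i \<bullet> g \<in> B p i (e + 1 + int k)" using Suc.prems(3) by (simp add: mult.commute add.assoc)
    moreover have "y i \<bullet> g \<in> Z p i (e + 1)" by (rule Z_scale[OF y[OF i] Suc.prems(2)]) simp
    ultimately have "y i \<bullet> g \<in> B p i (e + 1)" using Suc.prems(1) Suc.IH[of "e + 1" "y i \<bullet> g"] by simp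
    then show ?case using inj[OF Suc.prems(1,2)] by simp
  qed simp
  then show ?case using torsionD[OF step.prems(3) i] step.prems by blast
qed

end

section \<open>Torsion bounds from approximations\<close>

text \<open>The heart of the theorem. In degrees above the bound for \<open>i + 1\<close>, torsion elements are divisible by \<open>y\<^sub>i\<close> with torsion quotient; after \<open>t\<close> divisions the quotient still has degree at least \<open>s\<close>, so \<open>y\<^sub>i\<^sup>t\<close> kills it.\<close>

lemma torsion_vanishing_by_approximation:
  fixes s :: int and t :: nat and E :: "int \<Rightarrow> ('k::field) vec set"
  assumes E: "graded_sub n E" and U: "graded_sub n U" "\<And>e. U e \<subseteq> E e"
    and y: "\<And>l. l < N \<Longrightarrow> y l \<in> hom_part n 1"
    and t: "1 \<le> t"
    and gen: "\<And>e. s < e \<Longrightarrow> E e \<subseteq> multiples y {..<N} E e"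
    and W_def: "\<And>i e. W i e = {u + h | u h. u \<in> U e \<and> h \<in> multiples y {..<i} E e}"
    and almost: "\<And>i v e. i < N \<Longrightarrow> v \<in> E e \<Longrightarrow> y i \<bullet> v \<in> W i (e + 1) \<Longrightarrow> v \<in> torsion y N (W i) e"
    and kill: "\<And>i v e. i < N \<Longrightarrow> s \<le> e \<Longrightarrow> v \<in> E e \<Longrightarrow> v \<in> torsion y N (W i) e \<Longrightarrow> y i ^ t \<bullet> v \<in> W i (e + int t)"
  shows "i \<le> N \<Longrightarrow> s + (int t - 1) * (int N - int i) < e \<Longrightarrow> v \<in> E e \<Longrightarrow> v \<in> torsion y N (W i) e \<Longrightarrow> v \<in> W i e"
proof (induction i arbitrary: e v rule: inc_induct)
  case base
  then have "v \<in> multiples y {..<N} E e" using gen by auto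
  then show ?case unfolding W_def using gs_0[OF U(1)] by (intro CollectI exI[of _ 0] exI[of _ v]) auto
next
  case (step i)
  then have i: "i < N" by simp
  have J: "graded_sub n (multiples y {..<i} E)" for i by (rule graded_sub_multiples[OF E])
  have W: "graded_sub n (W i)" for i
    unfolding graded_sub_def
  proof (intro conjI allI ballI)
    show "0 \<in> W i e" for e unfolding W_def using gs_0[OF U(1)] gs_0[OF J] by (intro CollectI exI[of _ 0]) auto
    fix e v assume "v \<in> W i e"
    then obtain u h where v: "u \<in> U e" "h \<in> multiples y {..<i} E e" "v = u + h" by (auto simp: W_def)
    { fix w assume "w \<in> W i e"
      then obtain u' h' where w: "u' \<in> U e" "h' \<in> multiples y {..<i} E e" "w = u' + h'" by (auto simp: W_def)
      show "v + w \<in> W i e" unfolding W_def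
        by (intro CollectI exI[of _ "u + u'"] exI[of _ "h + h'"])
          (use v w in \<open>auto intro: gs_add[OF U(1)] gs_add[OF J]\<close>) }
    { fix a and q :: "'k mpol" assume "q \<in> hom_part n a"
      then show "q \<bullet> v \<in> W i (a + e)" unfolding W_def
        by (intro CollectI exI[of _ "q \<bullet> u"] exI[of _ "q \<bullet> h"])
          (use v in \<open>auto simp: vec.scale_right_distrib intro: gs_scale[OF U(1)] gs_scale[OF J]\<close>) }
  qed
  have WE: "W i e \<subseteq> E e" for e
  proof
    fix v assume "v \<in> W i e"
    then obtain u h where uh: "u \<in> U e" "h \<in> multiples y {..<i} E e" "v = u + h" by (auto simp: W_def)
    have "h \<in> E e" using multiples_subset[OF E, of "{..<i}" y e] y i uh(2) by auto
    then show "v \<in> E e" unfolding uh(3) using U(2) uh(1) by (intro gs_add[OF E]) auto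
  qed
  have W_Suc: "\<exists>u\<in>W i e. \<exists>b\<in>E (e - 1). v = u + y i \<bullet> b" if "v \<in> W (Suc i) e" for v e
  proof -
    from that obtain u h where uh: "u \<in> U e" "h \<in> multiples y {..<Suc i} E e" "v = u + h" by (auto simp: W_def)
    then obtain h' b where "h' \<in> multiples y {..<i} E e" "b \<in> E (e - 1)" "h = h' + y i \<bullet> b"
      by (auto simp: multiples_lessThan_Suc)
    then show ?thesis using uh by (intro bexI[of _ "u + h'"] bexI[of _ b]) (auto simp: W_def add.assoc)
  qed
  have W_mono: "W i e \<subseteq> W (Suc i) e" for e
    unfolding W_def using multiples_mono[OF E, of "{..<Suc i}" "{..<i}" y e] by auto
  define c where "c = s + (int t - 1) * (int N - int (Suc i))"
  have c: "c + (int t - 1) < e" using step.prems(1) by (simp add: c_def algebra_simps)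
  have cs: "s \<le> c" unfolding c_def using t i by simp
  have descend: "\<exists>g. g \<in> E (e - 1) \<and> g \<in> torsion y N (W i) (e - 1) \<and> (\<exists>w\<in>W i e. v = w + y i \<bullet> g)"
    if "c < e" "v \<in> E e" "v \<in> torsion y N (W i) e" for e v
  proof -
    have "v \<in> torsion y N (W (Suc i)) e" by (rule torsion_mono[OF W_mono that(3)])
    then have "v \<in> W (Suc i) e" using step.IH[of e v] that by (simp add: c_def)
    then obtain w g where wg: "w \<in> W i e" "g \<in> E (e - 1)" "v = w + y i \<bullet> g" using W_Suc by blast
    have "- w \<in> torsion y N (W i) e" using gs_uminus[OF W wg(1)] by (rule torsion_of_mem)
    have "y i \<bullet> g = v + - w" using wg by simp
    also have "\<dots> \<in> torsion y N (W i) e"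
      using torsion_add[OF W y that(3) \<open>- w \<in> _\<close>] by simp
    finally have "y i \<bullet> g \<in> torsion y N (W i) (e - 1 + 1)" by simp
    then have "g \<in> torsion y N (W i) (e - 1)"
      using torsion_colon[OF W E y almost[OF i] wg(2)] by blast
    then show ?thesis using wg by blast
  qed
  have "\<exists>g. g \<in> E (e - int m) \<and> g \<in> torsion y N (W i) (e - int m) \<and> (\<exists>w\<in>W i e. v = w + y i ^ m \<bullet> g)"
    if "m \<le> t" for m
    using that
  proof (induction m)
    case 0
    then show ?case using step.prems gs_0[OF W] by (intro exI[of _ v] conjI bexI[of _ 0]) auto
  next
    case (Suc m)
    then obtain g w where g: "g \<in> E (e - int m)" "g \<in> torsion y N (W i) (e - int m)" "w \<in> W i e" "v = w + y i ^ m \<bullet> g"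
      using Suc_leD by blast
    have "c < e - int m" using c Suc.prems by linarith
    from descend[OF this g(1,2)] obtain g' w' where
      g': "g' \<in> E (e - int m - 1)" "g' \<in> torsion y N (W i) (e - int m - 1)" "w' \<in> W i (e - int m)" "g = w' + y i \<bullet> g'" by blast
    have "y i ^ m \<bullet> w' \<in> W i e" by (rule gs_power[OF W y[OF i] g'(3)]) simp
    then have "w + y i ^ m \<bullet> w' \<in> W i e" using g(3) by (intro gs_add[OF W])
    moreover have "v = (w + y i ^ m \<bullet> w') + y i ^ Suc m \<bullet> g'"
      using g g' by (simp add: vec.scale_right_distrib mult.commute)
    moreover have "e - int (Suc m) = e - int m - 1" by simp
    ultimately show ?case using g'(1,2) by metis
  qed
  from this[of t] obtain g w where g: "g \<in> E (e - int t)" "g \<in> torsion y N (W i) (e - int t)" "w \<in> W i e" "v = w + y i ^ t \<bullet> g"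
    by blast
  have "s \<le> e - int t" using c cs by linarith
  then have "y i ^ t \<bullet> g \<in> W i (e - int t + int t)" using kill[OF i _ g(1,2)] by blast
  then have "y i ^ t \<bullet> g \<in> W i e" by simp
  then show ?case unfolding g(4) by (rule gs_add[OF W g(3)])
qed

definition free_part :: "nat \<Rightarrow> int list \<Rightarrow> int \<Rightarrow> ('k::field) vec set" where
  "free_part n D e = {v. (\<forall>j < length D. v j \<in> hom_part n (e - D ! j)) \<and> (\<forall>j \<ge> length D. v j = 0)}"

lemma graded_sub_free_part: "graded_sub n (free_part n D)"
  unfolding graded_sub_def free_part_def
  by (auto simp: vscale_def add_diff_eq[symmetric] intro!: hom_part_mult)

lemma free_part_hom: "v \<in> free_part n D e \<Longrightarrow> j < length D \<Longrightarrow> v j \<in> hom_part n (e - D ! j)"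
  and free_part_zero: "v \<in> free_part n D e \<Longrightarrow> length D \<le> j \<Longrightarrow> v j = 0"
  by (auto simp: free_part_def)

lemma free_part_bounded_below: "\<exists>e0. \<forall>e<e0. free_part n D e = {0 :: ('k::field) vec}"
proof -
  have "v = 0" if v: "v \<in> free_part n D e" and e: "\<forall>x\<in>set D. e < x" for e and v :: "'k vec"
  proof
    fix j
    show "v j = 0 j"
    proof (cases "j < length D")
      case True
      then have "e - D ! j < 0" using e by simp
      from free_part_hom[OF v True, unfolded hom_part_neg[OF this]] show ?thesis by simp
    qed (use free_part_zero[OF v] in auto)
  qed
  then have zero: "free_part n D e = {0 :: 'k vec}" if "\<forall>x\<in>set D. e < x" for e
    using that gs_0[OF graded_sub_free_part] by blast
  have "\<exists>e0. \<forall>x\<in>set D. e0 \<le> (x::int)"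
    by (rule exI[of _ "Min (insert 0 (set D))"]) simp
  then obtain e0 where "\<forall>x\<in>set D. e0 \<le> x" by blast
  then show ?thesis by (intro exI[of _ e0] allI impI zero) auto
qed

lemma multiples_var_free_part:
  assumes v: "v \<in> free_part n D e" and T: "finite T"
    and meet: "\<And>j m. m \<in> Poly_Mapping.keys (v j) \<Longrightarrow> Poly_Mapping.keys m \<inter> T \<noteq> {}"
  shows "v \<in> multiples var T (free_part n D) e"
proof -
  have "\<exists>q. (\<forall>l\<in>T. q l \<in> hom_part n (e - 1 - D ! j)) \<and> v j = (\<Sum>l\<in>T. var l * q l)" if "j < length D" for j
    using hom_part_var_decomp[OF free_part_hom[OF v that] T meet] by (simp add: algebra_simps)
  then obtain q where q: "\<And>j. j < length D \<Longrightarrow> (\<forall>l\<in>T. q j l \<in> hom_part n (e - 1 - D ! j)) \<and> v j = (\<Sum>l\<in>T. var l * q j l)"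
    by metis
  define g where "g l j = (if j < length D then q j l else 0)" for l j
  have "v j = (\<Sum>l\<in>T. var l \<bullet> g l) j" for j
  proof -
    have "(\<Sum>l\<in>T. var l \<bullet> g l) j = (\<Sum>l\<in>T. var l * g l j)"
      using T by (induction T rule: finite_induct) (auto simp: vscale_def)
    then show ?thesis using q[of j] free_part_zero[OF v, of j] by (cases "j < length D") (simp_all add: g_def)
  qed
  then have "v = (\<Sum>l\<in>T. var l \<bullet> g l)" by blast
  moreover have "\<forall>l\<in>T. g l \<in> free_part n D (e - 1)" using q by (auto simp: free_part_def g_def)
  ultimately show ?thesis unfolding multiples_def by blast
qed

lemma positive_multiples_var:
  assumes v: "v \<in> free_part n D e" and "\<And>j. Poly_Mapping.lookup (v j) 0 = 0"
  shows "v \<in> multiples var {..n} (free_part n D) e"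
proof (rule multiples_var_free_part[OF v])
  fix j m assume m: "m \<in> Poly_Mapping.keys (v j)"
  then have "j < length D" using free_part_zero[OF v, of j] by (cases "j < length D") auto
  then have "Poly_Mapping.keys m \<subseteq> {0..n}" using free_part_hom[OF v] m by (auto simp: hom_part_iff)
  moreover have "m \<noteq> 0" using m assms(2)[of j] by (auto simp: in_keys_iff)
  then have "Poly_Mapping.keys m \<noteq> {}" by simp
  ultimately show "Poly_Mapping.keys m \<inter> {..n} \<noteq> {}" by fastforce
qed simp

lemma multiples_positive:
  assumes v: "v \<in> multiples z T E e" and z: "\<And>l. l \<in> T \<Longrightarrow> z l \<in> hom_part n 1"
  shows "Poly_Mapping.lookup (v j) 0 = 0"
proof -
  obtain g where v: "v = (\<Sum>l\<in>T. z l \<bullet> g l)" using v by (auto simp: multiples_def)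
  have "Poly_Mapping.lookup ((\<Sum>l\<in>T. z l \<bullet> g l) j) 0 = 0"
    using z
  proof (induction T rule: infinite_finite_induct)
    case (insert l T)
    then show ?case using hom_part_lookup_0[of "z l" n 1] by (simp add: lookup_add vscale_def lookup_mult_0)
  qed auto
  then show ?thesis using v by simp
qed

section \<open>Regular sequences of linear forms on free modules\<close>

text \<open>Regularity modulo every subset makes the notion independent of the order of the forms. This is what allows changes of coordinates one step at a time.\<close>

definition regular_family :: "(nat \<Rightarrow> ('k::field) mpol) \<Rightarrow> nat set \<Rightarrow> (int \<Rightarrow> 'k vec set) \<Rightarrow> bool" where
  "regular_family z I E \<longleftrightarrow> (\<forall>T a v e. T \<subseteq> I \<longrightarrow> a \<in> I - T \<longrightarrow> v \<in> E e \<longrightarrow>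
     z a \<bullet> v \<in> multiples z T E (e + 1) \<longrightarrow> v \<in> multiples z T E e)"

lemma regular_familyD:
  "regular_family z I E \<Longrightarrow> T \<subseteq> I \<Longrightarrow> a \<in> I \<Longrightarrow> a \<notin> T \<Longrightarrow> v \<in> E e \<Longrightarrow>
    z a \<bullet> v \<in> multiples z T E (e + 1) \<Longrightarrow> v \<in> multiples z T E e"
  unfolding regular_family_def by blast

lemma regular_family_var: "regular_family var {..n} (free_part n D)"
  unfolding regular_family_def
proof (intro allI impI)
  fix T a v e
  assume T: "T \<subseteq> {..n}" and a: "a \<in> {..n} - T" and v: "v \<in> free_part n D e"
    and av: "var a \<bullet> v \<in> multiples var T (free_part n D) (e + 1)"
  show "v \<in> multiples var T (free_part n D) e"
  proof (rule multiples_var_free_part[OF v])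
    show "finite T" using T finite_subset by blast
    fix j m assume m: "m \<in> Poly_Mapping.keys (v j)"
    obtain g where g: "var a \<bullet> v = (\<Sum>l\<in>T. var l \<bullet> g l)" using av by (auto simp: multiples_def)
    have "Poly_Mapping.single a 1 + m \<in> Poly_Mapping.keys ((var a \<bullet> v) j)"
      using m lookup_single_mult[of "Poly_Mapping.single a 1" 1 "v j" m]
      by (simp add: vscale_def var_def in_keys_iff)
    moreover have "(\<Sum>l\<in>T. var l \<bullet> g l) j = (\<Sum>l\<in>T. var l * g l j)"
      using \<open>finite T\<close> by (induction T rule: finite_induct) (auto simp: vscale_def)
    ultimately have "Poly_Mapping.single a 1 + m \<in> Poly_Mapping.keys (\<Sum>l\<in>T. var l * g l j)" using g by simp
    then obtain l where l: "l \<in> T" "Poly_Mapping.single a 1 + m \<in> Poly_Mapping.keys (var l * g l j)"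
      using keys_sum[of "\<lambda>l. var l * g l j" T] by blast
    then obtain m' where "Poly_Mapping.single a 1 + m = Poly_Mapping.single l 1 + m'"
      using keys_single_mult[of "Poly_Mapping.single l 1" 1 "g l j"] by (auto simp: var_def)
    then have "l \<in> Poly_Mapping.keys (Poly_Mapping.single a 1 + m)" by (simp add: keys_add_nat)
    moreover have "l \<noteq> a" using l a by blast
    ultimately have "l \<in> Poly_Mapping.keys m" by (auto simp: keys_add_nat)
    then show "Poly_Mapping.keys m \<inter> T \<noteq> {}" using l by blast
  qed
qed

abbreviation const :: "'k::field \<Rightarrow> 'k mpol" where "const c \<equiv> Poly_Mapping.single 0 c"

text \<open>Modulo \<open>b\<close> the new form agrees with the old one, and \<open>b\<close> can be cancelled by induction on the degree; this is why the family must be bounded below.\<close>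

lemma regular_family_shear:
  assumes E: "graded_sub n E" and bounded: "\<forall>e<e0. E e = {0}"
    and I: "finite I" "a \<in> I" "b \<in> I" "a \<noteq> b" and z: "\<And>l. l \<in> I \<Longrightarrow> z l \<in> hom_part n 1"
    and reg: "regular_family z I E"
  shows "regular_family (z(a := z a + const c * z b)) I E"
proof -
  define z' where "z' = z(a := z a + const c * z b)"
  have z'l: "z' l \<in> hom_part n 1" if "l \<in> I" for l
    using z[OF that] z[OF I(3)] hom_part_mult[OF hom_part_const z[OF I(3)], of c] by (auto simp: z'_def)
  have same: "multiples z' T E e = multiples z T E e" if "a \<notin> T" for T e
    using that by (intro multiples_cong) (auto simp: z'_def)
  have J: "graded_sub n (multiples z T E)" for T by (rule graded_sub_multiples[OF E])
  have z'a: "z' a \<bullet> v = z a \<bullet> v + z b \<bullet> const c \<bullet> v" for v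
    by (simp add: z'_def vec.scale_left_distrib mult.commute)
  have cE: "const c \<bullet> v \<in> E e" if "v \<in> E e" for v e
    by (rule gs_scale[OF E hom_part_const that]) simp
  have A1: "v \<in> multiples z T E e"
    if T: "T \<subseteq> I - {a}" "b \<in> T" and v: "v \<in> E e" "z' a \<bullet> v \<in> multiples z T E (e + 1)" for T v e
  proof -
    have "finite T" using T I(1) finite_subset by blast
    have "z b \<bullet> const c \<bullet> v \<in> multiples z T E (e + 1)"
      using T cE[OF v(1)] by (intro multiples_single[OF E \<open>finite T\<close>]) auto
    then have "z' a \<bullet> v - z b \<bullet> const c \<bullet> v \<in> multiples z T E (e + 1)" using v(2) by (intro gs_diff[OF J])
    then have "z a \<bullet> v \<in> multiples z T E (e + 1)" by (simp add: z'a)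
    then show ?thesis using T I by (intro regular_familyD[OF reg _ I(2) _ v(1)]) auto
  qed
  have A2: "v \<in> multiples z T E e"
    if T: "T \<subseteq> I - {a}" "b \<notin> T" and "v \<in> E e" "z' a \<bullet> v \<in> multiples z T E (e + 1)" "nat (e - e0 + 1) = k" for T v e k
    using that(3-5)
  proof (induction k arbitrary: v e)
    case 0
    then have "v = 0" using bounded by auto
    show ?case unfolding \<open>v = 0\<close> by (rule gs_0[OF J])
  next
    case (Suc k)
    have fin: "finite T" using T I(1) finite_subset by blast
    have "multiples z T E (e + 1) \<subseteq> multiples z (insert b T) E (e + 1)" using fin by (intro multiples_mono[OF E]) auto
    then have "v \<in> multiples z (insert b T) E e" using A1[of "insert b T" v e] T I Suc.prems by auto
    then obtain u w where uw: "u \<in> multiples z T E e" "w \<in> E (e - 1)" "v = u + z b \<bullet> w"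
      using T fin by (auto simp: multiples_insert)
    have "z' a \<bullet> u \<in> multiples z T E (e + 1)" by (rule gs_lin[OF J z'l[OF I(2)] uw(1)]) simp
    then have "z' a \<bullet> v - z' a \<bullet> u \<in> multiples z T E (e + 1)" using Suc.prems(2) by (intro gs_diff[OF J])
    moreover have "z' a \<bullet> v - z' a \<bullet> u = z b \<bullet> z' a \<bullet> w"
      unfolding uw(3) by (simp add: vec.scale_right_distrib mult.commute)
    ultimately have "z b \<bullet> z' a \<bullet> w \<in> multiples z T E (e + 1)" by simp
    moreover have "z' a \<bullet> w \<in> E e" by (rule gs_lin[OF E z'l[OF I(2)] uw(2)]) simp
    ultimately have "z' a \<bullet> w \<in> multiples z T E e" using T I(3) regular_familyD[OF reg, of T b "z' a \<bullet> w" e] by blast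
    then have "w \<in> multiples z T E (e - 1)" using uw(2) Suc.prems(3) Suc.IH[of w "e - 1"] by simp
    then have "z b \<bullet> w \<in> multiples z T E e" by (rule gs_lin[OF J z[OF I(3)]]) simp
    then show ?case unfolding uw(3) by (intro gs_add[OF J] uw(1))
  qed
  have A: "v \<in> multiples z T E e"
    if "T \<subseteq> I - {a}" and "v \<in> E e" "z' a \<bullet> v \<in> multiples z T E (e + 1)" for T v e
    using A1[OF that(1) _ that(2,3)] A2[OF that(1) _ that(2,3) refl] by blast
  have "v \<in> multiples z' T E e"
    if T: "T \<subseteq> I" and d: "d \<in> I - T" and v: "v \<in> E e" "z' d \<bullet> v \<in> multiples z' T E (e + 1)" for T d v e
  proof (cases "a \<in> T")
    case False
    then have m: "z' d \<bullet> v \<in> multiples z T E (e + 1)" using v(2) same by simp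
    show ?thesis
    proof (cases "d = a")
      case True
      then have "v \<in> multiples z T E e" using A T False v(1) m by blast
      then show ?thesis using same False by simp
    next
      case d': False
      then have "v \<in> multiples z T E e" using regular_familyD[OF reg T, of d v e] m d v(1) by (simp add: z'_def)
      then show ?thesis using same False by simp
    qed
  next
    case True
    define T0 where "T0 = T - {a}"
    have T0: "T = insert a T0" "a \<notin> T0" "finite T0" "T0 \<subseteq> I - {a}" "d \<noteq> a" "d \<notin> T0" "d \<in> I"
      using True T d I(1) finite_subset by (auto simp: T0_def)
    have zd: "z' d = z d" using T0 by (simp add: z'_def)
    obtain u q where uq: "u \<in> multiples z T0 E (e + 1)" "q \<in> E (e + 1 - 1)" "z d \<bullet> v = u + z' a \<bullet> q"
      using v(2) T0 same[OF T0(2)] by (auto simp: multiples_insert zd)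
    have q: "q \<in> E e" using uq by simp
    have "z' a \<bullet> q = z d \<bullet> v - u" using uq(3) by simp
    also have "\<dots> \<in> multiples z (insert d T0) E (e + 1)"
    proof (rule gs_diff[OF J])
      show "z d \<bullet> v \<in> multiples z (insert d T0) E (e + 1)"
        using multiples_single[OF E, of "insert d T0" d v "e + 1"] T0(3) v(1) by simp
      show "u \<in> multiples z (insert d T0) E (e + 1)"
        using multiples_mono[OF E, of "insert d T0" T0 z "e + 1"] T0(3) uq(1) by blast
    qed
    finally have "q \<in> multiples z (insert d T0) E e" using A[OF _ q] T0 by blast
    then obtain u' q' where uq': "u' \<in> multiples z T0 E e" "q' \<in> E (e - 1)" "q = u' + z d \<bullet> q'"
      unfolding multiples_insert[OF T0(3,6)] by blast
    have "z d \<bullet> (v - z' a \<bullet> q') = u + z' a \<bullet> u'"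
      unfolding vec.scale_right_diff_distrib uq(3) uq'(3) by (simp add: vec.scale_right_distrib mult.commute)
    also have "\<dots> \<in> multiples z T0 E (e + 1)"
      using gs_lin[OF J z'l[OF I(2)] uq'(1)] uq(1) by (intro gs_add[OF J]) auto
    finally have m: "z d \<bullet> (v - z' a \<bullet> q') \<in> multiples z T0 E (e + 1)" .
    have "z' a \<bullet> q' \<in> E e" by (rule gs_lin[OF E z'l[OF I(2)] uq'(2)]) simp
    then have "v - z' a \<bullet> q' \<in> multiples z T0 E e"
      using T0 v(1) by (intro regular_familyD[OF reg _ _ _ _ m] gs_diff[OF E]) auto
    then have "v - z' a \<bullet> q' \<in> multiples z' T0 E e" using same T0 by simp
    moreover have "v = (v - z' a \<bullet> q') + z' a \<bullet> q'" by simp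
    ultimately show ?thesis unfolding T0(1) multiples_insert[OF T0(3,2)] using uq'(2) by blast
  qed
  then show ?thesis unfolding regular_family_def z'_def by blast
qed

lemma multiples_shear_subset:
  assumes E: "graded_sub n E" and I: "finite I" "a \<in> I" "b \<in> I" "a \<noteq> b"
  shows "multiples z I E e \<subseteq> multiples (z(a := z a + const c * z b)) I E e"
proof
  define z' where "z' = z(a := z a + const c * z b)"
  have J': "graded_sub n (multiples z' T E)" for T by (rule graded_sub_multiples[OF E])
  fix v assume "v \<in> multiples z I E e"
  then obtain g where g: "\<forall>l\<in>I. g l \<in> E (e - 1)" "v = (\<Sum>l\<in>I. z l \<bullet> g l)" by (auto simp: multiples_def)
  have "z l \<bullet> g l \<in> multiples z' I E e" if l: "l \<in> I" for l
  proof (cases "l = a")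
    case True
    have "const c \<bullet> g a \<in> E (e - 1)" using g I by (intro gs_scale[OF E hom_part_const]) auto
    then have "z' a \<bullet> g a - z' b \<bullet> const c \<bullet> g a \<in> multiples z' I E e"
      using g I by (intro gs_diff[OF J'] multiples_single[OF E]) auto
    then show ?thesis using True I by (simp add: z'_def vec.scale_left_distrib mult.commute)
  next
    case False
    then show ?thesis using multiples_single[OF E I(1) l, of "g l" e z'] g l by (auto simp: z'_def)
  qed
  then show "v \<in> multiples (z(a := z a + const c * z b)) I E e"
    unfolding g(2) z'_def by (intro gs_sum[OF J'[unfolded z'_def]])
qed

text \<open>Points of the moment curve, so that any \<open>n - i + 1\<close> of these forms span \<open>x\<^sub>i, \<dots>, x\<^sub>n\<close>.\<close>

definition lin_form :: "nat \<Rightarrow> nat \<Rightarrow> 'k::field \<Rightarrow> 'k mpol" where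
  "lin_form n i c = (\<Sum>j\<in>{i..n}. const (c ^ (j - i)) * var j)"

lemma hom_part_lin_form: "lin_form n i c \<in> hom_part n 1"
  unfolding lin_form_def
proof (rule hom_part_sum)
  fix j assume "j \<in> {i..n}"
  then show "const (c ^ (j - i)) * var j \<in> hom_part n 1"
    using hom_part_mult[OF hom_part_const hom_part_var, of j n "c ^ (j - i)"] by auto
qed

text \<open>The triangular system is reached from the variables by shears: first \<open>y\<^sub>0\<close> is built from \<open>x\<^sub>0\<close> term by term, then \<open>y\<^sub>1\<close>, and so on, each time adding multiples of variables that are still unchanged.\<close>

lemma lin_forms_regular:
  fixes n :: nat and c :: "nat \<Rightarrow> 'k::field"
  defines "y \<equiv> \<lambda>l. lin_form n l (c l)"
  shows "regular_family y {..n} (free_part n D)"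
    and "multiples var {..n} (free_part n D) e \<subseteq> multiples y {..n} (free_part n D) e"
proof -
  define F where "F = (free_part n D :: int \<Rightarrow> 'k vec set)"
  have E: "graded_sub n F" unfolding F_def by (rule graded_sub_free_part)
  obtain e0 where e0: "\<forall>e<e0. F e = {0}" using free_part_bounded_below unfolding F_def by blast
  define good where "good z \<longleftrightarrow> (\<forall>l\<le>n. z l \<in> hom_part n 1) \<and> regular_family z {..n} F \<and>
    (\<forall>e. multiples var {..n} F e \<subseteq> multiples z {..n} F e)" for z
  have shear: "good (z(a := z a + const k * z b))" if "good z" "a \<le> n" "b \<le> n" "a \<noteq> b" for z a b k
    using that regular_family_shear[OF E e0, of "{..n}" a b z k] multiples_shear_subset[OF E, of "{..n}" a b z _ k]
      hom_part_mult[OF hom_part_const, of "z b" n 1 k]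
    unfolding good_def by (auto intro!: hom_part_add) blast
  define mixed where "mixed i l = (if l < i then y l else var l)" for i l
  have "good (mixed i)" if "i \<le> Suc n" for i
    using that
  proof (induction i)
    case 0
    have "mixed 0 = var" by (simp add: mixed_def fun_eq_iff)
    then show ?case using regular_family_var[of n D] by (simp add: good_def F_def)
  next
    case (Suc i)
    define partial where "partial k = (mixed i)(i := (\<Sum>j\<in>{i..i + k}. const (c i ^ (j - i)) * var j))" for k
    have "good (partial k)" if "i + k \<le> n" for k
      using that
    proof (induction k)
      case 0
      have "partial 0 = mixed i" by (auto simp: partial_def mixed_def fun_eq_iff)
      then show ?case using Suc by simp
    next
      case (Suc k)
      have "partial (Suc k) = (partial k)(i := partial k i + const (c i ^ Suc k) * partial k (i + Suc k))"
        by (auto simp: partial_def mixed_def fun_eq_iff)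
      moreover have "good (partial k)" "i \<le> n" "i + Suc k \<le> n" "i \<noteq> i + Suc k" using Suc by auto
      ultimately show ?case using shear by metis
    qed
    moreover have "partial (n - i) = mixed (Suc i)"
      using Suc.prems by (auto simp: partial_def mixed_def fun_eq_iff y_def lin_form_def)
    ultimately show ?case using Suc.prems by (metis Suc_le_mono le_add_diff_inverse order_refl)
  qed
  from this[of "Suc n"] have good: "good (mixed (Suc n))" by simp
  have same: "multiples (mixed (Suc n)) T F = multiples y T F" if "T \<subseteq> {..n}" for T
    using that by (intro ext multiples_cong) (auto simp: mixed_def)
  have y: "mixed (Suc n) l = y l" if "l \<in> {..n}" for l using that by (simp add: mixed_def)
  have reg: "regular_family (mixed (Suc n)) {..n} F"
    and sub: "multiples var {..n} F e \<subseteq> multiples (mixed (Suc n)) {..n} F e"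
    using good by (auto simp: good_def)
  show "multiples var {..n} (free_part n D) e \<subseteq> multiples y {..n} (free_part n D) e"
    using sub same[of "{..n}"] by (simp add: F_def)
  show "regular_family y {..n} (free_part n D)"
    unfolding regular_family_def
  proof (intro allI impI)
    fix T a v e
    assume "T \<subseteq> {..n}" "a \<in> {..n} - T" "v \<in> free_part n D e"
      "y a \<bullet> v \<in> multiples y T (free_part n D) (e + 1)"
    then show "v \<in> multiples y T (free_part n D) e"
      using regular_familyD[OF reg, of T a v e] same[of T] y[of a] by (simp add: F_def)
  qed
qed

section \<open>Finite generation of graded submodules\<close>

lemma nat_seq_nondecreasing_subseq:
  fixes s :: "nat \<Rightarrow> nat"
  shows "\<exists>r :: nat \<Rightarrow> nat. strict_mono r \<and> (\<forall>i j. i \<le> j \<longrightarrow> s (r i) \<le> s (r j))"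
proof -
  obtain f where f: "strict_mono f" "monoseq (\<lambda>k. s (f k))" using seq_monosub by blast
  show ?thesis
  proof (cases "\<forall>i j. i \<le> j \<longrightarrow> s (f i) \<le> s (f j)")
    case False
    then have dec: "s (f j) \<le> s (f i)" if "i \<le> j" for i j using f(2) that unfolding monoseq_def by blast
    obtain k where k: "\<And>j. s (f k) \<le> s (f j)" using ex_has_least_nat[of "\<lambda>_. True" 0 "\<lambda>k. s (f k)"] by auto
    have "s (f (k + i)) \<le> s (f (k + j))" for i j
      using dec[of k "k + i"] k[of "k + j"] by linarith
    moreover have "strict_mono (\<lambda>i. f (k + i))" using f(1) by (simp add: strict_mono_def)
    ultimately show ?thesis by blast
  qed (use f in blast)
qed

lemma dickson:
  fixes s :: "nat \<Rightarrow> nat \<Rightarrow> nat"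
  shows "\<exists>r :: nat \<Rightarrow> nat. strict_mono r \<and> (\<forall>l<N. \<forall>i j. i \<le> j \<longrightarrow> s (r i) l \<le> s (r j) l)"
proof (induction N)
  case 0
  then show ?case by (intro exI[of _ id]) (auto simp: strict_mono_def)
next
  case (Suc N)
  then obtain r :: "nat \<Rightarrow> nat" where r: "strict_mono r" "\<forall>l<N. \<forall>i j. i \<le> j \<longrightarrow> s (r i) l \<le> s (r j) l" by blast
  obtain r' :: "nat \<Rightarrow> nat" where r': "strict_mono r'" "\<forall>i j. i \<le> j \<longrightarrow> s (r (r' i)) N \<le> s (r (r' j)) N"
    using nat_seq_nondecreasing_subseq[of "\<lambda>k. s (r k) N"] by blast
  have "r' i \<le> r' j" if "i \<le> j" for i j using r'(1) that by (simp add: strict_mono_less_eq)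
  then show ?case using r r'
    by (intro exI[of _ "r \<circ> r'"]) (auto simp: strict_mono_def less_Suc_eq)
qed

text \<open>A term of a free module is a basis index together with a monomial.\<close>

definition term_dvd :: "nat \<times> (nat \<Rightarrow>\<^sub>0 nat) \<Rightarrow> nat \<times> (nat \<Rightarrow>\<^sub>0 nat) \<Rightarrow> bool" where
  "term_dvd a b \<longleftrightarrow> fst a = fst b \<and> (\<exists>m. snd b = snd a + m)"

definition free_terms :: "nat \<Rightarrow> nat \<Rightarrow> (nat \<times> (nat \<Rightarrow>\<^sub>0 nat)) set" where
  "free_terms n L = {a. fst a < L \<and> Poly_Mapping.keys (snd a) \<subseteq> {0..n}}"

text \<open>Dickson's lemma for terms. The index \<open>i\<close> is forced to agree by treating \<open>i\<close> and \<open>L - i\<close> as two further exponents.\<close>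

lemma term_dvd_sequence:
  fixes q :: "nat \<Rightarrow> nat \<times> (nat \<Rightarrow>\<^sub>0 nat)"
  assumes "\<And>k. q k \<in> free_terms n L"
  shows "\<exists>a b. a < b \<and> term_dvd (q a) (q b)"
proof -
  define s where "s k l = (if l \<le> n then Poly_Mapping.lookup (snd (q k)) l else if l = n + 1 then fst (q k) else L - fst (q k))" for k l
  obtain r :: "nat \<Rightarrow> nat" where r: "strict_mono r" "\<forall>l<n+3. \<forall>i j. i \<le> j \<longrightarrow> s (r i) l \<le> s (r j) l" using dickson by blast
  define a b where "a = r 0" and "b = r 1"
  have ab: "a < b" using r(1) by (simp add: a_def b_def strict_mono_def)
  have le: "s a l \<le> s b l" if "l < n + 3" for l using r(2) that by (simp add: a_def b_def)
  have fst: "fst (q a) = fst (q b)"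
    using le[of "n + 1"] le[of "n + 2"] assms[of a] assms[of b] by (auto simp: s_def free_terms_def)
  have "Poly_Mapping.lookup (snd (q a)) l \<le> Poly_Mapping.lookup (snd (q b)) l" for l
  proof (cases "l \<le> n")
    case True
    then show ?thesis using le[of l] by (simp add: s_def)
  next
    case False
    then have "l \<notin> Poly_Mapping.keys (snd (q a))" using assms[of a] by (auto simp: free_terms_def)
    then show ?thesis by (simp add: in_keys_iff)
  qed
  then have "snd (q b) = snd (q a) + (snd (q b) - snd (q a))"
    by (intro poly_mapping_eqI) (simp add: lookup_add lookup_minus)
  then show ?thesis using ab fst unfolding term_dvd_def by blast
qed

lemma finite_term_basis:
  assumes "Q \<subseteq> free_terms n L"
  shows "\<exists>B. finite B \<and> B \<subseteq> Q \<and> (\<forall>q\<in>Q. \<exists>b\<in>B. term_dvd b q)"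
proof (rule ccontr)
  assume none: "\<not> ?thesis"
  define h where "h B = (SOME q. q \<in> Q \<and> (\<forall>b\<in>B. \<not> term_dvd b q))" for B
  have h: "h B \<in> Q \<and> (\<forall>b\<in>B. \<not> term_dvd b (h B))" if "finite B" "B \<subseteq> Q" for B
    unfolding h_def
  proof (rule someI_ex, rule ccontr)
    assume "\<nexists>q. q \<in> Q \<and> (\<forall>b\<in>B. \<not> term_dvd b q)"
    then have "\<forall>q\<in>Q. \<exists>b\<in>B. term_dvd b q" by blast
    with that have "finite B \<and> B \<subseteq> Q \<and> (\<forall>q\<in>Q. \<exists>b\<in>B. term_dvd b q)" by (intro conjI)
    then have "\<exists>B. finite B \<and> B \<subseteq> Q \<and> (\<forall>q\<in>Q. \<exists>b\<in>B. term_dvd b q)" by (rule exI)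
    with none show False by (rule notE)
  qed
  define X where "X k = ((\<lambda>B. insert (h B) B) ^^ k) {}" for k
  have X: "finite (X k) \<and> X k \<subseteq> Q" for k
  proof (induction k)
    case (Suc k)
    then show ?case using h[of "X k"] by (simp add: X_def)
  qed (simp add: X_def)
  have mono: "h (X a) \<in> X b" if "a < b" for a b
    using that by (induction b) (auto simp: X_def less_Suc_eq)
  obtain a b where "a < b" "term_dvd (h (X a)) (h (X b))"
    using term_dvd_sequence[of "\<lambda>k. h (X k)" n L] h[OF conjunct1[OF X] conjunct2[OF X]] assms by blast
  then show False using h[OF conjunct1[OF X] conjunct2[OF X], of b] mono[of a b] by simp
qed

definition term_less :: "nat \<times> (nat \<Rightarrow>\<^sub>0 nat) \<Rightarrow> nat \<times> (nat \<Rightarrow>\<^sub>0 nat) \<Rightarrow> bool" where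
  "term_less a b \<longleftrightarrow> fst b < fst a \<or> fst a = fst b \<and> snd a < snd b"

lemma mono_zero_le: "(0 :: nat \<Rightarrow>\<^sub>0 nat) \<le> m"
proof -
  have "\<not> m < 0" by transfer (auto simp: less_fun_def)
  then show ?thesis by simp
qed

text \<open>A monomial order on finitely many variables is well-founded because it extends divisibility.\<close>

lemma wf_term_less: "wf {(a, b). a \<in> free_terms n L \<and> b \<in> free_terms n L \<and> term_less a b}"
  unfolding wf_iff_no_infinite_down_chain
proof
  assume "\<exists>f. \<forall>i. (f (Suc i), f i) \<in> {(a, b). a \<in> free_terms n L \<and> b \<in> free_terms n L \<and> term_less a b}"
  then obtain f where f: "\<And>i. f i \<in> free_terms n L" "\<And>i. term_less (f (Suc i)) (f i)" by blast
  have less: "term_less (f (Suc (i + k))) (f i)" for i k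
  proof (induction k)
    case (Suc k)
    then show ?case using f(2)[of "Suc (i + k)"] by (auto simp: term_less_def)
  qed (simp add: f)
  obtain a b where ab: "a < b" "term_dvd (f a) (f b)" using term_dvd_sequence[OF f(1)] by blast
  then obtain k where "b = Suc (a + k)" using less_imp_Suc_add by blast
  then have "term_less (f b) (f a)" using less by simp
  moreover obtain m where "snd (f b) = snd (f a) + m" "fst (f a) = fst (f b)" using ab(2) by (auto simp: term_dvd_def)
  moreover have "snd (f a) \<le> snd (f a) + m" using add_left_mono[OF mono_zero_le, of "snd (f a)" m] by simp
  ultimately show False by (auto simp: term_less_def)
qed

definition lead :: "('k::field) vec \<Rightarrow> nat \<times> (nat \<Rightarrow>\<^sub>0 nat) \<Rightarrow> bool" where
  "lead v a \<longleftrightarrow> (\<forall>j<fst a. v j = 0) \<and> snd a \<in> Poly_Mapping.keys (v (fst a)) \<and> (\<forall>m\<in>Poly_Mapping.keys (v (fst a)). m \<le> snd a)"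

lemma lead_exists:
  assumes "v \<noteq> 0" shows "\<exists>a. lead v a"
proof -
  have ex: "\<exists>j. v j \<noteq> 0" using assms by (auto simp: fun_eq_iff)
  define i where "i = (LEAST j. v j \<noteq> 0)"
  have i: "v i \<noteq> 0" "\<forall>j<i. v j = 0" using LeastI_ex[OF ex] not_less_Least unfolding i_def by blast+
  then have "Poly_Mapping.keys (v i) \<noteq> {}" by simp
  then have "lead v (i, Max (Poly_Mapping.keys (v i)))" using i by (auto simp: lead_def)
  then show ?thesis by blast
qed

lemma lead_free_terms: "v \<in> free_part n D e \<Longrightarrow> lead v a \<Longrightarrow> a \<in> free_terms n (length D)"
  and lead_degree: "v \<in> free_part n D e \<Longrightarrow> lead v a \<Longrightarrow> int (mono_degree (snd a)) = e - D ! fst a"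
proof -
  assume v: "v \<in> free_part n D e" and a: "lead v a"
  have "fst a < length D" using a free_part_zero[OF v] by (cases "fst a < length D") (auto simp: lead_def)
  then show "a \<in> free_terms n (length D)" "int (mono_degree (snd a)) = e - D ! fst a"
    using a free_part_hom[OF v] by (auto simp: lead_def hom_part_iff free_terms_def)
qed

lemma lead_cancel:
  assumes v: "lead v (i, m0 + m)" and w: "lead w (i, m0)"
  defines "u \<equiv> Poly_Mapping.single m (Poly_Mapping.lookup (v i) (m0 + m) / Poly_Mapping.lookup (w i) m0) \<bullet> w"
  assumes a: "lead (v - u) a"
  shows "term_less a (i, m0 + m)"
proof -
  have ui: "u j = Poly_Mapping.single m (Poly_Mapping.lookup (v i) (m0 + m) / Poly_Mapping.lookup (w i) m0) * w j" for j
    by (simp add: u_def vscale_def)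
  have zero: "(v - u) j = 0" if "j < i" for j using v w that by (simp add: lead_def ui)
  then have "i \<le> fst a" using a by (force simp: lead_def not_le[symmetric])
  show ?thesis
  proof (cases "i < fst a")
    case False
    then have ia: "fst a = i" using \<open>i \<le> fst a\<close> by simp
    have "Poly_Mapping.lookup (w i) m0 \<noteq> 0" using w by (simp add: lead_def in_keys_iff)
    then have "Poly_Mapping.lookup ((v - u) i) (m0 + m) = 0"
      by (simp add: lookup_minus ui lookup_single_mult add.commute[of m0 m])
    then have "snd a \<noteq> m0 + m" using a ia by (auto simp: lead_def in_keys_iff)
    moreover have "snd a \<le> m0 + m"
    proof -
      have "snd a \<in> Poly_Mapping.keys (v i) \<union> Poly_Mapping.keys (u i)"
        using a ia keys_diff[of "v i" "u i"] by (auto simp: lead_def)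
      then consider "snd a \<in> Poly_Mapping.keys (v i)" | m' where "snd a = m + m'" "m' \<in> Poly_Mapping.keys (w i)"
        using keys_single_mult[of m _ "w i"] by (auto simp: ui)
      then show ?thesis
      proof cases
        case 2
        then have "m' \<le> m0" using w by (auto simp: lead_def)
        then show ?thesis using 2 add_right_mono[of m' m0 m] by (simp add: add.commute)
      qed (use v in \<open>auto simp: lead_def\<close>)
    qed
    ultimately show ?thesis using ia by (simp add: term_less_def)
  qed (simp add: term_less_def)
qed

text \<open>Reduction by elements whose leading terms form a finite basis of all leading terms. The conclusion, in terms of all graded submodules \<open>W\<close>, is the form in which both the chain condition and the generators of kernels follow at once.\<close>

theorem graded_submodule_fg:
  fixes K :: "int \<Rightarrow> ('k::field) vec set"
  assumes K: "graded_sub n K" and KF: "\<And>e. K e \<subseteq> free_part n D e"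
  shows "\<exists>B. finite B \<and> (\<forall>(e, v)\<in>B. v \<in> K e) \<and>
    (\<forall>W. graded_sub n W \<longrightarrow> (\<forall>(e, v)\<in>B. v \<in> W e) \<longrightarrow> (\<forall>e. K e \<subseteq> W e))"
proof -
  define Q where "Q = {a. \<exists>e. \<exists>v\<in>K e. lead v a}"
  have "Q \<subseteq> free_terms n (length D)"
  proof
    fix a assume "a \<in> Q"
    then obtain e v where "v \<in> K e" "lead v a" unfolding Q_def mem_Collect_eq by (elim exE bexE)
    then show "a \<in> free_terms n (length D)" using lead_free_terms[OF subsetD[OF KF]] by metis
  qed
  from finite_term_basis[OF this] obtain B0 where
    B0: "finite B0" "B0 \<subseteq> Q" "\<forall>q\<in>Q. \<exists>b\<in>B0. term_dvd b q" by (elim exE conjE)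
  define g where "g b = (SOME ev. snd ev \<in> K (fst ev) \<and> lead (snd ev) b)" for b
  have g: "snd (g b) \<in> K (fst (g b)) \<and> lead (snd (g b)) b" if "b \<in> B0" for b
  proof -
    have "b \<in> Q" using that B0(2) by (rule subsetD[rotated])
    then obtain e v where "v \<in> K e" "lead v b" unfolding Q_def mem_Collect_eq by (elim exE bexE)
    then have "snd (e, v) \<in> K (fst (e, v)) \<and> lead (snd (e, v)) b" by simp
    then show ?thesis unfolding g_def by (rule someI)
  qed
  have "v \<in> W e" if W: "graded_sub n W" "\<forall>(e, v)\<in>g ` B0. v \<in> W e" and "v \<in> K e" for W e and v :: "'k vec"
  proof -
    have *: "\<forall>v e. v \<in> K e \<longrightarrow> lead v a \<longrightarrow> v \<in> W e" for a
    proof (induction a rule: wf_induct_rule[OF wf_term_less[of n "length D"]])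
      case (1 a)
      show ?case
      proof (intro allI impI)
        fix v e assume v: "v \<in> K e" "lead v a"
        then have "a \<in> Q" unfolding Q_def by blast
        with B0(3) obtain b where b: "b \<in> B0" "term_dvd b a" by (elim ballE bexE) auto
        then obtain m where m: "snd a = snd b + m" "fst a = fst b" by (auto simp: term_dvd_def)
        define w where "w = snd (g b)"
        define ew where "ew = fst (g b)"
        have w: "w \<in> K ew" "lead w b" "w \<in> W ew" using g[OF b(1)] W(2) b(1) by (auto simp: w_def ew_def)
        define c where "c = Poly_Mapping.lookup (v (fst a)) (snd b + m) / Poly_Mapping.lookup (w (fst a)) (snd b)"
        have deg: "e = int (mono_degree m) + ew"
          using lead_degree[OF subsetD[OF KF v(1)] v(2)] lead_degree[OF subsetD[OF KF w(1)] w(2)] m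
          by (simp add: mono_degree_add)
        have "Poly_Mapping.keys m \<subseteq> {0..n}"
          using lead_free_terms[OF subsetD[OF KF v(1)] v(2)] m by (auto simp: free_terms_def keys_add_nat)
        then have hom: "Poly_Mapping.single m c \<in> hom_part n (int (mono_degree m))" by (rule hom_part_single)
        define u where "u = Poly_Mapping.single m c \<bullet> w"
        have u: "u \<in> K e" "u \<in> W e" unfolding u_def using gs_scale[OF K hom w(1) deg] gs_scale[OF W(1) hom w(3) deg] by auto
        have d: "v - u \<in> K e" using v(1) u(1) by (intro gs_diff[OF K])
        have "v - u \<in> W e"
        proof (cases "v - u = 0")
          case True
          show ?thesis unfolding True by (rule gs_0[OF W(1)])
        next
          case False
          then obtain a' where a': "lead (v - u) a'" using lead_exists by blast
          have "term_less a' (fst a, snd b + m)"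
          proof (rule lead_cancel)
            show "lead v (fst a, snd b + m)" using v(2) m(1) by (metis prod.collapse)
            show "lead w (fst a, snd b)" using w(2) m(2) by simp
            show "lead (v - Poly_Mapping.single m (Poly_Mapping.lookup (v (fst a)) (snd b + m) / Poly_Mapping.lookup (w (fst a)) (snd b)) \<bullet> w) a'"
              using a' unfolding u_def c_def .
          qed
          then have "term_less a' a" using m(1) by (metis prod.collapse)
          then have "(a', a) \<in> {(a, b). a \<in> free_terms n (length D) \<and> b \<in> free_terms n (length D) \<and> term_less a b}"
            using lead_free_terms[OF subsetD[OF KF d] a'] lead_free_terms[OF subsetD[OF KF v(1)] v(2)] by blast
          from 1[OF this] show ?thesis using d a' by blast
        qed
        then have "v - u + u \<in> W e" using u(2) by (intro gs_add[OF W(1)])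
        then show "v \<in> W e" by simp
      qed
    qed
    show ?thesis
    proof (cases "v = 0")
      case True
      show ?thesis unfolding True by (rule gs_0[OF W(1)])
    next
      case False
      then show ?thesis using * lead_exists \<open>v \<in> K e\<close> by blast
    qed
  qed
  then have gen: "\<forall>W. graded_sub n W \<longrightarrow> (\<forall>(e, v)\<in>g ` B0. v \<in> W e) \<longrightarrow> (\<forall>e. K e \<subseteq> W e)"
    by (intro allI impI subsetI)
  have "\<forall>(e, v)\<in>g ` B0. v \<in> K e"
  proof (rule ballI, erule imageE)
    fix x b assume "x = g b" "b \<in> B0"
    then show "case x of (e, v) \<Rightarrow> v \<in> K e" using g[of b] by (simp add: case_prod_beta)
  qed
  then show ?thesis using gen finite_imageI[OF B0(1)] by (intro exI[of _ "g ` B0"] conjI)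
qed

corollary graded_submodule_acc:
  fixes V :: "nat \<Rightarrow> int \<Rightarrow> ('k::field) vec set"
  assumes V: "\<And>k. graded_sub n (V k)" and VF: "\<And>k e. V k e \<subseteq> free_part n D e"
    and mono: "\<And>k e. V k e \<subseteq> V (Suc k) e"
  shows "\<exists>k. \<forall>e. V (Suc k) e \<subseteq> V k e"
proof -
  have mono': "V k e \<subseteq> V k' e" if "k \<le> k'" for k k' e
    using lift_Suc_mono_le[of "\<lambda>k. V k e", OF mono that] .
  define K where "K e = (\<Union>k. V k e)" for e
  have "graded_sub n K"
    unfolding graded_sub_def
  proof (intro conjI allI ballI)
    show "0 \<in> K e" for e using gs_0[OF V] by (auto simp: K_def)
    fix e v assume "v \<in> K e"
    then obtain k where k: "v \<in> V k e" by (auto simp: K_def)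
    { fix w assume "w \<in> K e"
      then obtain k' where k': "w \<in> V k' e" by (auto simp: K_def)
      have "v \<in> V (max k k') e" "w \<in> V (max k k') e"
        using mono'[of k "max k k'" e] mono'[of k' "max k k'" e] k k' by auto
      then show "v + w \<in> K e" using gs_add[OF V] unfolding K_def by blast }
    { fix a and p :: "'k mpol" assume "p \<in> hom_part n a"
      then show "p \<bullet> v \<in> K (a + e)" using gs_scale[OF V _ k refl] unfolding K_def by blast }
  qed
  moreover have "K e \<subseteq> free_part n D e" for e using VF by (auto simp: K_def)
  ultimately have "\<exists>B. finite B \<and> (\<forall>(e, v)\<in>B. v \<in> K e) \<and>
      (\<forall>W. graded_sub n W \<longrightarrow> (\<forall>(e, v)\<in>B. v \<in> W e) \<longrightarrow> (\<forall>e. K e \<subseteq> W e))"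
    by (rule graded_submodule_fg)
  then obtain B where B: "finite B" "\<forall>(e, v)\<in>B. v \<in> K e"
    and gen: "\<forall>W. graded_sub n W \<longrightarrow> (\<forall>(e, v)\<in>B. v \<in> W e) \<longrightarrow> (\<forall>e. K e \<subseteq> W e)"
    by (elim exE conjE)
  have "\<exists>k. \<forall>(e, v)\<in>B'. v \<in> V k e" if "finite B'" "B' \<subseteq> B" for B'
    using that
  proof (induction B' rule: finite_induct)
    case (insert b B')
    obtain k where k: "\<forall>(e, v)\<in>B'. v \<in> V k e" using insert by auto
    obtain e v where b: "b = (e, v)" by (cases b)
    then have "v \<in> K e" using insert.prems B(2) by auto
    then obtain k' where k': "v \<in> V k' e" by (auto simp: K_def)
    have "\<forall>(e, v)\<in>insert b B'. v \<in> V (max k k') e"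
      using k k' b mono'[of k "max k k'"] mono'[of k' "max k k'"] by fastforce
    then show ?case by blast
  qed auto
  then obtain k where "\<forall>(e, v)\<in>B. v \<in> V k e" using B(1) by blast
  with gen V have "\<forall>e. K e \<subseteq> V k e" by simp
  then show ?thesis unfolding K_def by blast
qed

section \<open>General linear forms\<close>

text \<open>All elements that some power of \<open>\<mm>\<close> moves into \<open>W\<close>. In contrast to the torsion for given forms, it does not depend on forms that are still to be chosen.\<close>

definition saturation :: "nat \<Rightarrow> (int \<Rightarrow> ('k::field) vec set) \<Rightarrow> (int \<Rightarrow> 'k vec set) \<Rightarrow> int \<Rightarrow> 'k vec set" where
  "saturation n F W e = {v \<in> F e. \<exists>k. \<forall>q\<in>hom_part n (int k). q \<bullet> v \<in> W (e + int k)}"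

lemma hom_part_Suc_decomp:
  assumes "q \<in> hom_part n (int (Suc k))"
  shows "\<exists>g. (\<forall>l\<le>n. g l \<in> hom_part n (int k)) \<and> q = (\<Sum>l\<le>n. var l * g l)"
proof -
  have "\<exists>g. (\<forall>l\<in>{..n}. g l \<in> hom_part n (int (Suc k) - 1)) \<and> q = (\<Sum>l\<in>{..n}. var l * g l)"
  proof (rule hom_part_var_decomp[OF assms])
    fix m assume "m \<in> Poly_Mapping.keys q"
    then have m: "Poly_Mapping.keys m \<subseteq> {0..n}" "mono_degree m = Suc k" using assms by (auto simp: hom_part_iff)
    then have "Poly_Mapping.keys m \<noteq> {}" by auto
    then show "Poly_Mapping.keys m \<inter> {..n} \<noteq> {}" using m(1) by fastforce
  qed simp
  then show ?thesis unfolding Ball_def atMost_iff by simp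
qed

lemma saturation_step:
  fixes W :: "int \<Rightarrow> ('k::field) vec set"
  assumes W: "graded_sub n W" and v: "\<forall>q\<in>hom_part n (int k). q \<bullet> v \<in> W (e + int k)" and le: "k \<le> k'"
  shows "\<forall>q\<in>hom_part n (int k'). q \<bullet> v \<in> W (e + int k')"
  using le
proof (induction k' rule: dec_induct)
  case base
  then show ?case using v by blast
next
  case (step k')
  show ?case
  proof
    fix q :: "'k mpol" assume "q \<in> hom_part n (int (Suc k'))"
    from hom_part_Suc_decomp[OF this] obtain g
      where g: "\<forall>l\<le>n. g l \<in> hom_part n (int k')" "q = (\<Sum>l\<le>n. var l * g l)" by (elim exE conjE)
    have "var l \<bullet> g l \<bullet> v \<in> W (e + int (Suc k'))" if "l \<le> n" for l
      using step.IH g(1) that by (intro gs_lin[OF W hom_part_var]) auto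
    then have "(\<Sum>l\<le>n. var l \<bullet> g l \<bullet> v) \<in> W (e + int (Suc k'))" by (intro gs_sum[OF W]) auto
    then show "q \<bullet> v \<in> W (e + int (Suc k'))" unfolding g(2) by (simp add: vec.scale_sum_left)
  qed
qed

lemma graded_sub_saturation:
  fixes W :: "int \<Rightarrow> ('k::field) vec set"
  assumes F: "graded_sub n F" and W: "graded_sub n W"
  shows "graded_sub n (saturation n F W)"
  unfolding graded_sub_def
proof (intro conjI allI ballI)
  show "0 \<in> saturation n F W e" for e using gs_0[OF F] gs_0[OF W] by (auto simp: saturation_def)
  fix e v assume "v \<in> saturation n F W e"
  then obtain k where k: "v \<in> F e" "\<forall>q\<in>hom_part n (int k). q \<bullet> v \<in> W (e + int k)" by (auto simp: saturation_def)
  { fix w assume "w \<in> saturation n F W e"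
    then obtain k' where k': "w \<in> F e" "\<forall>q\<in>hom_part n (int k'). q \<bullet> w \<in> W (e + int k')" by (auto simp: saturation_def)
    have "\<forall>q\<in>hom_part n (int (max k k')). q \<bullet> (v + w) \<in> W (e + int (max k k'))"
      using saturation_step[OF W k(2), of "max k k'"] saturation_step[OF W k'(2), of "max k k'"] gs_add[OF W]
      by (simp add: vec.scale_right_distrib del: of_nat_max)
    then show "v + w \<in> saturation n F W e" unfolding saturation_def using gs_add[OF F k(1) k'(1)] by blast }
  { fix a and p :: "'k mpol" assume p: "p \<in> hom_part n a"
    have "q \<bullet> p \<bullet> v \<in> W (a + e + int k)" if q: "q \<in> hom_part n (int k)" for q :: "'k mpol"
    proof -
      have "p \<bullet> q \<bullet> v \<in> W (a + e + int k)" using k(2) q by (intro gs_scale[OF W p]) auto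
      then show ?thesis by (simp add: mult.commute)
    qed
    then show "p \<bullet> v \<in> saturation n F W (a + e)"
      unfolding saturation_def using gs_scale[OF F p k(1) refl] by blast }
qed

lemma saturation_superset: "graded_sub n W \<Longrightarrow> (\<And>e. W e \<subseteq> F e) \<Longrightarrow> v \<in> W e \<Longrightarrow> v \<in> saturation n F W e"
  unfolding saturation_def using gs_scale[of n W _ 0 v e e] by (auto intro!: exI[of _ 0])

lemma saturation_closed:
  fixes W :: "int \<Rightarrow> ('k::field) vec set"
  assumes W: "graded_sub n W" and v: "v \<in> F e"
    and vars: "\<And>l. l \<le> n \<Longrightarrow> var l \<bullet> v \<in> saturation n F W (e + 1)"
  shows "v \<in> saturation n F W e"
proof -
  have "\<forall>l\<in>{..n}. \<exists>k. \<forall>q\<in>hom_part n (int k). q \<bullet> var l \<bullet> v \<in> W (e + 1 + int k)"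
    using vars by (auto simp: saturation_def)
  then obtain k where k: "\<And>l. l \<le> n \<Longrightarrow> \<forall>q\<in>hom_part n (int (k l)). q \<bullet> var l \<bullet> v \<in> W (e + 1 + int (k l))"
    by (metis atMost_iff)
  define M where "M = Max (k ` {..n})"
  have "q \<bullet> v \<in> W (e + int (Suc M))" if q: "q \<in> hom_part n (int (Suc M))" for q :: "'k mpol"
  proof -
    from hom_part_Suc_decomp[OF q] obtain g
      where g: "\<forall>l\<le>n. g l \<in> hom_part n (int M)" "q = (\<Sum>l\<le>n. var l * g l)" by (elim exE conjE)
    have "g l \<bullet> var l \<bullet> v \<in> W (e + 1 + int M)" if l: "l \<le> n" for l
    proof -
      have "k l \<le> M" using l by (simp add: M_def)
      from saturation_step[OF W k[OF l] this] show ?thesis using g(1) l by blast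
    qed
    then have "(\<Sum>l\<le>n. g l \<bullet> var l \<bullet> v) \<in> W (e + int (Suc M))"
      by (intro gs_sum[OF W]) (auto simp: add.commute add.left_commute)
    then show ?thesis unfolding g(2) by (simp add: vec.scale_sum_left mult.commute)
  qed
  then show ?thesis unfolding saturation_def using v by blast
qed

lemma saturation_torsion:
  assumes "\<And>l. l < N \<Longrightarrow> y l \<in> hom_part n 1" "v \<in> saturation n F W e"
  shows "v \<in> torsion y N W e"
  using assms hom_part_power1 by (fastforce simp: saturation_def intro!: torsionI)

text \<open>If infinitely many forms are zero divisors modulo \<open>S\<close>, then arbitrarily many of them share an annihilated element. Given annihilated elements for disjoint sets of forms, the chain of submodules \<open>(S : a\<^sub>0 \<cdots> a\<^bsub>k-1\<^esub>)\<close> stops; an element killed by \<open>a\<^sub>k\<close> is then killed by \<open>a\<^sub>0 \<cdots> a\<^bsub>k-1\<^esub>\<close>, and multiplying by these factors one at a time reaches a nonzero element killed by one form more.\<close>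

lemma many_zero_divisors:
  fixes S :: "int \<Rightarrow> ('k::field) vec set" and a :: "'k \<Rightarrow> 'k mpol"
  assumes S: "graded_sub n S" and a: "\<And>c. a c \<in> hom_part n 1"
    and bad: "\<And>c. c \<in> C \<Longrightarrow> \<exists>e. \<exists>v\<in>free_part n D e. v \<notin> S e \<and> a c \<bullet> v \<in> S (e + 1)"
  shows "infinite C' \<Longrightarrow> C' \<subseteq> C \<Longrightarrow>
    \<exists>T\<subseteq>C'. finite T \<and> card T = Suc r \<and> (\<exists>e. \<exists>v\<in>free_part n D e. v \<notin> S e \<and> (\<forall>c\<in>T. a c \<bullet> v \<in> S (e + 1)))"
proof (induction r arbitrary: C')
  case 0
  then obtain c where "c \<in> C'" by (metis finite.emptyI ex_in_conv)
  then show ?case using bad[of c] 0 by (intro exI[of _ "{c}"]) auto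
next
  case (Suc r)
  define F where "F = (free_part n D :: int \<Rightarrow> 'k vec set)"
  have F: "graded_sub n F" unfolding F_def by (rule graded_sub_free_part)
  have "\<exists>T e v. T \<subseteq> C' - X \<and> finite T \<and> card T = Suc r \<and> v \<in> F e \<and> v \<notin> S e \<and> (\<forall>c\<in>T. a c \<bullet> v \<in> S (e + 1))"
    if "finite X" for X
  proof -
    have "infinite (C' - X)" "C' - X \<subseteq> C" using Suc.prems that by auto
    from Suc.IH[OF this] show ?thesis unfolding F_def by (elim exE conjE bexE) (intro exI conjI)
  qed
  then have "\<exists>p. fst p \<subseteq> C' - X \<and> finite (fst p) \<and> card (fst p) = Suc r \<and> snd (snd p) \<in> F (fst (snd p)) \<and>
      snd (snd p) \<notin> S (fst (snd p)) \<and> (\<forall>c\<in>fst p. a c \<bullet> snd (snd p) \<in> S (fst (snd p) + 1))" (is "\<exists>p. ?P X p")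
    if "finite X" for X
    using that by simp
  then have P: "?P X (SOME p. ?P X p)" if "finite X" for X
    using that by (intro someI_ex[of "?P X"]) simp
  define T where "T X = fst (SOME p. ?P X p)" for X
  define ed where "ed X = fst (snd (SOME p. ?P X p))" for X
  define vd where "vd X = snd (snd (SOME p. ?P X p))" for X
  have T: "T X \<subseteq> C' - X \<and> finite (T X) \<and> card (T X) = Suc r \<and>
      vd X \<in> F (ed X) \<and> vd X \<notin> S (ed X) \<and> (\<forall>c\<in>T X. a c \<bullet> vd X \<in> S (ed X + 1))" if "finite X" for X
    using P[OF that] unfolding T_def ed_def vd_def .
  define pick where "pick X = (SOME c. c \<in> T X)" for X
  have pick: "pick X \<in> T X" if "finite X" for X
  proof -
    have "T X \<noteq> {}" using T[OF that] by auto
    then show ?thesis unfolding pick_def by (simp add: some_in_eq)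
  qed
  define X where "X k = ((\<lambda>Y. insert (pick Y) Y) ^^ k) {}" for k
  have X: "finite (X k)" for k by (induction k) (auto simp: X_def)
  have pX: "pick (X j) \<in> X k" if "j < k" for j k
    using that by (induction k) (auto simp: X_def less_Suc_eq)
  define P where "P k = (\<Prod>i<k. a (pick (X i)))" for k
  have P: "P k \<in> hom_part n (int k)" for k
    unfolding P_def by (induction k) (auto dest: hom_part_mult[OF _ a] simp: algebra_simps)
  define V where "V k e = {v \<in> F e. P k \<bullet> v \<in> S (e + int k)}" for k e
  have "\<exists>k. \<forall>e. V (Suc k) e \<subseteq> V k e"
  proof (rule graded_submodule_acc[of n V D])
    show "V k e \<subseteq> free_part n D e" for k e by (auto simp: V_def F_def)
    show "V k e \<subseteq> V (Suc k) e" for k e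
    proof
      fix v assume v: "v \<in> V k e"
      then have "a (pick (X k)) \<bullet> P k \<bullet> v \<in> S (e + int (Suc k))" by (intro gs_lin[OF S a]) (auto simp: V_def)
      then show "v \<in> V (Suc k) e" using v by (simp add: V_def P_def mult.commute)
    qed
    show "graded_sub n (V k)" for k
      unfolding graded_sub_def
    proof (intro conjI allI ballI)
      show "0 \<in> V k e" for e using gs_0[OF F] gs_0[OF S] by (simp add: V_def)
      show "v + w \<in> V k e" if "v \<in> V k e" "w \<in> V k e" for v w e
        using that gs_add[OF F] gs_add[OF S] by (simp add: V_def vec.scale_right_distrib)
      fix b e v and p :: "'k mpol" assume p: "p \<in> hom_part n b" and v: "v \<in> V k e"
      have "p \<bullet> P k \<bullet> v \<in> S (b + e + int k)" using v by (intro gs_scale[OF S p]) (auto simp: V_def)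
      then show "p \<bullet> v \<in> V k (b + e)" using v gs_scale[OF F p _ refl] by (simp add: V_def mult.commute)
    qed
  qed
  then obtain k where k: "\<And>e. V (Suc k) e \<subseteq> V k e" by blast
  define v where "v = vd (X k)"
  define e where "e = ed (X k)"
  have v: "v \<in> F e" "v \<notin> S e" "\<forall>c\<in>T (X k). a c \<bullet> v \<in> S (e + 1)" using T[OF X] by (auto simp: v_def e_def)
  have "P k \<bullet> a (pick (X k)) \<bullet> v \<in> S (e + int (Suc k))"
    using v(3) pick[OF X] by (intro gs_scale[OF S P]) auto
  then have "v \<in> V (Suc k) e" using v(1) by (simp add: V_def P_def)
  then have "P k \<bullet> v \<in> S (e + int k)" using k by (auto simp: V_def)
  then have "\<exists>j<k. P j \<bullet> v \<notin> S (e + int j) \<and> P (Suc j) \<bullet> v \<in> S (e + int (Suc j))"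
    using v(2)
  proof (induction k)
    case (Suc k)
    then show ?case by (cases "P k \<bullet> v \<in> S (e + int k)") (auto intro: less_SucI)
  qed (simp add: P_def)
  then obtain j where j: "j < k" "P j \<bullet> v \<notin> S (e + int j)" "P (Suc j) \<bullet> v \<in> S (e + int (Suc j))" by blast
  define w where "w = P j \<bullet> v"
  have "w \<in> F (e + int j)" unfolding w_def using v(1) by (intro gs_scale[OF F P]) auto
  moreover have "w \<notin> S (e + int j)" using j by (simp add: w_def)
  moreover have "a c \<bullet> w \<in> S (e + int j + 1)" if "c \<in> insert (pick (X j)) (T (X k))" for c
    using that
  proof
    assume "c = pick (X j)"
    moreover have "e + int j + 1 = e + int (Suc j)" by simp
    ultimately show ?thesis using j(3) by (simp only:) (simp add: w_def P_def mult.commute)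
  next
    assume "c \<in> T (X k)"
    then have "P j \<bullet> a c \<bullet> v \<in> S (e + int j + 1)" using v(3) by (intro gs_scale[OF S P]) auto
    then show ?thesis by (simp add: w_def mult.commute)
  qed
  moreover have "pick (X j) \<in> C'" "pick (X j) \<notin> T (X k)" using T[OF X] pick[OF X] pX[OF j(1)] by blast+
  moreover have "T (X k) \<subseteq> C'" "finite (T (X k))" "card (T (X k)) = Suc r" using T[OF X] by blast+
  ultimately show ?case
    by (intro exI[of _ "insert (pick (X j)) (T (X k))"]) (auto simp: F_def)
qed

definition vpoly :: "nat \<Rightarrow> (nat \<Rightarrow> ('k::field) vec) \<Rightarrow> 'k \<Rightarrow> 'k vec" where
  "vpoly m z c = (\<Sum>k<m. const (c ^ k) \<bullet> z k)"

lemma const_mult: "const c * const d = (const (c * d) :: ('k::field) mpol)"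
  by (simp add: mult_single)

lemma vpoly_Suc: "vpoly (Suc m) z c = z 0 + const c \<bullet> vpoly m (\<lambda>k. z (Suc k)) c"
  unfolding vpoly_def by (subst sum.lessThan_Suc_shift) (simp add: vec.scale_sum_right const_mult del: sum.lessThan_Suc)

text \<open>Division of a polynomial with vector coefficients by \<open>c - b\<close>. The coefficients of the quotient determine all coefficients but the constant one, up to any submodule.\<close>

lemma vpoly_divided_difference:
  "\<exists>q. (\<forall>c. vpoly (Suc m) z c - vpoly (Suc m) z b = const (c - b) \<bullet> vpoly m q c) \<and>
    (\<forall>S. graded_sub n S \<longrightarrow> (\<forall>j<m. q j \<in> S e) \<longrightarrow> (\<forall>j<m. z (Suc j) \<in> S e))"
proof (induction m arbitrary: z)
  case 0
  then show ?case by (simp add: vpoly_def vscale_def)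
next
  case (Suc m)
  define z' where "z' k = z (Suc k)" for k
  obtain q where q: "\<And>c. vpoly (Suc m) z' c - vpoly (Suc m) z' b = const (c - b) \<bullet> vpoly m q c"
    "\<And>S. graded_sub n S \<Longrightarrow> \<forall>j<m. q j \<in> S e \<Longrightarrow> \<forall>j<m. z' (Suc j) \<in> S e" using Suc[of z'] by blast
  define q' where "q' k = (case k of 0 \<Rightarrow> vpoly (Suc m) z' b | Suc k \<Rightarrow> q k)" for k
  have q': "vpoly (Suc m) q' c = vpoly (Suc m) z' b + const c \<bullet> vpoly m q c" for c
    by (simp add: vpoly_Suc[of m q'] q'_def)
  have "vpoly (Suc (Suc m)) z c - vpoly (Suc (Suc m)) z b = const (c - b) \<bullet> vpoly (Suc m) q' c" for c
  proof -
    have "vpoly (Suc (Suc m)) z c - vpoly (Suc (Suc m)) z b = const c \<bullet> vpoly (Suc m) z' c - const b \<bullet> vpoly (Suc m) z' b"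
      unfolding vpoly_Suc[of "Suc m" z] z'_def by simp
    also have "\<dots> = const c \<bullet> (vpoly (Suc m) z' c - vpoly (Suc m) z' b) + const (c - b) \<bullet> vpoly (Suc m) z' b"
      by (simp add: vec.scale_right_diff_distrib vec.scale_left_diff_distrib single_diff)
    also have "\<dots> = const (c - b) \<bullet> (const c \<bullet> vpoly m q c + vpoly (Suc m) z' b)"
      unfolding q(1) by (simp add: vec.scale_right_distrib mult.commute)
    finally show ?thesis by (simp add: q' add.commute)
  qed
  moreover have "\<forall>j<Suc m. z (Suc j) \<in> S e" if S: "graded_sub n S" "\<forall>j<Suc m. q' j \<in> S e" for S
  proof -
    have "\<forall>j<m. q j \<in> S e" using S(2) by (force simp: q'_def)
    then have z: "\<forall>j<m. z' (Suc j) \<in> S e" using q(2)[OF S(1)] by blast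
    have "vpoly m (\<lambda>k. z' (Suc k)) b \<in> S e"
      unfolding vpoly_def using z by (intro gs_sum[OF S(1)] gs_scale[OF S(1) hom_part_const]) auto
    then have r: "const b \<bullet> vpoly m (\<lambda>k. z' (Suc k)) b \<in> S e" by (intro gs_scale[OF S(1) hom_part_const]) auto
    have "q' 0 \<in> S e" using S(2) by blast
    moreover have "q' 0 = z' 0 + const b \<bullet> vpoly m (\<lambda>k. z' (Suc k)) b" by (simp add: q'_def vpoly_Suc)
    ultimately have "z' 0 + const b \<bullet> vpoly m (\<lambda>k. z' (Suc k)) b - const b \<bullet> vpoly m (\<lambda>k. z' (Suc k)) b \<in> S e"
      using r by (intro gs_diff[OF S(1)]) auto
    then have "z' 0 \<in> S e" by simp
    then show ?thesis using z by (auto simp: z'_def less_Suc_eq_0_disj)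
  qed
  ultimately show ?case by blast
qed

lemma vandermonde:
  assumes S: "graded_sub n S"
  shows "finite T \<Longrightarrow> card T = m \<Longrightarrow> (\<And>c. c \<in> T \<Longrightarrow> vpoly m z c \<in> S e) \<Longrightarrow> k < m \<Longrightarrow> z k \<in> S e"
proof (induction m arbitrary: T z k)
  case (Suc m)
  obtain b where b: "b \<in> T" using Suc.prems by fastforce
  from vpoly_divided_difference[of m z b n e] obtain q where
    q: "\<forall>c. vpoly (Suc m) z c - vpoly (Suc m) z b = const (c - b) \<bullet> vpoly m q c"
      "\<forall>S. graded_sub n S \<longrightarrow> (\<forall>j<m. q j \<in> S e) \<longrightarrow> (\<forall>j<m. z (Suc j) \<in> S e)"
    by (elim exE conjE)
  have "vpoly m q c \<in> S e" if c: "c \<in> T - {b}" for c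
  proof -
    have h: "const (c - b) \<bullet> vpoly m q c \<in> S e"
      unfolding q(1)[rule_format, symmetric] using Suc.prems(3) b c by (intro gs_diff[OF S]) auto
    have "const (1 / (c - b)) \<bullet> const (c - b) \<bullet> vpoly m q c \<in> S e"
      by (rule gs_scale[OF S hom_part_const h]) simp
    moreover have "const (1 / (c - b)) * const (c - b) = (1 :: 'a mpol)" using c by (simp add: const_mult)
    ultimately show ?thesis by (simp only: vec.scale_scale vec.scale_one)
  qed
  then have "\<forall>j<m. q j \<in> S e" using Suc.IH[of "T - {b}" q] Suc.prems(1,2) b by simp
  then have z: "\<forall>j<m. z (Suc j) \<in> S e" using q(2) S by simp
  have "vpoly m (\<lambda>k. z (Suc k)) b \<in> S e"
    unfolding vpoly_def using z by (intro gs_sum[OF S] gs_scale[OF S hom_part_const]) auto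
  then have "const b \<bullet> vpoly m (\<lambda>k. z (Suc k)) b \<in> S e" by (intro gs_scale[OF S hom_part_const]) auto
  then have "vpoly (Suc m) z b - const b \<bullet> vpoly m (\<lambda>k. z (Suc k)) b \<in> S e" using Suc.prems(3)[OF b] by (intro gs_diff[OF S])
  then have "z 0 \<in> S e" by (simp add: vpoly_Suc)
  then show ?case using z Suc.prems(4) by (auto simp: less_Suc_eq_0_disj)
qed simp

text \<open>An element killed modulo the saturation by \<open>n - i + 1\<close> of the forms is killed by \<open>x\<^sub>i, \<dots>, x\<^sub>n\<close>, and by the earlier variables because the earlier forms already act as zero; so it lies in the saturation.\<close>

lemma finitely_many_bad_forms:
  fixes W :: "int \<Rightarrow> ('k::field) vec set"
  assumes W: "graded_sub n W" and WF: "\<And>e. W e \<subseteq> free_part n D e" and i: "i \<le> n"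
    and prev: "\<And>l e v. l < i \<Longrightarrow> v \<in> free_part n D e \<Longrightarrow> lin_form n l (c l) \<bullet> v \<in> W (e + 1)"
  shows "finite {b. \<exists>e. \<exists>v\<in>free_part n D e. v \<notin> saturation n (free_part n D) W e \<and> lin_form n i b \<bullet> v \<in> W (e + 1)}"
    (is "finite ?C")
proof (rule ccontr)
  assume inf: "infinite ?C"
  define S where "S = saturation n (free_part n D) W"
  have S: "graded_sub n S" unfolding S_def by (rule graded_sub_saturation[OF graded_sub_free_part W])
  have WS: "w \<in> S e" if "w \<in> W e" for w e
    unfolding S_def by (rule saturation_superset[OF W WF that])
  have "\<exists>T\<subseteq>?C. finite T \<and> card T = Suc (n - i) \<and>
      (\<exists>e. \<exists>v\<in>free_part n D e. v \<notin> S e \<and> (\<forall>c\<in>T. lin_form n i c \<bullet> v \<in> S (e + 1)))"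
  proof (rule many_zero_divisors[OF S hom_part_lin_form _ inf subset_refl])
    fix b assume "b \<in> ?C"
    then obtain e v where "v \<in> free_part n D e" "v \<notin> S e" "lin_form n i b \<bullet> v \<in> W (e + 1)"
      unfolding S_def mem_Collect_eq by (elim exE bexE conjE)
    then show "\<exists>e. \<exists>v\<in>free_part n D e. v \<notin> S e \<and> lin_form n i b \<bullet> v \<in> S (e + 1)"
      using WS by (intro exI bexI conjI)
  qed
  then
  obtain T e v where T: "finite T" "card T = Suc (n - i)" "v \<in> free_part n D e" "v \<notin> S e"
    "\<forall>c\<in>T. lin_form n i c \<bullet> v \<in> S (e + 1)" by (elim exE conjE bexE)
  have form: "lin_form n i b \<bullet> v = vpoly (Suc (n - i)) (\<lambda>k. var (i + k) \<bullet> v) b" for b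
  proof -
    have "lin_form n i b \<bullet> v = (\<Sum>j\<in>{i..n}. const (b ^ (j - i)) \<bullet> var j \<bullet> v)"
      by (simp add: lin_form_def vec.scale_sum_left)
    also have "\<dots> = (\<Sum>k<Suc (n - i). const (b ^ k) \<bullet> var (i + k) \<bullet> v)"
      by (rule sum.reindex_bij_witness[of _ "\<lambda>k. i + k" "\<lambda>j. j - i"]) (use i in auto)
    finally show ?thesis by (simp add: vpoly_def)
  qed
  have high: "var l \<bullet> v \<in> S (e + 1)" if "i \<le> l" "l \<le> n" for l
    using vandermonde[OF S T(1,2), of "\<lambda>k. var (i + k) \<bullet> v" "e + 1" "l - i"] T(5) form that by auto
  have "var l \<bullet> v \<in> S (e + 1)" if "l \<le> n" for l
    using that
  proof (induction "n - l" arbitrary: l rule: less_induct)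
    case less
    show ?case
    proof (cases "i \<le> l")
      case True
      then show ?thesis using high less.prems by blast
    next
      case False
      have "lin_form n l (c l) = var l + (\<Sum>j\<in>{Suc l..n}. const (c l ^ (j - l)) * var j)"
        unfolding lin_form_def using less.prems by (subst sum.atLeast_Suc_atMost) auto
      then have "var l \<bullet> v = lin_form n l (c l) \<bullet> v - (\<Sum>j\<in>{Suc l..n}. const (c l ^ (j - l)) \<bullet> var j \<bullet> v)"
        by (simp add: vec.scale_left_distrib vec.scale_sum_left)
      also have "\<dots> \<in> S (e + 1)"
      proof (rule gs_diff[OF S])
        show "lin_form n l (c l) \<bullet> v \<in> S (e + 1)" using WS prev[of l v e] False T(3) by simp
        have "const (c l ^ (j - l)) \<bullet> var j \<bullet> v \<in> S (e + 1)" if "j \<in> {Suc l..n}" for j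
        proof -
          have "var j \<bullet> v \<in> S (e + 1)" using less.hyps[of j] diff_less_mono2[of l j n] that by simp
          then show ?thesis by (rule gs_scale[OF S hom_part_const]) simp
        qed
        then show "(\<Sum>j\<in>{Suc l..n}. const (c l ^ (j - l)) \<bullet> var j \<bullet> v) \<in> S (e + 1)" by (rule gs_sum[OF S])
      qed
      finally show ?thesis .
    qed
  qed
  then have "v \<in> S e" unfolding S_def using saturation_closed[of n W v "free_part n D" e] W T(3) by simp
  then show False using T(4) by simp
qed

declare plus_fun_apply [simp del]

section \<open>Graded modules\<close>

lemma finsum_eq_sum:
  assumes "abelian_monoid G" "add G = (+)" "zero G = (0 :: 'a :: comm_monoid_add)" "\<And>i. i \<in> A \<Longrightarrow> f i \<in> carrier G" "finite A"
  shows "finsum G f A = sum f A"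
proof -
  interpret abelian_monoid G by fact
  from assms(5,4) show ?thesis
    by (induction A rule: finite_induct) (auto simp: assms(2,3) Pi_def)
qed

lemma (in graded_module) part_carrier: "x \<in> graded_part M e \<Longrightarrow> x \<in> carrier M"
  using additive_subgroup.a_subset[OF graded_part_subgroup] by blast

lemma (in graded_module) part_zero: "\<zero>\<^bsub>M\<^esub> \<in> graded_part M e"
  using additive_subgroup.zero_closed[OF graded_part_subgroup] .

lemma (in graded_module) part_add: "x \<in> graded_part M e \<Longrightarrow> y \<in> graded_part M e \<Longrightarrow> x \<oplus>\<^bsub>M\<^esub> y \<in> graded_part M e"
  using additive_subgroup.a_closed[OF graded_part_subgroup] .

lemma (in abelian_monoid) finsum_mem:
  assumes "\<zero> \<in> H" "\<And>x y. x \<in> H \<Longrightarrow> y \<in> H \<Longrightarrow> x \<oplus> y \<in> H" "H \<subseteq> carrier G" "\<And>i. i \<in> A \<Longrightarrow> f i \<in> H"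
  shows "finsum G f A \<in> H"
proof (cases "finite A")
  case True
  then show ?thesis using assms(4)
  proof (induction A rule: finite_induct)
    case (insert a A)
    then have "f \<in> A \<rightarrow> carrier G" "f a \<in> carrier G" using assms(3) by auto
    then show ?case using insert assms(2) by simp
  qed (simp add: assms(1))
next
  case False
  then show ?thesis using assms(1) by (simp add: finsum_infinite)
qed

lemma (in graded_module) support_sum:
  assumes A: "finite A" and f: "\<And>e. e \<in> A \<Longrightarrow> f e \<in> graded_part M e"
  defines "f' \<equiv> \<lambda>e. if e \<in> A then f e else \<zero>\<^bsub>M\<^esub>"
  shows "finite {e. f' e \<noteq> \<zero>\<^bsub>M\<^esub>}" "(\<Oplus>\<^bsub>M\<^esub>e\<in>{e. f' e \<noteq> \<zero>\<^bsub>M\<^esub>}. f' e) = (\<Oplus>\<^bsub>M\<^esub>e\<in>A. f e)"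
proof -
  let ?S = "{e. f' e \<noteq> \<zero>\<^bsub>M\<^esub>}"
  have S: "?S \<subseteq> A" by (auto simp: f'_def)
  then show fin: "finite ?S" using A finite_subset by blast
  have c: "f' e \<in> carrier M" for e using f part_carrier by (auto simp: f'_def)
  have AS: "?S \<union> (A - ?S) = A" using S by blast
  have "(\<Oplus>\<^bsub>M\<^esub>e\<in>?S \<union> (A - ?S). f' e) = (\<Oplus>\<^bsub>M\<^esub>e\<in>?S. f' e) \<oplus>\<^bsub>M\<^esub> (\<Oplus>\<^bsub>M\<^esub>e\<in>A - ?S. f' e)"
    using fin A c by (intro M.finsum_Un_disjoint) auto
  moreover have "(\<Oplus>\<^bsub>M\<^esub>e\<in>A - ?S. f' e) = (\<Oplus>\<^bsub>M\<^esub>e\<in>A - ?S. \<zero>\<^bsub>M\<^esub>)" by (rule M.finsum_cong') auto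
  moreover have "(\<Oplus>\<^bsub>M\<^esub>e\<in>?S. f' e) \<in> carrier M" using c by (intro M.finsum_closed) auto
  moreover have "(\<Oplus>\<^bsub>M\<^esub>e\<in>A. f e) = (\<Oplus>\<^bsub>M\<^esub>e\<in>A. f' e)"
    by (rule M.finsum_cong') (auto simp: c, simp add: f'_def)
  ultimately show "(\<Oplus>\<^bsub>M\<^esub>e\<in>?S. f' e) = (\<Oplus>\<^bsub>M\<^esub>e\<in>A. f e)" unfolding AS by simp
qed

text \<open>The uniqueness of homogeneous components, restated for two sums over the same finite set of degrees.\<close>

lemma (in graded_module) components_unique:
  assumes A: "finite A" and f: "\<And>e. e \<in> A \<Longrightarrow> f e \<in> graded_part M e" and g: "\<And>e. e \<in> A \<Longrightarrow> g e \<in> graded_part M e"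
    and eq: "(\<Oplus>\<^bsub>M\<^esub>e\<in>A. f e) = (\<Oplus>\<^bsub>M\<^esub>e\<in>A. g e)" and e: "e \<in> A"
  shows "f e = g e"
proof -
  define x where "x = (\<Oplus>\<^bsub>M\<^esub>e\<in>A. f e)"
  have x: "x \<in> carrier M" unfolding x_def using f part_carrier by (intro M.finsum_closed) auto
  define f' where "f' e = (if e \<in> A then f e else \<zero>\<^bsub>M\<^esub>)" for e
  define g' where "g' e = (if e \<in> A then g e else \<zero>\<^bsub>M\<^esub>)" for e
  have "(\<forall>e. f' e \<in> graded_part M e) \<and> finite {e. f' e \<noteq> \<zero>\<^bsub>M\<^esub>} \<and> (\<Oplus>\<^bsub>M\<^esub>e \<in> {e. f' e \<noteq> \<zero>\<^bsub>M\<^esub>}. f' e) = x"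
    using support_sum[OF A f] f part_zero unfolding x_def f'_def by simp
  note f'_eq = the1_equality[OF direct_sum[OF x], OF this]
  have "(\<forall>e. g' e \<in> graded_part M e) \<and> finite {e. g' e \<noteq> \<zero>\<^bsub>M\<^esub>} \<and> (\<Oplus>\<^bsub>M\<^esub>e \<in> {e. g' e \<noteq> \<zero>\<^bsub>M\<^esub>}. g' e) = x"
    using support_sum[OF A g] g part_zero eq unfolding x_def g'_def by simp
  from the1_equality[OF direct_sum[OF x], OF this] have "f' = g'" using f'_eq by simp
  then show ?thesis using e unfolding f'_def g'_def by metis
qed

section \<open>Free modules\<close>

abbreviation free :: "nat \<Rightarrow> int list \<Rightarrow> (('k::field) mpol, 'k vec) graded_module" where
  "free \<equiv> free_module"

lemma free_module_simps [simp]: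
  "zero (free n D) = 0" "add (free n D) = (+)" "smult (free n D) = (\<bullet>)" "graded_part (free n D) = free_part n D"
  by (auto simp: free_module_def fun_eq_iff vscale_def free_part_def plus_fun_apply)

lemma carrier_free_iff:
  "v \<in> carrier (free n D) \<longleftrightarrow> (\<forall>j < length D. v j \<in> carrier (poly_ring n)) \<and> (\<forall>j \<ge> length D. v j = 0)"
  by (simp add: free_module_def)

lemma free_carrier_0 [simp]: "0 \<in> carrier (free n D)"
  by (simp add: carrier_free_iff)

lemma free_carrier_add [intro]: "v \<in> carrier (free n D) \<Longrightarrow> w \<in> carrier (free n D) \<Longrightarrow> v + w \<in> carrier (free n D)"
  by (auto simp: carrier_free_iff plus_fun_apply)

lemma free_carrier_uminus [intro]: "v \<in> carrier (free n D) \<Longrightarrow> - v \<in> carrier (free n D)"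
  by (auto simp: carrier_free_iff)

lemma free_carrier_scale [intro]: "p \<in> carrier (poly_ring n) \<Longrightarrow> v \<in> carrier (free n D) \<Longrightarrow> p \<bullet> v \<in> carrier (free n D)"
  by (auto simp: carrier_free_iff vscale_def)

lemma free_carrier_sum [intro]:
  "(\<And>i. i \<in> A \<Longrightarrow> f i \<in> carrier (free n D)) \<Longrightarrow> sum f A \<in> carrier (free n D)"
  by (induction A rule: infinite_finite_induct) auto

lemma free_part_carrier: "v \<in> free_part n D e \<Longrightarrow> v \<in> carrier (free n D)"
  by (auto simp: free_part_def carrier_free_iff hom_part_carrier)

lemma module_free: "Module.module (poly_ring n) (free n D :: (('k::field) mpol, 'k vec) graded_module)" (is "Module.module _ ?F")
proof (rule moduleI[OF cring_poly_ring])
  show "abelian_group ?F"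
  proof (rule abelian_groupI)
    fix x assume "x \<in> carrier ?F"
    then show "\<exists>y\<in>carrier ?F. y \<oplus>\<^bsub>?F\<^esub> x = \<zero>\<^bsub>?F\<^esub>" by (intro bexI[of _ "-x"]) auto
  qed (auto simp: add.assoc add.commute)
qed (auto simp: vec.scale_left_distrib vec.scale_right_distrib)

definition vcomp :: "int list \<Rightarrow> int \<Rightarrow> ('k::field) vec \<Rightarrow> 'k vec" where
  "vcomp D e v = (\<lambda>j. if j < length D then hcomp (e - D ! j) (v j) else 0)"

lemma vcomp_mem: "v \<in> carrier (free n D) \<Longrightarrow> vcomp D e v \<in> free_part n D e"
  by (auto simp: vcomp_def free_part_def carrier_free_iff hcomp_mem)

lemma vcomp_add: "vcomp D e (v + w) = vcomp D e v + vcomp D e w"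
  by (auto simp: vcomp_def fun_eq_iff hcomp_add plus_fun_apply)

lemma vcomp_0 [simp]: "vcomp D e 0 = 0"
  by (auto simp: vcomp_def fun_eq_iff)

lemma vcomp_sum: "vcomp D e (sum f A) = (\<Sum>i\<in>A. vcomp D e (f i))"
  by (induction A rule: infinite_finite_induct)
    (simp_all only: sum.infinite sum.empty sum.insert vcomp_0 vcomp_add not_False_eq_True simp_thms)

lemma vcomp_free_part: "v \<in> free_part n D e \<Longrightarrow> vcomp D a v = (if a = e then v else 0)"
  by (auto simp: vcomp_def fun_eq_iff free_part_def hcomp_hom)

lemma vcomp_scale: "q \<in> hom_part n b \<Longrightarrow> vcomp D e (q \<bullet> v) = q \<bullet> vcomp D (e - b) v"
  by (auto simp: vcomp_def fun_eq_iff vscale_def hcomp_mult algebra_simps)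

lemma vcomp_sum_all:
  assumes v: "v \<in> carrier (free n D)"
  shows "\<exists>A. finite A \<and> (\<forall>B. finite B \<longrightarrow> A \<subseteq> B \<longrightarrow> v = (\<Sum>e\<in>B. vcomp D e v))"
proof -
  define A where "A = (\<Union>j<length D. (\<lambda>m. int (mono_degree m) + D ! j) ` Poly_Mapping.keys (v j))"
  have "finite A" by (auto simp: A_def)
  moreover have "v j = (\<Sum>e\<in>B. vcomp D e v) j" if B: "finite B" "A \<subseteq> B" for B j
  proof -
    have "(\<Sum>e\<in>B. vcomp D e v) j = (\<Sum>e\<in>B. vcomp D e v j)" using B(1)
      by (induction B rule: finite_induct) (auto simp: plus_fun_apply)
    also have "\<dots> = v j"
    proof (cases "j < length D")
      case True
      have "(\<Sum>e\<in>B. vcomp D e v j) = (\<Sum>a\<in>(\<lambda>e. e - D ! j) ` B. hcomp a (v j))"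
        using True by (subst sum.reindex) (auto simp: inj_on_def vcomp_def)
      also have "\<dots> = v j"
      proof (rule hcomp_sum_all[symmetric])
        show "(\<lambda>m. int (mono_degree m)) ` Poly_Mapping.keys (v j) \<subseteq> (\<lambda>e. e - D ! j) ` B"
        proof
          fix a assume "a \<in> (\<lambda>m. int (mono_degree m)) ` Poly_Mapping.keys (v j)"
          then have "a + D ! j \<in> B" using True B(2) by (auto simp: A_def)
          then show "a \<in> (\<lambda>e. e - D ! j) ` B" by (intro image_eqI[of _ _ "a + D ! j"]) auto
        qed
      qed (use B in simp)
      finally show ?thesis .
    next
      case False
      then show ?thesis using v by (simp add: vcomp_def carrier_free_iff)
    qed
    finally show ?thesis by simp
  qed
  ultimately show ?thesis by (intro exI[of _ A]) (auto simp: fun_eq_iff)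
qed

lemma graded_module_free: "graded_module n (free n D :: (('k::field) mpol, 'k vec) graded_module)" (is "graded_module n ?F")
proof -
  interpret F: Module.module "poly_ring n" ?F by (rule module_free)
  have fsum: "finsum ?F f A = sum f A" if "\<And>i. i \<in> A \<Longrightarrow> f i \<in> carrier ?F" "finite A" for f :: "int \<Rightarrow> 'k vec" and A
    using that by (intro finsum_eq_sum F.abelian_monoid_axioms) auto
  have ainv: "\<ominus>\<^bsub>?F\<^esub> x = - x" if "x \<in> carrier ?F" for x
    using that by (intro F.M.minus_equality) auto
  have "additive_subgroup (graded_part ?F e) ?F" for e
  proof (rule additive_subgroupI, rule subgroup.intro)
    show "graded_part ?F e \<subseteq> carrier (add_monoid ?F)" using free_part_carrier by auto
    show "\<one>\<^bsub>add_monoid ?F\<^esub> \<in> graded_part ?F e" using gs_0[OF graded_sub_free_part[of n D], of e] by simp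
    fix v assume v: "v \<in> graded_part ?F e"
    then have "\<ominus>\<^bsub>?F\<^esub> v = - v" using free_part_carrier by (intro ainv) simp
    then show "inv\<^bsub>add_monoid ?F\<^esub> v \<in> graded_part ?F e"
      unfolding a_inv_def using gs_uminus[OF graded_sub_free_part] v by simp
    fix w assume "w \<in> graded_part ?F e"
    with v show "v \<otimes>\<^bsub>add_monoid ?F\<^esub> w \<in> graded_part ?F e"
      using gs_add[OF graded_sub_free_part] by simp
  qed
  moreover have "p \<odot>\<^bsub>?F\<^esub> x \<in> graded_part ?F (a + e)" if "p \<in> hom_part n a" "x \<in> graded_part ?F e" for p a x e
    using gs_scale[OF graded_sub_free_part that(1), of x D e "a + e"] that(2) by simp
  moreover have "\<exists>!f. (\<forall>e. f e \<in> graded_part ?F e) \<and> finite {e. f e \<noteq> \<zero>\<^bsub>?F\<^esub>} \<and>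
      (\<Oplus>\<^bsub>?F\<^esub>e \<in> {e. f e \<noteq> \<zero>\<^bsub>?F\<^esub>}. f e) = x" if x: "x \<in> carrier ?F" for x
  proof (rule ex1I[of _ "\<lambda>e. vcomp D e x"])
    obtain A where A: "finite A" "\<And>B. finite B \<Longrightarrow> A \<subseteq> B \<Longrightarrow> x = (\<Sum>e\<in>B. vcomp D e x)"
      using vcomp_sum_all[OF x] by auto
    have comp: "vcomp D e x = 0" if "e \<notin> A" for e
    proof -
      have "x = (\<Sum>e\<in>insert e A. vcomp D e x)" by (rule A(2)) (use A(1) in auto)
      also have "\<dots> = vcomp D e x + x" using A(2)[OF A(1)] that A(1) by simp
      finally show ?thesis by simp
    qed
    then have sub: "{e. vcomp D e x \<noteq> 0} \<subseteq> A" by blast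
    then have fin: "finite {e. vcomp D e x \<noteq> 0}" using A(1) finite_subset by blast
    have "(\<Sum>e\<in>{e. vcomp D e x \<noteq> 0}. vcomp D e x) = (\<Sum>e\<in>A. vcomp D e x)"
      using sub A(1) by (intro sum.mono_neutral_left) auto
    also have "\<dots> = x" using A(2)[OF A(1)] by simp
    finally have "(\<Sum>e\<in>{e. vcomp D e x \<noteq> 0}. vcomp D e x) = x" .
    then show "(\<forall>e. vcomp D e x \<in> graded_part ?F e) \<and> finite {e. vcomp D e x \<noteq> \<zero>\<^bsub>?F\<^esub>} \<and>
      (\<Oplus>\<^bsub>?F\<^esub>e \<in> {e. vcomp D e x \<noteq> \<zero>\<^bsub>?F\<^esub>}. vcomp D e x) = x"
      using fin vcomp_mem[OF x] free_part_carrier[OF vcomp_mem[OF x]] by (subst fsum) auto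
  next
    fix f assume f: "(\<forall>e. f e \<in> graded_part ?F e) \<and> finite {e. f e \<noteq> \<zero>\<^bsub>?F\<^esub>} \<and>
      (\<Oplus>\<^bsub>?F\<^esub>e \<in> {e. f e \<noteq> \<zero>\<^bsub>?F\<^esub>}. f e) = x"
    then have fp: "\<And>e. f e \<in> free_part n D e" and fin: "finite {e. f e \<noteq> 0}" by auto
    have x: "x = (\<Sum>e\<in>{e. f e \<noteq> 0}. f e)" using f fsum[of "{e. f e \<noteq> 0}" f] free_part_carrier[OF fp] by simp
    have "vcomp D a x = f a" for a
    proof -
      have "vcomp D a x = (\<Sum>e\<in>{e. f e \<noteq> 0}. if e = a then f e else 0)"
        unfolding x vcomp_sum by (rule sum.cong) (auto simp: vcomp_free_part[OF fp])
      also have "\<dots> = f a" using fin by simp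
      finally show ?thesis .
    qed
    then show "f = (\<lambda>e. vcomp D e x)" by (rule ext[OF sym])
  qed
  ultimately show ?thesis unfolding graded_module_def graded_module_axioms_def using module_free by blast
qed

section \<open>Graded maps from free modules\<close>

locale free_map = graded_module n M
  for n :: nat and M :: "(('k::field) mpol, 'b) graded_module" (structure) +
  fixes D :: "int list" and \<epsilon> :: "'k vec \<Rightarrow> 'b"
  assumes hom: "\<epsilon> \<in> graded_hom n (free n D) M"
begin

lemma closed: "v \<in> carrier (free n D) \<Longrightarrow> \<epsilon> v \<in> carrier M"
  using hom by (auto simp: graded_hom_def hom_def)

lemma add: "v \<in> carrier (free n D) \<Longrightarrow> w \<in> carrier (free n D) \<Longrightarrow> \<epsilon> (v + w) = \<epsilon> v \<oplus>\<^bsub>M\<^esub> \<epsilon> w"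
  using hom by (auto simp: graded_hom_def hom_def)

lemma scale: "p \<in> carrier (poly_ring n) \<Longrightarrow> v \<in> carrier (free n D) \<Longrightarrow> \<epsilon> (p \<bullet> v) = p \<odot>\<^bsub>M\<^esub> \<epsilon> v"
  using hom by (auto simp: graded_hom_def)

lemma graded: "v \<in> free_part n D e \<Longrightarrow> \<epsilon> v \<in> graded_part M e"
  using hom by (simp add: graded_hom_def image_subset_iff)

lemma zero [simp]: "\<epsilon> 0 = \<zero>\<^bsub>M\<^esub>"
  using add[of 0 0] closed[of 0] by (metis add.right_neutral free_carrier_0 M.add.r_cancel_one')

lemma uminus: "v \<in> carrier (free n D) \<Longrightarrow> \<epsilon> (- v) = \<ominus>\<^bsub>M\<^esub> \<epsilon> v"
  using add[of "-v" v] closed free_carrier_uminus[of v n D] by (intro M.minus_equality[symmetric]) simp_all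

lemma diff: "v \<in> carrier (free n D) \<Longrightarrow> w \<in> carrier (free n D) \<Longrightarrow> \<epsilon> (v - w) = \<epsilon> v \<ominus>\<^bsub>M\<^esub> \<epsilon> w"
  using add[of v "-w"] uminus[of w] free_carrier_uminus[of w n D] by (simp add: a_minus_def)

lemma diff_zero: "v \<in> carrier (free n D) \<Longrightarrow> w \<in> carrier (free n D) \<Longrightarrow> \<epsilon> v = \<epsilon> w \<Longrightarrow> \<epsilon> (v - w) = \<zero>\<^bsub>M\<^esub>"
  by (simp add: diff closed M.minus_eq M.r_neg)

lemma sum: "finite A \<Longrightarrow> (\<And>i. i \<in> A \<Longrightarrow> f i \<in> carrier (free n D)) \<Longrightarrow> \<epsilon> (sum f A) = (\<Oplus>\<^bsub>M\<^esub>i\<in>A. \<epsilon> (f i))"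
proof (induction A rule: finite_induct)
  case (insert a A)
  then have "sum f A \<in> carrier (free n D)" "(\<lambda>i. \<epsilon> (f i)) \<in> A \<rightarrow> carrier M" using closed by auto
  moreover have "\<epsilon> (f a + sum f A) = \<epsilon> (f a) \<oplus>\<^bsub>M\<^esub> \<epsilon> (sum f A)" using insert.prems calculation(1) by (intro add) auto
  ultimately show ?case unfolding sum.insert[OF insert.hyps(1,2)]
    using insert by (simp add: closed del: plus_fun_apply)
qed simp

definition kernel_part :: "int \<Rightarrow> 'k vec set" where
  "kernel_part e = {v \<in> free_part n D e. \<epsilon> v = \<zero>\<^bsub>M\<^esub>}"

lemma graded_sub_kernel: "graded_sub n kernel_part"
  unfolding graded_sub_def kernel_part_def mem_Collect_eq
proof (intro conjI allI ballI; (elim CollectE conjE)?)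
  fix e v w assume "v \<in> free_part n D e" "\<epsilon> v = \<zero>\<^bsub>M\<^esub>" "w \<in> free_part n D e" "\<epsilon> w = \<zero>\<^bsub>M\<^esub>"
  then show "v + w \<in> free_part n D e" "\<epsilon> (v + w) = \<zero>\<^bsub>M\<^esub>"
    using gs_add[OF graded_sub_free_part] add[OF free_part_carrier free_part_carrier] by (simp_all del: plus_fun_apply)
next
  fix a e v and p :: "'k mpol" assume "p \<in> hom_part n a" "v \<in> free_part n D e" "\<epsilon> v = \<zero>\<^bsub>M\<^esub>"
  then show "p \<bullet> v \<in> free_part n D (a + e)" "\<epsilon> (p \<bullet> v) = \<zero>\<^bsub>M\<^esub>"
    using gs_scale[OF graded_sub_free_part _ _ refl] scale[OF hom_part_carrier free_part_carrier]
      smult_r_null[OF hom_part_carrier] by simp_all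
qed (use gs_0[OF graded_sub_free_part] in simp_all)

lemma kernel_part_subset: "kernel_part e \<subseteq> free_part n D e"
  by (auto simp: kernel_part_def)

lemma component: 
  assumes v: "v \<in> carrier (free n D)" and x: "\<epsilon> v \<in> graded_part M e"
  shows "\<epsilon> (vcomp D e v) = \<epsilon> v"
proof -
  obtain A where A: "finite A" "\<And>B. finite B \<Longrightarrow> A \<subseteq> B \<Longrightarrow> v = (\<Sum>e\<in>B. vcomp D e v)"
    using vcomp_sum_all[OF v] by auto
  let ?B = "insert e A"
  have vB: "v = (\<Sum>e\<in>?B. vcomp D e v)" by (rule A(2)) (use A(1) in auto)
  have "(\<Oplus>\<^bsub>M\<^esub>a\<in>?B. \<epsilon> (vcomp D a v)) = \<epsilon> (\<Sum>a\<in>?B. vcomp D a v)"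
    using A(1) free_part_carrier[OF vcomp_mem[OF v]] by (intro sum[symmetric]) auto
  also have "\<dots> = \<epsilon> v" using vB by simp
  also have "\<dots> = (\<Oplus>\<^bsub>M\<^esub>a\<in>?B. if e = a then \<epsilon> v else \<zero>\<^bsub>M\<^esub>)"
    using A(1) closed[OF v] M.finsum_singleton[of e ?B "\<lambda>_. \<epsilon> v"] by simp
  finally have eq: "(\<Oplus>\<^bsub>M\<^esub>a\<in>?B. \<epsilon> (vcomp D a v)) = (\<Oplus>\<^bsub>M\<^esub>a\<in>?B. if e = a then \<epsilon> v else \<zero>\<^bsub>M\<^esub>)" .
  have "(if e = a then \<epsilon> v else \<zero>\<^bsub>M\<^esub>) \<in> graded_part M a" for a
    using x part_zero by (cases "e = a") auto
  from components_unique[OF _ graded[OF vcomp_mem[OF v]] this eq, of e] show ?thesis using A(1) by simp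
qed

lemma kernel_component: "v \<in> carrier (free n D) \<Longrightarrow> \<epsilon> v = \<zero>\<^bsub>M\<^esub> \<Longrightarrow> vcomp D e v \<in> kernel_part e"
  using component[of v e] part_zero vcomp_mem[of v n D e] by (simp add: kernel_part_def)

lemma lift_graded: "x \<in> \<epsilon> ` carrier (free n D) \<Longrightarrow> x \<in> graded_part M e \<Longrightarrow> \<exists>v\<in>free_part n D e. \<epsilon> v = x"
  using component vcomp_mem by blast

end

section \<open>Minimal covers\<close>

context graded_module
begin

lemma submodule_zero: "submodule N (poly_ring n) M \<Longrightarrow> \<zero>\<^bsub>M\<^esub> \<in> N"
  using subgroup.one_closed[OF submodule.axioms(1)] by fastforce

lemma generated_least: "submodule N (poly_ring n) M \<Longrightarrow> A \<subseteq> N \<Longrightarrow> submodule_generated n M A \<subseteq> N"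
  unfolding submodule_generated_def by (intro Inter_lower) simp

lemma generated_superset: "A \<subseteq> submodule_generated n M A"
  unfolding submodule_generated_def by (intro Inter_greatest) simp

lemma generated_submodule:
  assumes "A \<subseteq> carrier M" shows "submodule (submodule_generated n M A) (poly_ring n) M"
proof -
  have iff: "x \<in> submodule_generated n M A \<longleftrightarrow> (\<forall>N. submodule N (poly_ring n) M \<longrightarrow> A \<subseteq> N \<longrightarrow> x \<in> N)" for x
    unfolding submodule_generated_def by auto
  show ?thesis
  proof (rule submoduleI)
    show "submodule_generated n M A \<subseteq> carrier M"
      by (rule generated_least[OF carrier_is_submodule assms])
    show "\<zero>\<^bsub>M\<^esub> \<in> submodule_generated n M A" using submodule_zero by (simp add: iff)
    show "\<ominus>\<^bsub>M\<^esub> a \<in> submodule_generated n M A" if "a \<in> submodule_generated n M A" for a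
      using that submoduleE(3) by (simp add: iff)
    show "a \<oplus>\<^bsub>M\<^esub> b \<in> submodule_generated n M A" if "a \<in> submodule_generated n M A" "b \<in> submodule_generated n M A" for a b
      using that submoduleE(5) by (simp add: iff)
    show "a \<odot>\<^bsub>M\<^esub> x \<in> submodule_generated n M A" if "a \<in> carrier (poly_ring n)" "x \<in> submodule_generated n M A" for a x
      using that submoduleE(4) by (simp add: iff)
  qed
qed

lemma submodule_finsum:
  assumes N: "submodule N (poly_ring n) M" and f: "\<And>i. i \<in> A \<Longrightarrow> f i \<in> N"
  shows "(\<Oplus>\<^bsub>M\<^esub>i\<in>A. f i) \<in> N"
  using submodule_zero[OF N] submoduleE(5)[OF N] submoduleE(1)[OF N] f by (intro M.finsum_mem) auto

definition gen_map :: "'b list \<Rightarrow> 'k vec \<Rightarrow> 'b" where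
  "gen_map xs v = (\<Oplus>\<^bsub>M\<^esub>j\<in>{..<length xs}. v j \<odot>\<^bsub>M\<^esub> xs ! j)"

lemma gen_map_hom:
  assumes len: "length D = length xs" and xs: "\<And>j. j < length xs \<Longrightarrow> xs ! j \<in> graded_part M (D ! j)"
  shows "gen_map xs \<in> graded_hom n (free n D) M"
proof -
  have xc: "xs ! j \<in> carrier M" if "j < length xs" for j using part_carrier[OF xs[OF that]] .
  have vc: "v j \<odot>\<^bsub>M\<^esub> xs ! j \<in> carrier M" if "v \<in> carrier (free n D)" "j < length xs" for v j
    using that xc len by (intro smult_closed) (auto simp: carrier_free_iff)
  have closed: "gen_map xs v \<in> carrier M" if "v \<in> carrier (free n D)" for v
    unfolding gen_map_def using vc[OF that] by (intro M.finsum_closed) auto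
  have add: "gen_map xs (v + w) = gen_map xs v \<oplus>\<^bsub>M\<^esub> gen_map xs w"
    if v: "v \<in> carrier (free n D)" and w: "w \<in> carrier (free n D)" for v w
  proof -
    have "gen_map xs (v + w) = (\<Oplus>\<^bsub>M\<^esub>j\<in>{..<length xs}. v j \<odot>\<^bsub>M\<^esub> xs ! j \<oplus>\<^bsub>M\<^esub> w j \<odot>\<^bsub>M\<^esub> xs ! j)"
      unfolding gen_map_def
    proof (rule M.finsum_cong')
      fix j assume "j \<in> {..<length xs}"
      then show "(v + w) j \<odot>\<^bsub>M\<^esub> xs ! j = v j \<odot>\<^bsub>M\<^esub> xs ! j \<oplus>\<^bsub>M\<^esub> w j \<odot>\<^bsub>M\<^esub> xs ! j"
        using smult_l_distr[of "v j" "w j" "xs ! j"] xc v w len by (simp add: plus_fun_apply carrier_free_iff)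
    qed (use vc v w in auto)
    also have "\<dots> = gen_map xs v \<oplus>\<^bsub>M\<^esub> gen_map xs w"
      unfolding gen_map_def using vc v w by (intro M.finsum_addf) auto
    finally show ?thesis .
  qed
  have scale: "gen_map xs (p \<bullet> v) = p \<odot>\<^bsub>M\<^esub> gen_map xs v"
    if p: "p \<in> carrier (poly_ring n)" and v: "v \<in> carrier (free n D)" for p v
  proof -
    have "p \<odot>\<^bsub>M\<^esub> gen_map xs v = (\<Oplus>\<^bsub>M\<^esub>j\<in>{..<length xs}. p \<odot>\<^bsub>M\<^esub> (v j \<odot>\<^bsub>M\<^esub> xs ! j))"
      unfolding gen_map_def using vc[OF v] p by (intro finsum_smult_ldistr) auto
    also have "\<dots> = gen_map xs (p \<bullet> v)"
      unfolding gen_map_def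
    proof (rule M.finsum_cong')
      fix j assume j: "j \<in> {..<length xs}"
      then show "p \<odot>\<^bsub>M\<^esub> (v j \<odot>\<^bsub>M\<^esub> xs ! j) = (p \<bullet> v) j \<odot>\<^bsub>M\<^esub> xs ! j"
        using smult_assoc1[of p "v j" "xs ! j"] xc p v len by (simp add: vscale_def carrier_free_iff)
    qed (use vc[OF free_carrier_scale[OF p v]] in auto)
    finally show ?thesis by simp
  qed
  have graded: "gen_map xs v \<in> graded_part M e" if v: "v \<in> free_part n D e" for v e
    unfolding gen_map_def
  proof (rule M.finsum_mem[OF part_zero part_add])
    show "graded_part M e \<subseteq> carrier M" using part_carrier by blast
    fix j assume "j \<in> {..<length xs}"
    then have "v j \<odot>\<^bsub>M\<^esub> xs ! j \<in> graded_part M (e - D ! j + D ! j)"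
      using len xs by (intro graded_part_smult free_part_hom[OF v]) auto
    then show "v j \<odot>\<^bsub>M\<^esub> xs ! j \<in> graded_part M e" by simp
  qed
  show ?thesis unfolding graded_hom_def hom_def using closed add scale graded
    by (simp add: Pi_def image_subset_iff)
qed

lemma finsum_split:
  assumes "finite A" "j \<in> A" "\<And>i. i \<in> A \<Longrightarrow> f i \<in> carrier M"
  shows "(\<Oplus>\<^bsub>M\<^esub>i\<in>A. f i) = f j \<oplus>\<^bsub>M\<^esub> (\<Oplus>\<^bsub>M\<^esub>i\<in>A - {j}. f i)"
  using M.finsum_insert[of "A - {j}" j f] assms by (simp add: insert_absorb Pi_def)

text \<open>A generating set of least cardinality gives the cover. A relation with a nonzero constant coefficient would express one generator through the others.\<close>

lemma minimal_cover:
  assumes A: "finite A" "\<forall>a\<in>A. \<exists>e. a \<in> graded_part M e"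
  shows "\<exists>D \<epsilon>. \<epsilon> \<in> graded_hom n (free n D) M \<and> \<epsilon> ` carrier (free n D) = submodule_generated n M A \<and>
    (\<forall>v\<in>carrier (free n D). \<epsilon> v = \<zero>\<^bsub>M\<^esub> \<longrightarrow> (\<forall>j. Poly_Mapping.lookup (v j) 0 = 0))"
proof -
  define P where "P B \<longleftrightarrow> finite B \<and> (\<forall>a\<in>B. \<exists>e. a \<in> graded_part M e) \<and>
    submodule_generated n M B = submodule_generated n M A" for B
  have "P A" using A by (simp add: P_def)
  from ex_has_least_nat[of P, OF this, of card] obtain B where B: "P B" and leastB: "\<forall>C. P C \<longrightarrow> card B \<le> card C"
    by (elim exE conjE)
  have least: "card B \<le> card C" if "P C" for C using leastB that by simp
  have BM: "B \<subseteq> carrier M" and finB: "finite B" using B part_carrier by (auto simp: P_def)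
  obtain xs where xs: "set xs = B" "distinct xs" using finite_distinct_list[OF finB] by blast
  define deg where "deg a = (SOME e. a \<in> graded_part M e)" for a
  have deg: "a \<in> graded_part M (deg a)" if "a \<in> B" for a
    unfolding deg_def using B that by (intro someI_ex[of "\<lambda>e. a \<in> graded_part M e"]) (auto simp: P_def)
  define D where "D = map deg xs"
  have xj: "xs ! j \<in> B" if "j < length xs" for j using that xs(1) by auto
  have len: "length D = length xs" by (simp add: D_def)
  have hom: "gen_map xs \<in> graded_hom n (free n D) M"
    using deg xj by (intro gen_map_hom) (auto simp: D_def)
  interpret E: free_map n M D "gen_map xs"
    by (intro free_map.intro graded_module_axioms free_map_axioms.intro hom)
  have gB: "submodule (submodule_generated n M C) (poly_ring n) M" if "C \<subseteq> B" for C
    using that BM by (intro generated_submodule) auto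
  have term_mem: "v j \<odot>\<^bsub>M\<^esub> xs ! j \<in> submodule_generated n M C"
    if "v \<in> carrier (free n D)" "C \<subseteq> B" "xs ! j \<in> C" "j < length xs" for v j C
  proof -
    have "xs ! j \<in> submodule_generated n M C" using generated_superset that by blast
    then show ?thesis using that len by (intro submoduleE(4)[OF gB]) (auto simp: carrier_free_iff)
  qed
  have "gen_map xs ` carrier (free n D) = submodule_generated n M B"
  proof
    show "gen_map xs ` carrier (free n D) \<subseteq> submodule_generated n M B"
    proof
      fix x assume "x \<in> gen_map xs ` carrier (free n D)"
      then obtain v where v: "v \<in> carrier (free n D)" "x = gen_map xs v" by blast
      show "x \<in> submodule_generated n M B"
        unfolding v(2) gen_map_def using term_mem[OF v(1) subset_refl] xj by (intro submodule_finsum gB) auto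
    qed
    have "submodule (gen_map xs ` carrier (free n D)) (poly_ring n) M"
    proof (rule submoduleI)
      show "gen_map xs ` carrier (free n D) \<subseteq> carrier M" using E.closed by blast
      show "\<zero>\<^bsub>M\<^esub> \<in> gen_map xs ` carrier (free n D)" by (rule image_eqI[of _ _ 0]) simp_all
      show "\<ominus>\<^bsub>M\<^esub> a \<in> gen_map xs ` carrier (free n D)" if "a \<in> gen_map xs ` carrier (free n D)" for a
        using that E.uminus[symmetric] by (elim imageE) (simp, intro imageI free_carrier_uminus)
      show "a \<oplus>\<^bsub>M\<^esub> b \<in> gen_map xs ` carrier (free n D)"
        if "a \<in> gen_map xs ` carrier (free n D)" "b \<in> gen_map xs ` carrier (free n D)" for a b
        using that E.add[symmetric] by (elim imageE) (simp, rule imageI, rule free_carrier_add)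
      show "p \<odot>\<^bsub>M\<^esub> a \<in> gen_map xs ` carrier (free n D)"
        if "p \<in> carrier (poly_ring n)" "a \<in> gen_map xs ` carrier (free n D)" for p a
        using that E.scale[symmetric] by (elim imageE) (simp, rule imageI, rule free_carrier_scale)
    qed
    moreover have "B \<subseteq> gen_map xs ` carrier (free n D)"
    proof
      fix a assume "a \<in> B"
      then obtain j where j: "j < length xs" "a = xs ! j" using xs(1) by (auto simp: in_set_conv_nth)
      define u where "u = (\<lambda>i. if i = j then 1 else 0 :: 'k mpol)"
      have u: "u \<in> carrier (free n D)" using j len by (auto simp: u_def carrier_free_iff)
      have c: "xs ! i \<in> carrier M" if "i < length xs" for i using xj[OF that] BM by blast
      have "gen_map xs u = (\<Oplus>\<^bsub>M\<^esub>i\<in>{..<length xs}. if j = i then xs ! i else \<zero>\<^bsub>M\<^esub>)"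
        unfolding gen_map_def
      proof (rule M.finsum_cong')
        fix i assume "i \<in> {..<length xs}"
        then show "u i \<odot>\<^bsub>M\<^esub> xs ! i = (if j = i then xs ! i else \<zero>\<^bsub>M\<^esub>)"
          using smult_one[OF c, of i] smult_l_null[OF c, of i] by (auto simp: u_def)
      qed (use c in auto)
      also have "\<dots> = xs ! j" using j c by (intro M.finsum_singleton) auto
      finally show "a \<in> gen_map xs ` carrier (free n D)" using u j by (intro image_eqI[of _ _ u]) auto
    qed
    ultimately show "submodule_generated n M B \<subseteq> gen_map xs ` carrier (free n D)" by (rule generated_least)
  qed
  moreover have "Poly_Mapping.lookup (v j) 0 = 0"
    if v: "v \<in> carrier (free n D)" "gen_map xs v = \<zero>\<^bsub>M\<^esub>" for v j
  proof (rule ccontr)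
    assume nz: "Poly_Mapping.lookup (v j) 0 \<noteq> 0"
    have j: "j < length xs" using nz v(1) len by (cases "j < length xs") (auto simp: carrier_free_iff)
    define w where "w = vcomp D (D ! j) v"
    have w: "w \<in> free_part n D (D ! j)" "gen_map xs w = \<zero>\<^bsub>M\<^esub>"
      using E.kernel_component[OF v] by (auto simp: w_def E.kernel_part_def)
    have wc: "w \<in> carrier (free n D)" by (rule free_part_carrier[OF w(1)])
    define c where "c = Poly_Mapping.lookup (w j) 0"
    have "c = Poly_Mapping.lookup (v j) 0" using j len by (simp add: c_def w_def vcomp_def lookup_hcomp)
    then have c: "c \<noteq> 0" using nz by simp
    have "w j \<in> hom_part n 0" using free_part_hom[OF w(1), of j] j len by simp
    then have wj: "w j = const c" unfolding c_def by (rule hom_part_deg0)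
    define C where "C = B - {xs ! j}"
    define S where "S = (\<Oplus>\<^bsub>M\<^esub>i\<in>{..<length xs} - {j}. w i \<odot>\<^bsub>M\<^esub> xs ! i)"
    have CB: "C \<subseteq> B" by (auto simp: C_def)
    have S: "S \<in> submodule_generated n M C" unfolding S_def
    proof (rule submodule_finsum[OF gB[OF CB]])
      fix i assume i: "i \<in> {..<length xs} - {j}"
      then have "xs ! i \<in> C" using xj xs(2) j by (auto simp: C_def nth_eq_iff_index_eq)
      then show "w i \<odot>\<^bsub>M\<^esub> xs ! i \<in> submodule_generated n M C" using i by (intro term_mem[OF wc CB]) auto
    qed
    have xjc: "xs ! j \<in> carrier M" using xj[OF j] BM by blast
    have tc: "w i \<odot>\<^bsub>M\<^esub> xs ! i \<in> carrier M" if "i < length xs" for i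
      using that xj[OF that] BM wc len by (intro smult_closed) (auto simp: carrier_free_iff)
    have "w j \<odot>\<^bsub>M\<^esub> xs ! j \<oplus>\<^bsub>M\<^esub> S = \<zero>\<^bsub>M\<^esub>"
      using w(2) finsum_split[of "{..<length xs}" j "\<lambda>i. w i \<odot>\<^bsub>M\<^esub> xs ! i"] j tc
      by (simp add: gen_map_def S_def)
    then have "\<ominus>\<^bsub>M\<^esub> S = w j \<odot>\<^bsub>M\<^esub> xs ! j"
      using tc[OF j] S submoduleE(1)[OF gB[OF CB]] by (intro M.minus_equality) auto
    then have h: "const c \<odot>\<^bsub>M\<^esub> xs ! j \<in> submodule_generated n M C"
      using submoduleE(3)[OF gB[OF CB] S] wj by simp
    have cc: "const (1 / c) \<in> carrier (poly_ring n)" "const c \<in> carrier (poly_ring n)"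
      by (rule hom_part_carrier[OF hom_part_const])+
    have "const (1 / c) \<odot>\<^bsub>M\<^esub> (const c \<odot>\<^bsub>M\<^esub> xs ! j) \<in> submodule_generated n M C"
      by (rule submoduleE(4)[OF gB[OF CB] cc(1) h])
    moreover have "const (1 / c) * const c = (1 :: 'k mpol)" using c by (simp add: const_mult)
    ultimately have "xs ! j \<in> submodule_generated n M C"
      using smult_assoc1[OF cc xjc] smult_one[OF xjc] by simp
    then have "B \<subseteq> submodule_generated n M C" using generated_superset[of C] by (auto simp: C_def)
    then have "submodule_generated n M B \<subseteq> submodule_generated n M C" by (rule generated_least[OF gB[OF CB]])
    moreover have "submodule_generated n M C \<subseteq> submodule_generated n M B"
      using generated_superset[of B] CB by (intro generated_least[OF gB[OF subset_refl]]) auto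
    ultimately have "P C" using B CB finB by (auto simp: P_def finite_subset)
    then have "card B \<le> card C" by (rule least)
    moreover have "card C < card B" unfolding C_def using xj[OF j] finB by (intro card_Diff1_less)
    ultimately show False by simp
  qed
  moreover have "submodule_generated n M B = submodule_generated n M A" using B by (simp add: P_def)
  ultimately show ?thesis using hom by (intro exI[of _ D] exI[of _ "gen_map xs"]) simp
qed

end

lemma free_a_inv: "v \<in> carrier (free n D) \<Longrightarrow> \<ominus>\<^bsub>free n D\<^esub> v = - v"
proof -
  interpret F: Module.module "poly_ring n" "free n D" by (rule module_free)
  assume "v \<in> carrier (free n D)"
  then show ?thesis using free_carrier_uminus[of v n D] by (intro F.M.minus_equality) simp_all
qed

lemma (in free_map) kernel_cover:
  "\<exists>D' \<delta>. \<delta> \<in> graded_hom n (free n D') (free n D) \<and>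
    \<delta> ` carrier (free n D') = {v \<in> carrier (free n D). \<epsilon> v = \<zero>\<^bsub>M\<^esub>} \<and>
    (\<forall>v\<in>carrier (free n D'). \<delta> v = 0 \<longrightarrow> (\<forall>j. Poly_Mapping.lookup (v j) 0 = 0))"
proof -
  interpret F: graded_module n "free n D" by (rule graded_module_free)
  define K where "K = {v \<in> carrier (free n D). \<epsilon> v = \<zero>\<^bsub>M\<^esub>}"
  obtain B where B: "finite B" "\<forall>(e, v)\<in>B. v \<in> kernel_part e"
    and gen: "\<forall>W. graded_sub n W \<longrightarrow> (\<forall>(e, v)\<in>B. v \<in> W e) \<longrightarrow> (\<forall>e. kernel_part e \<subseteq> W e)"
    using graded_submodule_fg[OF graded_sub_kernel kernel_part_subset] by (elim exE conjE)
  define A where "A = snd ` B"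
  have AB: "\<exists>e. a \<in> kernel_part e \<and> (e, a) \<in> B" if "a \<in> A" for a
  proof -
    from that obtain x where "x \<in> B" "a = snd x" unfolding A_def by (elim imageE)
    then show ?thesis using B(2) by (intro exI[of _ "fst x"]) (auto simp: case_prod_beta)
  qed
  have finA: "finite A" using B(1) by (simp add: A_def)
  have homA: "\<forall>a\<in>A. \<exists>e. a \<in> graded_part (free n D) e"
  proof
    fix a assume "a \<in> A"
    then obtain e where "a \<in> kernel_part e" using AB by blast
    then show "\<exists>e. a \<in> graded_part (free n D) e" using kernel_part_subset by (intro exI[of _ e]) auto
  qed
  have AK: "A \<subseteq> K"
  proof
    fix a assume "a \<in> A"
    then obtain e where "a \<in> kernel_part e" using AB by blast
    then show "a \<in> K" using free_part_carrier by (auto simp: K_def kernel_part_def)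
  qed
  have subK: "submodule K (poly_ring n) (free n D)"
  proof (rule F.submoduleI)
    show "K \<subseteq> carrier (free n D)" by (auto simp: K_def)
    show "\<zero>\<^bsub>free n D\<^esub> \<in> K" by (simp add: K_def)
    show "\<ominus>\<^bsub>free n D\<^esub> a \<in> K" if "a \<in> K" for a
      using that free_carrier_uminus[of a n D] by (simp add: K_def free_a_inv uminus)
    show "a \<oplus>\<^bsub>free n D\<^esub> b \<in> K" if "a \<in> K" "b \<in> K" for a b
      using that free_carrier_add[of a n D b] by (simp add: K_def add)
    show "p \<odot>\<^bsub>free n D\<^esub> a \<in> K" if "p \<in> carrier (poly_ring n)" "a \<in> K" for p a
      using that free_carrier_scale[of p n a D] by (simp add: K_def scale)
  qed
  define G where "G = submodule_generated n (free n D) A"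
  have "A \<subseteq> carrier (free n D)" using AK by (auto simp: K_def)
  then have subG: "submodule G (poly_ring n) (free n D)" unfolding G_def by (rule F.generated_submodule)
  have "G = K"
  proof
    show "G \<subseteq> K" unfolding G_def by (rule F.generated_least[OF subK AK])
    define W where "W e = free_part n D e \<inter> G" for e
    have "graded_sub n W"
      unfolding graded_sub_def
    proof (intro conjI allI ballI)
      show "0 \<in> W e" for e using gs_0[OF graded_sub_free_part] F.submodule_zero[OF subG] by (simp add: W_def)
      show "v + w \<in> W e" if "v \<in> W e" "w \<in> W e" for v w e
        using that gs_add[OF graded_sub_free_part, of v n D e w] F.submoduleE(5)[OF subG, of v w] by (simp add: W_def)
      show "p \<bullet> v \<in> W (a + e)" if "p \<in> hom_part n a" "v \<in> W e" for p v a e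
        using that gs_scale[OF graded_sub_free_part that(1), of v D e "a + e"] F.submoduleE(4)[OF subG, of p v] by (simp add: W_def hom_part_carrier)
    qed
    moreover have "\<forall>(e, v)\<in>B. v \<in> W e"
    proof (rule ballI)
      fix x assume x: "x \<in> B"
      then have "snd x \<in> kernel_part (fst x)" using B(2) by (auto simp: case_prod_beta)
      moreover have "snd x \<in> G" using F.generated_superset[of A] x by (auto simp: G_def A_def)
      ultimately show "case x of (e, v) \<Rightarrow> v \<in> W e" by (simp add: case_prod_beta W_def kernel_part_def)
    qed
    ultimately have KW: "kernel_part e \<subseteq> W e" for e using gen by simp
    show "K \<subseteq> G"
    proof
      fix v assume v: "v \<in> K"
      then have vc: "v \<in> carrier (free n D)" "\<epsilon> v = \<zero>\<^bsub>M\<^esub>" by (auto simp: K_def)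
      obtain S where S: "finite S" "\<And>B. finite B \<Longrightarrow> S \<subseteq> B \<Longrightarrow> v = (\<Sum>e\<in>B. vcomp D e v)"
        using vcomp_sum_all[OF vc(1)] by auto
      have vG: "vcomp D e v \<in> G" for e using kernel_component[OF vc, of e] KW by (auto simp: W_def)
      have sG: "(\<Sum>e\<in>S'. vcomp D e v) \<in> G" if "finite S'" for S'
        using that
      proof (induction S' rule: finite_induct)
        case (insert a S')
        then show ?case using F.submoduleE(5)[OF subG, of "vcomp D a v" "\<Sum>e\<in>S'. vcomp D e v"] vG by simp
      qed (use F.submodule_zero[OF subG] in \<open>simp del: zero_fun_apply\<close>)
      have "v = (\<Sum>e\<in>S. vcomp D e v)" by (rule S(2)[OF S(1) subset_refl])
      with sG[OF S(1)] show "v \<in> G" by simp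
    qed
  qed
  then show ?thesis using F.minimal_cover[OF finA homA] by (simp add: G_def K_def)
qed

section \<open>Resolutions\<close>

definition free_resolution ::
    "nat \<Rightarrow> (('k::field) mpol, 'b) graded_module \<Rightarrow> (nat \<Rightarrow> int list) \<Rightarrow> ('k vec \<Rightarrow> 'b) \<Rightarrow> (nat \<Rightarrow> 'k vec \<Rightarrow> 'k vec) \<Rightarrow> bool" where
  "free_resolution n M D \<epsilon> \<delta> \<longleftrightarrow>
    \<epsilon> \<in> graded_hom n (free n (D 0)) M \<and> \<epsilon> ` carrier (free n (D 0)) = carrier M \<and>
    (\<forall>p. \<delta> p \<in> graded_hom n (free n (D (Suc p))) (free n (D p))) \<and>
    \<delta> 0 ` carrier (free n (D (Suc 0))) = {v \<in> carrier (free n (D 0)). \<epsilon> v = \<zero>\<^bsub>M\<^esub>} \<and>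
    (\<forall>p. \<delta> (Suc p) ` carrier (free n (D (Suc (Suc p)))) = {v \<in> carrier (free n (D (Suc p))). \<delta> p v = 0})"

definition minimal_differential :: "nat \<Rightarrow> (nat \<Rightarrow> int list) \<Rightarrow> (nat \<Rightarrow> ('k::field) vec \<Rightarrow> 'k vec) \<Rightarrow> bool" where
  "minimal_differential n D \<delta> \<longleftrightarrow>
    (\<forall>p. \<forall>v\<in>carrier (free n (D (Suc p))). \<forall>j. Poly_Mapping.lookup (\<delta> p v j) 0 = 0)"

lemma homogeneous_generators:
  assumes "fg_graded_module n M"
  shows "\<exists>A. finite A \<and> (\<forall>a\<in>A. \<exists>e. a \<in> graded_part M e) \<and> submodule_generated n M A = carrier M"
proof -
  interpret graded_module n M using assms by (simp add: fg_graded_module_def)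
  obtain A where A: "finite A" "A \<subseteq> carrier M" "submodule_generated n M A = carrier M"
    using assms unfolding fg_graded_module_def by (elim conjE exE)
  have "\<exists>f. (\<forall>e. f e \<in> graded_part M e) \<and> finite {e. f e \<noteq> \<zero>\<^bsub>M\<^esub>} \<and>
             (\<Oplus>\<^bsub>M\<^esub>e \<in> {e. f e \<noteq> \<zero>\<^bsub>M\<^esub>}. f e) = a" if "a \<in> carrier M" for a
    using direct_sum[OF that] by (rule ex1_implies_ex)
  then have "\<forall>a\<in>carrier M. \<exists>f. (\<forall>e. f e \<in> graded_part M e) \<and> finite {e. f e \<noteq> \<zero>\<^bsub>M\<^esub>} \<and>
             (\<Oplus>\<^bsub>M\<^esub>e \<in> {e. f e \<noteq> \<zero>\<^bsub>M\<^esub>}. f e) = a" by (rule ballI)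
  from bchoice[OF this] obtain f where f': "\<forall>a\<in>carrier M. (\<forall>e. f a e \<in> graded_part M e) \<and> finite {e. f a e \<noteq> \<zero>\<^bsub>M\<^esub>} \<and>
             (\<Oplus>\<^bsub>M\<^esub>e \<in> {e. f a e \<noteq> \<zero>\<^bsub>M\<^esub>}. f a e) = a" by (elim exE)
  have f: "(\<forall>e. f a e \<in> graded_part M e) \<and> finite {e. f a e \<noteq> \<zero>\<^bsub>M\<^esub>} \<and>
             (\<Oplus>\<^bsub>M\<^esub>e \<in> {e. f a e \<noteq> \<zero>\<^bsub>M\<^esub>}. f a e) = a" if "a \<in> carrier M" for a
    using f' that by (rule bspec)
  define C where "C = (\<Union>a\<in>A. f a ` {e. f a e \<noteq> \<zero>\<^bsub>M\<^esub>})"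
  have finC: "finite C" unfolding C_def using A f by (intro finite_UN_I finite_imageI) auto
  have homC: "\<exists>e. c \<in> graded_part M e" if "c \<in> C" for c
  proof -
    from that obtain a e where "a \<in> A" "c = f a e" unfolding C_def by (elim UN_E imageE)
    then show ?thesis using f[of a] A(2) by (intro exI[of _ e]) auto
  qed
  have CM: "C \<subseteq> carrier M" using homC part_carrier by blast
  have sub: "submodule (submodule_generated n M C) (poly_ring n) M" by (rule generated_submodule[OF CM])
  have "A \<subseteq> submodule_generated n M C"
  proof
    fix a assume a: "a \<in> A"
    have "(\<Oplus>\<^bsub>M\<^esub>e \<in> {e. f a e \<noteq> \<zero>\<^bsub>M\<^esub>}. f a e) \<in> submodule_generated n M C"
      using generated_superset[of C] a by (intro submodule_finsum[OF sub]) (auto simp: C_def)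
    then show "a \<in> submodule_generated n M C" using f A(2) a by auto
  qed
  from generated_least[OF sub this] have "carrier M \<subseteq> submodule_generated n M C" unfolding A(3) .
  then have "submodule_generated n M C = carrier M" using submoduleE(1)[OF sub] by blast
  then show ?thesis using finC homC by blast
qed

lemma free_map_free: "\<delta> \<in> graded_hom n (free n D') (free n D) \<Longrightarrow> free_map n (free n D) D' \<delta>"
  by (intro free_map.intro graded_module_free free_map_axioms.intro)

theorem minimal_resolution_exists:
  fixes M :: "(('k::field) mpol, 'b) graded_module"
  assumes "fg_graded_module n M"
  shows "\<exists>D \<epsilon> \<delta>. free_resolution n M D \<epsilon> \<delta> \<and> minimal_differential n D \<delta>"
proof -
  interpret graded_module n M using assms by (simp add: fg_graded_module_def)
  define pos where "pos v \<longleftrightarrow> (\<forall>j. Poly_Mapping.lookup (v j) 0 = 0)" for v :: "'k vec"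
  from homogeneous_generators[OF assms] obtain A where
    A: "finite A" "\<forall>a\<in>A. \<exists>e. a \<in> graded_part M e" "submodule_generated n M A = carrier M" by (elim exE conjE)
  from minimal_cover[OF A(1,2), unfolded A(3)] obtain D0 \<epsilon> where eps: "\<epsilon> \<in> graded_hom n (free n D0) M" "\<epsilon> ` carrier (free n D0) = carrier M"
    "\<forall>v\<in>carrier (free n D0). \<epsilon> v = \<zero>\<^bsub>M\<^esub> \<longrightarrow> pos v"
    unfolding pos_def by (elim exE conjE)
  interpret E: free_map n M D0 \<epsilon> by (intro free_map.intro graded_module_axioms free_map_axioms.intro eps(1))
  define P :: "nat \<Rightarrow> int list \<times> int list \<times> ('k vec \<Rightarrow> 'k vec) \<Rightarrow> bool" where
    "P p x \<longleftrightarrow> snd (snd x) \<in> graded_hom n (free n (fst (snd x))) (free n (fst x)) \<and>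
      (\<forall>v\<in>carrier (free n (fst (snd x))). snd (snd x) v = 0 \<longrightarrow> pos v) \<and>
      (p = 0 \<longrightarrow> fst x = D0 \<and> snd (snd x) ` carrier (free n (fst (snd x))) = {v \<in> carrier (free n D0). \<epsilon> v = \<zero>\<^bsub>M\<^esub>})" for p x
  define Q :: "nat \<Rightarrow> int list \<times> int list \<times> ('k vec \<Rightarrow> 'k vec) \<Rightarrow> int list \<times> int list \<times> ('k vec \<Rightarrow> 'k vec) \<Rightarrow> bool" where
    "Q p x z \<longleftrightarrow> fst z = fst (snd x) \<and>
      snd (snd z) ` carrier (free n (fst (snd z))) = {v \<in> carrier (free n (fst (snd x))). snd (snd x) v = 0}" for p x z
  have "\<exists>f. \<forall>p. P p (f p) \<and> Q p (f p) (f (Suc p))"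
  proof (rule dependent_nat_choice)
    from E.kernel_cover obtain D' \<delta> where "\<delta> \<in> graded_hom n (free n D') (free n D0)"
      "\<delta> ` carrier (free n D') = {v \<in> carrier (free n D0). \<epsilon> v = \<zero>\<^bsub>M\<^esub>}"
      "\<forall>v\<in>carrier (free n D'). \<delta> v = 0 \<longrightarrow> pos v"
      unfolding pos_def by (elim exE conjE)
    then have "P 0 (D0, D', \<delta>)" by (simp add: P_def)
    then show "\<exists>x. P 0 x" by blast
  next
    fix x p assume "P p x"
    then interpret K: free_map n "free n (fst x)" "fst (snd x)" "snd (snd x)"
      by (intro free_map_free) (simp add: P_def)
    from K.kernel_cover obtain D' \<delta> where "\<delta> \<in> graded_hom n (free n D') (free n (fst (snd x)))"
      "\<delta> ` carrier (free n D') = {v \<in> carrier (free n (fst (snd x))). snd (snd x) v = \<zero>\<^bsub>free n (fst x)\<^esub>}"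
      "\<forall>v\<in>carrier (free n D'). \<delta> v = 0 \<longrightarrow> pos v"
      unfolding pos_def by (elim exE conjE)
    then have "P (Suc p) (fst (snd x), D', \<delta>) \<and> Q p x (fst (snd x), D', \<delta>)" by (simp add: P_def Q_def)
    then show "\<exists>z. P (Suc p) z \<and> Q p x z" by (rule exI)
  qed
  then obtain f where f': "\<forall>p. P p (f p) \<and> Q p (f p) (f (Suc p))" by (elim exE)
  then have f: "P p (f p)" "Q p (f p) (f (Suc p))" for p by simp_all
  define D where "D p = fst (f p)" for p
  define \<delta> where "\<delta> p = snd (snd (f p))" for p
  have DS: "fst (snd (f p)) = D (Suc p)" for p using f(2)[of p] by (simp add: Q_def D_def)
  have D0: "D 0 = D0" using f(1)[of 0] by (simp add: P_def D_def)
  have im0: "\<delta> 0 ` carrier (free n (D (Suc 0))) = {v \<in> carrier (free n D0). \<epsilon> v = \<zero>\<^bsub>M\<^esub>}"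
    using f(1)[of 0] by (simp add: P_def \<delta>_def DS)
  have im: "\<delta> (Suc p) ` carrier (free n (D (Suc (Suc p)))) = {v \<in> carrier (free n (D (Suc p))). \<delta> p v = 0}" for p
    using f(2)[of p] by (simp add: Q_def \<delta>_def DS)
  have hom: "\<delta> p \<in> graded_hom n (free n (D (Suc p))) (free n (D p))" for p
    using f(1)[of p] by (simp add: P_def \<delta>_def DS D_def[symmetric])
  have ker: "pos v" if "v \<in> carrier (free n (D (Suc p)))" "\<delta> p v = 0" for p v
    using f(1)[of p] that by (simp add: P_def \<delta>_def DS)
  have "free_resolution n M D \<epsilon> \<delta>"
    unfolding free_resolution_def using eps im0 im hom by (simp add: D0)
  moreover have "pos (\<delta> p v)" if "v \<in> carrier (free n (D (Suc p)))" for p v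
  proof (cases p)
    case 0
    then have "\<delta> p v \<in> {v \<in> carrier (free n D0). \<epsilon> v = \<zero>\<^bsub>M\<^esub>}" using that im0 by blast
    then show ?thesis using eps(3) by simp
  next
    case (Suc p')
    then have "\<delta> p v \<in> {v \<in> carrier (free n (D (Suc p'))). \<delta> p' v = 0}" using that im[of p'] by blast
    then show ?thesis using ker[of _ p'] by simp
  qed
  then have "minimal_differential n D \<delta>" unfolding minimal_differential_def pos_def by blast
  ultimately show ?thesis by (intro exI conjI)
qed

declare zero_fun_apply [simp del]

section \<open>Hyperplane sections of a quotient of a free module\<close>

definition slice :: "nat \<Rightarrow> (nat \<Rightarrow> ('k::field) mpol) \<Rightarrow> int list \<Rightarrow> (int \<Rightarrow> 'k vec set) \<Rightarrow> nat \<Rightarrow> int \<Rightarrow> 'k vec set" where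
  "slice n y D U i e = {u + h | u h. u \<in> U e \<and> h \<in> multiples y {..<i} (free_part n D) e}"

lemma sliceI: "u \<in> U e \<Longrightarrow> h \<in> multiples y {..<i} (free_part n D) e \<Longrightarrow> v = u + h \<Longrightarrow> v \<in> slice n y D U i e"
  unfolding slice_def by blast

lemma sliceE:
  assumes "v \<in> slice n y D U i e"
  obtains u h where "u \<in> U e" "h \<in> multiples y {..<i} (free_part n D) e" "v = u + h"
  using assms unfolding slice_def by blast

lemma slice_mono: "(\<And>e. U e \<subseteq> V e) \<Longrightarrow> slice n y D U i e \<subseteq> slice n y D V i e"
  unfolding slice_def by blast

lemma slice_cong: "(\<And>l. l < i \<Longrightarrow> y l = y' l) \<Longrightarrow> slice n y D U i = slice n y' D U i"
  unfolding slice_def using multiples_cong[of "{..<i}" y y'] by (intro ext) simp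

lemma graded_sub_slice:
  fixes U :: "int \<Rightarrow> ('k::field) vec set"
  assumes U: "graded_sub n U" shows "graded_sub n (slice n y D U i)"
proof -
  have J: "graded_sub n (multiples y {..<i} (free_part n D))"
    by (rule graded_sub_multiples[OF graded_sub_free_part])
  show ?thesis
    unfolding graded_sub_def
  proof (intro conjI allI ballI)
    show "0 \<in> slice n y D U i e" for e
      using gs_0[OF U] gs_0[OF J] by (rule sliceI) simp
    fix e v assume "v \<in> slice n y D U i e"
    then obtain u h where v: "u \<in> U e" "h \<in> multiples y {..<i} (free_part n D) e" "v = u + h" by (rule sliceE)
    { fix w assume "w \<in> slice n y D U i e"
      then obtain u' h' where w: "u' \<in> U e" "h' \<in> multiples y {..<i} (free_part n D) e" "w = u' + h'" by (rule sliceE)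
      show "v + w \<in> slice n y D U i e"
        using gs_add[OF U v(1) w(1)] gs_add[OF J v(2) w(2)] by (rule sliceI) (simp add: v(3) w(3)) }
    { fix a and q :: "'k mpol" assume q: "q \<in> hom_part n a"
      show "q \<bullet> v \<in> slice n y D U i (a + e)"
        using gs_scale[OF U q v(1) refl] gs_scale[OF J q v(2) refl]
        by (rule sliceI) (simp add: v(3) vec.scale_right_distrib) }
  qed
qed

definition torsion_bound :: "nat \<Rightarrow> (nat \<Rightarrow> ('k::field) mpol) \<Rightarrow> int list \<Rightarrow> (int \<Rightarrow> 'k vec set) \<Rightarrow> int \<Rightarrow> bool" where
  "torsion_bound n y D U c \<longleftrightarrow> (\<forall>i\<le>Suc n. \<forall>e v. c < e \<longrightarrow> v \<in> free_part n D e \<longrightarrow>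
    v \<in> torsion y (Suc n) (slice n y D U i) e \<longrightarrow> v \<in> slice n y D U i e)"

definition almost_regular :: "nat \<Rightarrow> (nat \<Rightarrow> ('k::field) mpol) \<Rightarrow> int list \<Rightarrow> (int \<Rightarrow> 'k vec set) \<Rightarrow> bool" where
  "almost_regular n y D U \<longleftrightarrow> (\<forall>i\<le>n. \<forall>e v. v \<in> free_part n D e \<longrightarrow> y i \<bullet> v \<in> slice n y D U i (e + 1) \<longrightarrow>
    v \<in> torsion y (Suc n) (slice n y D U i) e)"

abbreviation lin_forms :: "nat \<Rightarrow> (nat \<Rightarrow> 'k::field) \<Rightarrow> nat \<Rightarrow> 'k mpol" where
  "lin_forms n c \<equiv> \<lambda>l. lin_form n l (c l)"

text \<open>The forms are chosen one after the other. The condition on \<open>y\<^sub>i\<close> is stated with the saturation, since it then involves only the forms up to \<open>y\<^sub>i\<close> and survives the later choices.\<close>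

theorem almost_regular_exists:
  fixes D :: "nat \<Rightarrow> int list" and U :: "nat \<Rightarrow> int \<Rightarrow> ('k::field) vec set"
  assumes inf: "infinite (UNIV :: 'k set)" and A: "finite A"
    and U: "\<And>a. a \<in> A \<Longrightarrow> graded_sub n (U a)" "\<And>a e. a \<in> A \<Longrightarrow> U a e \<subseteq> free_part n (D a) e"
  shows "\<exists>c. \<forall>a\<in>A. almost_regular n (lin_forms n c) (D a) (U a)"
proof -
  define S where "S c a i = saturation n (free_part n (D a)) (slice n (lin_forms n c) (D a) (U a) i)" for c a i
  define good where "good c i \<longleftrightarrow> (\<forall>a\<in>A. \<forall>e v. v \<in> free_part n (D a) e \<longrightarrow>
    lin_form n i (c i) \<bullet> v \<in> slice n (lin_forms n c) (D a) (U a) i (e + 1) \<longrightarrow> v \<in> S c a i e)" for c i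
  have "\<exists>c. \<forall>i<m. good c i" if "m \<le> Suc n" for m
    using that
  proof (induction m)
    case (Suc m)
    then obtain c where c: "\<forall>i<m. good c i" by auto
    define bad where "bad a = {b. \<exists>e. \<exists>v\<in>free_part n (D a) e. v \<notin> S c a m e \<and>
        lin_form n m b \<bullet> v \<in> slice n (lin_forms n c) (D a) (U a) m (e + 1)}" for a
    have "finite (bad a)" if a: "a \<in> A" for a
      unfolding bad_def S_def
    proof (rule finitely_many_bad_forms[OF graded_sub_slice[OF U(1)[OF a]]])
      show "m \<le> n" using Suc.prems by simp
      show "slice n (lin_forms n c) (D a) (U a) m e \<subseteq> free_part n (D a) e" for e
      proof
        fix v assume "v \<in> slice n (lin_forms n c) (D a) (U a) m e"
        then obtain u h where v: "u \<in> U a e" "h \<in> multiples (lin_forms n c) {..<m} (free_part n (D a)) e" "v = u + h"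
          by (rule sliceE)
        have "h \<in> free_part n (D a) e"
          using multiples_subset[OF graded_sub_free_part, of "{..<m}" "lin_forms n c" n "D a" e] hom_part_lin_form v(2) by blast
        then show "v \<in> free_part n (D a) e" unfolding v(3)
          using U(2)[OF a, of e] v(1) by (intro gs_add[OF graded_sub_free_part]) auto
      qed
      fix l e and v :: "'k vec" assume "l < m" "v \<in> free_part n (D a) e"
      then have "lin_form n l (c l) \<bullet> v \<in> multiples (lin_forms n c) {..<m} (free_part n (D a)) (e + 1)"
        using multiples_single[OF graded_sub_free_part, of "{..<m}" l v n "D a" "e + 1" "lin_forms n c"] by simp
      with gs_0[OF U(1)[OF a]] show "lin_form n l (c l) \<bullet> v \<in> slice n (lin_forms n c) (D a) (U a) m (e + 1)"
        by (rule sliceI) simp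
    qed
    then have "finite (\<Union>a\<in>A. bad a)" using A by blast
    then obtain b where b: "b \<notin> (\<Union>a\<in>A. bad a)" using ex_new_if_finite[OF inf] by metis
    define c' where "c' = c(m := b)"
    have same: "slice n (lin_forms n c') (D a) (U a) i = slice n (lin_forms n c) (D a) (U a) i" if "i \<le> m" for a i
      using that by (intro slice_cong) (simp add: c'_def)
    have "good c' i" if "i < Suc m" for i
    proof (cases "i = m")
      case True
      show ?thesis unfolding good_def
      proof (intro ballI allI impI)
        fix a e and v :: "'k vec" assume a: "a \<in> A" and v: "v \<in> free_part n (D a) e"
          "lin_form n i (c' i) \<bullet> v \<in> slice n (lin_forms n c') (D a) (U a) i (e + 1)"
        show "v \<in> S c' a i e"
        proof (rule ccontr)
          assume "v \<notin> S c' a i e"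
          then have "v \<notin> S c a m e" using same[of m a] True by (simp add: S_def)
          moreover have "lin_form n m b \<bullet> v \<in> slice n (lin_forms n c) (D a) (U a) m (e + 1)"
            using v(2) same[of m a] True by (simp add: c'_def)
          ultimately have "b \<in> bad a" unfolding bad_def using v(1) by (intro CollectI exI bexI conjI)
          then show False using a b by blast
        qed
      qed
    next
      case False
      then have i: "i < m" using that by simp
      have "S c' a i = S c a i" for a using same[of i a] i by (simp add: S_def)
      moreover have "c' i = c i" using i by (simp add: c'_def)
      ultimately show ?thesis using c i same[of i] by (simp add: good_def)
    qed
    then show ?case by blast
  qed simp
  from this[of "Suc n"] obtain c where c: "\<forall>i<Suc n. good c i" by auto
  have "almost_regular n (lin_forms n c) (D a) (U a)" if a: "a \<in> A" for a
    unfolding almost_regular_def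
  proof (intro allI impI)
    fix i e and v :: "'k vec" assume i: "i \<le> n" and v: "v \<in> free_part n (D a) e"
      "lin_form n i (c i) \<bullet> v \<in> slice n (lin_forms n c) (D a) (U a) i (e + 1)"
    have "good c i" using c i by simp
    then have "v \<in> S c a i e" using a v by (simp add: good_def)
    then show "v \<in> torsion (lin_forms n c) (Suc n) (slice n (lin_forms n c) (D a) (U a) i) e"
      unfolding S_def by (rule saturation_torsion[OF hom_part_lin_form])
  qed
  then show ?thesis by blast
qed

section \<open>Resolutions and torsion bounds\<close>

definition kernel_sub :: "nat \<Rightarrow> (('k::field) mpol, 'b) graded_module \<Rightarrow> int list \<Rightarrow> ('k vec \<Rightarrow> 'b) \<Rightarrow> int \<Rightarrow> 'k vec set" where
  "kernel_sub n M D \<epsilon> e = {v \<in> free_part n D e. \<epsilon> v = \<zero>\<^bsub>M\<^esub>}"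

lemma (in free_map) kernel_part_eq: "kernel_part = kernel_sub n M D \<epsilon>"
  by (intro ext) (simp add: kernel_part_def kernel_sub_def)

lemma multiples_lin_forms:
  assumes v: "v \<in> free_part n D e" and pos: "\<And>j. Poly_Mapping.lookup (v j) 0 = 0"
  shows "v \<in> multiples (lin_forms n c) {..n} (free_part n D) e"
  using positive_multiples_var[OF v pos] lin_forms_regular(2)[of n D e c] by blast

lemma high_degree_positive:
  assumes v: "v \<in> free_part n D e" and D: "\<forall>x\<in>set D. x < e"
  shows "Poly_Mapping.lookup (v j) 0 = 0"
proof (cases "j < length D")
  case True
  then have "e - D ! j \<noteq> 0" using D by auto
  then show ?thesis by (rule hom_part_lookup_0[OF free_part_hom[OF v True]])
qed (use free_part_zero[OF v] in simp)

definition unit_vec :: "nat \<Rightarrow> ('k::field) vec" where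
  "unit_vec j = (\<lambda>i. if i = j then 1 else 0)"

lemma unit_vec_part: "j < length D \<Longrightarrow> unit_vec j \<in> free_part n D (D ! j)"
  by (auto simp: unit_vec_def free_part_def)

lemma lookup_unit_vec: "Poly_Mapping.lookup (unit_vec j j :: ('k::field) mpol) 0 = 1"
  by (simp add: unit_vec_def)

locale sliced_resolution = graded_module n M
  for n :: nat and M :: "(('k::field) mpol, 'b) graded_module" (structure) +
  fixes D :: "nat \<Rightarrow> int list" and \<epsilon> :: "'k vec \<Rightarrow> 'b" and \<delta> :: "nat \<Rightarrow> 'k vec \<Rightarrow> 'k vec" and c :: "nat \<Rightarrow> 'k"
  assumes res: "free_resolution n M D \<epsilon> \<delta>"
begin

lemma fm0: "free_map n M (D 0) \<epsilon>"
  using res by (intro free_map.intro graded_module_axioms free_map_axioms.intro) (simp add: free_resolution_def)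

lemma fm: "free_map n (free n (D p)) (D (Suc p)) (\<delta> p)"
  using res by (intro free_map_free) (simp add: free_resolution_def)

lemma image_0: "\<delta> 0 ` carrier (free n (D (Suc 0))) = {v \<in> carrier (free n (D 0)). \<epsilon> v = \<zero>\<^bsub>M\<^esub>}"
  using res by (simp add: free_resolution_def)

lemma image_Suc: "\<delta> (Suc p) ` carrier (free n (D (Suc (Suc p)))) = {v \<in> carrier (free n (D (Suc p))). \<delta> p v = 0}"
  using res by (simp add: free_resolution_def)

sublocale L: graded_resolution n "Suc n" "\<lambda>p. free_part n (D p)" \<delta> "lin_forms n c"
proof
  show "graded_sub n (free_part n (D p))" for p by (rule graded_sub_free_part)
  show "lin_form n l (c l) \<in> hom_part n 1" for l by (rule hom_part_lin_form)
  show "\<delta> p v \<in> free_part n (D p) e" if "v \<in> free_part n (D (Suc p)) e" for p v e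
    using free_map.graded[OF fm that] by simp
  show "\<delta> p (v + w) = \<delta> p v + \<delta> p w" if "v \<in> free_part n (D (Suc p)) e" "w \<in> free_part n (D (Suc p)) e" for p v w e
    using free_map.add[OF fm free_part_carrier[OF that(1)] free_part_carrier[OF that(2)]] by simp
  show "\<delta> p (q \<bullet> v) = q \<bullet> \<delta> p v" if "q \<in> hom_part n a" "v \<in> free_part n (D (Suc p)) e" for q a p v e
    using free_map.scale[OF fm hom_part_carrier[OF that(1)] free_part_carrier[OF that(2)]] by simp
  show "\<delta> p (\<delta> (Suc p) v) = 0" if "v \<in> free_part n (D (Suc (Suc p))) e" for p v e
  proof -
    have "\<delta> (Suc p) v \<in> \<delta> (Suc p) ` carrier (free n (D (Suc (Suc p))))" using free_part_carrier[OF that] by (rule imageI)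
    then show ?thesis unfolding image_Suc by simp
  qed
  show "\<exists>w\<in>free_part n (D (Suc (Suc p))) e. \<delta> (Suc p) w = v" if v: "v \<in> free_part n (D (Suc p)) e" "\<delta> p v = 0" for p v e
  proof -
    have "v \<in> \<delta> (Suc p) ` carrier (free n (D (Suc (Suc p))))" unfolding image_Suc using v free_part_carrier[OF v(1)] by simp
    then show ?thesis using v(1) by (intro free_map.lift_graded[OF fm]) simp_all
  qed
  show "v \<in> multiples (lin_forms n c) {..<i} (free_part n (D p)) e"
    if "i < Suc n" "v \<in> free_part n (D p) e"
      "lin_form n i (c i) \<bullet> v \<in> multiples (lin_forms n c) {..<i} (free_part n (D p)) (e + 1)" for i v p e
  proof -
    have "{..<i} \<subseteq> {..n}" using that(1) by auto
    then show ?thesis using that regular_familyD[OF lin_forms_regular(1)[of n c "D p"], of "{..<i}" i v e] by simp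
  qed
qed

lemma B_slice: "L.B 0 i = slice n (lin_forms n c) (D 0) (kernel_sub n M (D 0) \<epsilon>) i"
proof (rule ext)
  fix e
  have im: "u \<in> kernel_sub n M (D 0) \<epsilon> e \<longleftrightarrow> (\<exists>g\<in>free_part n (D (Suc 0)) e. \<delta> 0 g = u)" for u
  proof
    assume u: "u \<in> kernel_sub n M (D 0) \<epsilon> e"
    then have "u \<in> \<delta> 0 ` carrier (free n (D (Suc 0)))" unfolding image_0 using free_part_carrier by (auto simp: kernel_sub_def)
    then show "\<exists>g\<in>free_part n (D (Suc 0)) e. \<delta> 0 g = u"
      using u by (intro free_map.lift_graded[OF fm]) (simp_all add: kernel_sub_def)
  next
    assume "\<exists>g\<in>free_part n (D (Suc 0)) e. \<delta> 0 g = u"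
    then obtain g where g: "g \<in> free_part n (D (Suc 0)) e" "\<delta> 0 g = u" by (elim bexE)
    have "u \<in> \<delta> 0 ` carrier (free n (D (Suc 0)))" using g(2) free_part_carrier[OF g(1)] by (rule image_eqI[OF sym])
    then have "\<epsilon> u = \<zero>\<^bsub>M\<^esub>" unfolding image_0 by simp
    then show "u \<in> kernel_sub n M (D 0) \<epsilon> e" using L.d_in[OF g(1)] g(2) by (simp add: kernel_sub_def)
  qed
  show "L.B 0 i e = slice n (lin_forms n c) (D 0) (kernel_sub n M (D 0) \<epsilon>) i e"
    unfolding L.B_def slice_def im by (intro Collect_cong) blast
qed

lemma torsion_bound_of_degrees:
  assumes deg: "\<And>p. \<forall>x\<in>set (D p). x \<le> r + int p"
    and almost: "almost_regular n (lin_forms n c) (D 0) (kernel_sub n M (D 0) \<epsilon>)"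
  shows "torsion_bound n (lin_forms n c) (D 0) (kernel_sub n M (D 0) \<epsilon>) r"
  unfolding torsion_bound_def B_slice[symmetric]
proof (intro allI impI)
  fix i e and v :: "'k vec" assume i: "i \<le> Suc n" and e: "r < e" and v: "v \<in> free_part n (D 0) e" "v \<in> torsion (lin_forms n c) (Suc n) (L.B 0 i) e"
  show "v \<in> L.B 0 i e"
  proof (rule L.torsion_vanishing[OF _ _ i _ _ v(2)])
    show "free_part n (D p) e \<subseteq> L.J p (Suc n) e" if "r + int p < e" for p e
    proof
      fix w :: "'k vec" assume w: "w \<in> free_part n (D p) e"
      have "\<forall>x\<in>set (D p). x < e" using deg[of p] that by auto
      from multiples_lin_forms[OF w high_degree_positive[OF w this]] show "w \<in> L.J p (Suc n) e"
        by (simp add: lessThan_Suc_atMost)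
    qed
    show "w \<in> torsion (lin_forms n c) (Suc n) (L.B 0 i) e"
      if "i < Suc n" "w \<in> free_part n (D 0) e" "lin_form n i (c i) \<bullet> w \<in> L.B 0 i (e + 1)" for i w e
      using almost that unfolding almost_regular_def B_slice[symmetric] by simp
    show "r + int 0 < e" using e by simp
    show "v \<in> L.Z 0 i e" using v(1) by (simp add: L.Z_def)
  qed
qed

context
  assumes minimal: "minimal_differential n D \<delta>"
begin

lemma unit_cycle: "j < length (D (Suc p)) \<Longrightarrow> unit_vec j \<in> L.Z (Suc p) (Suc n) (D (Suc p) ! j)"
proof -
  assume "j < length (D (Suc p))"
  then have u: "(unit_vec j :: 'k vec) \<in> free_part n (D (Suc p)) (D (Suc p) ! j)" by (rule unit_vec_part)
  have "Poly_Mapping.lookup (\<delta> p (unit_vec j) i) 0 = 0" for i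
    using minimal free_part_carrier[OF u] by (simp add: minimal_differential_def)
  from multiples_lin_forms[OF L.d_in[OF u] this] show ?thesis
    using u by (simp add: L.Z_def lessThan_Suc_atMost)
qed

lemma unit_not_boundary: "unit_vec j \<notin> L.B p (Suc n) e"
proof
  assume "unit_vec j \<in> L.B p (Suc n) e"
  then obtain g h where g: "g \<in> free_part n (D (Suc p)) e" "h \<in> L.J p (Suc n) e" "unit_vec j = \<delta> p g + h"
    unfolding L.B_def by blast
  have "Poly_Mapping.lookup (\<delta> p g j) 0 = 0"
    using minimal free_part_carrier[OF g(1)] by (simp add: minimal_differential_def)
  moreover have "Poly_Mapping.lookup (h j) 0 = 0" by (rule multiples_positive[OF g(2) hom_part_lin_form])
  ultimately have "Poly_Mapping.lookup ((\<delta> p g + h) j) 0 = 0" by (simp add: plus_fun_apply lookup_add)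
  then show False unfolding g(3)[symmetric] lookup_unit_vec by simp
qed

lemma degrees_of_torsion_bound:
  assumes D0: "\<forall>x\<in>set (D 0). x \<le> r"
    and almost: "almost_regular n (lin_forms n c) (D 0) (kernel_sub n M (D 0) \<epsilon>)"
    and bound: "torsion_bound n (lin_forms n c) (D 0) (kernel_sub n M (D 0) \<epsilon>) r"
  shows "\<forall>x\<in>set (D p). x \<le> r + int p"
proof (cases p)
  case 0
  then show ?thesis using D0 by simp
next
  case (Suc p')
  show ?thesis
  proof (rule ballI, rule ccontr)
    fix x assume "x \<in> set (D p)" and x: "\<not> x \<le> r + int p"
    then obtain j where j: "j < length (D (Suc p'))" "x = D (Suc p') ! j" unfolding Suc by (auto simp: in_set_conv_nth)
    have "L.Z (Suc p') (Suc n) x \<subseteq> L.B (Suc p') (Suc n) x"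
    proof (rule L.homology_degree_bound[OF _ order_refl])
      show "r + int (Suc p') < x" using x Suc by simp
      show "v \<in> L.B 0 i e" if "i < Suc n" "v \<in> free_part n (D 0) e" "r < e" "lin_form n i (c i) \<bullet> v \<in> L.B 0 i (e + 1)" for i v e
      proof -
        have "v \<in> torsion (lin_forms n c) (Suc n) (L.B 0 i) e"
          using almost that unfolding almost_regular_def B_slice[symmetric] by simp
        then show ?thesis using bound that unfolding torsion_bound_def B_slice[symmetric] by simp
      qed
    qed
    then show False using unit_cycle[OF j(1)] unit_not_boundary[of j "Suc p'" x] j(2) by blast
  qed
qed

lemma resolution_length: "Suc n < p \<Longrightarrow> D p = []"
proof (rule ccontr)
  assume p: "Suc n < p" and ne: "D p \<noteq> []"
  obtain p' where p': "p = Suc p'" using p by (cases p) auto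
  have "0 < length (D (Suc p'))" using ne p' by simp
  from unit_cycle[OF this] L.homology_zero_above[OF order_refl p] unit_not_boundary[of 0 "Suc p'"]
  show False unfolding p' by blast
qed

end

end

section \<open>Comparing covers\<close>

text \<open>Both covers present the same module, so the section can be computed in either: the multiples of the forms are lifted term by term.\<close>

lemma slice_transfer:
  assumes e1: "free_map n M D \<epsilon>" "\<epsilon> ` carrier (free n D) = carrier M"
    and e2: "free_map n M D' \<epsilon>'" "\<epsilon>' ` carrier (free n D') = carrier M"
    and y: "\<And>l. y l \<in> hom_part n 1"
    and w: "w \<in> free_part n D e" "w' \<in> free_part n D' e" "\<epsilon> w = \<epsilon>' w'"
    and mem: "w \<in> slice n y D (kernel_sub n M D \<epsilon>) i e"
  shows "w' \<in> slice n y D' (kernel_sub n M D' \<epsilon>') i e"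
proof -
  interpret A: free_map n M D \<epsilon> by fact
  interpret B: free_map n M D' \<epsilon>' by fact
  obtain u h where uh: "u \<in> kernel_sub n M D \<epsilon> e" "h \<in> multiples y {..<i} (free_part n D) e" "w = u + h"
    using mem by (rule sliceE)
  obtain g where g: "\<forall>l\<in>{..<i}. g l \<in> free_part n D (e - 1)" "h = (\<Sum>l\<in>{..<i}. y l \<bullet> g l)"
    using uh(2) unfolding multiples_def by blast
  have "\<forall>l\<in>{..<i}. \<exists>g'. g' \<in> free_part n D' (e - 1) \<and> \<epsilon>' g' = \<epsilon> (g l)"
  proof
    fix l assume "l \<in> {..<i}"
    then have gl: "g l \<in> free_part n D (e - 1)" using g(1) by blast
    have "\<epsilon> (g l) \<in> \<epsilon>' ` carrier (free n D')" unfolding e2(2) using A.closed[OF free_part_carrier[OF gl]] .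
    from B.lift_graded[OF this A.graded[OF gl]] show "\<exists>g'. g' \<in> free_part n D' (e - 1) \<and> \<epsilon>' g' = \<epsilon> (g l)"
      by (elim bexE) (intro exI conjI)
  qed
  from bchoice[OF this] obtain g' where g': "\<forall>l\<in>{..<i}. g' l \<in> free_part n D' (e - 1) \<and> \<epsilon>' (g' l) = \<epsilon> (g l)" by (elim exE)
  define h' where "h' = (\<Sum>l\<in>{..<i}. y l \<bullet> g' l)"
  have h'm: "h' \<in> multiples y {..<i} (free_part n D') e" unfolding multiples_def h'_def using g' by blast
  have h'p: "h' \<in> free_part n D' e"
    using multiples_subset[OF graded_sub_free_part, of "{..<i}" y n D' e] y h'm by blast
  have hp: "h \<in> free_part n D e"
    using multiples_subset[OF graded_sub_free_part, of "{..<i}" y n D e] y uh(2) by blast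
  have gc: "g l \<in> carrier (free n D)" "g' l \<in> carrier (free n D')" if "l \<in> {..<i}" for l
    using free_part_carrier[of "g l" n D "e - 1"] free_part_carrier[of "g' l" n D' "e - 1"] g(1) g' that by auto
  have yc: "y l \<in> carrier (poly_ring n)" for l by (rule hom_part_carrier[OF y])
  have "\<epsilon>' h' = (\<Oplus>\<^bsub>M\<^esub>l\<in>{..<i}. \<epsilon>' (y l \<bullet> g' l))"
    unfolding h'_def using gc yc by (intro B.sum free_carrier_scale) auto
  also have "\<dots> = (\<Oplus>\<^bsub>M\<^esub>l\<in>{..<i}. \<epsilon> (y l \<bullet> g l))"
  proof (rule A.M.finsum_cong')
    fix l assume l: "l \<in> {..<i}"
    note c = gc[OF l]
    show "\<epsilon>' (y l \<bullet> g' l) = \<epsilon> (y l \<bullet> g l)" using A.scale[OF yc c(1)] B.scale[OF yc c(2)] g' l by simp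
  next
    show "(\<lambda>l. \<epsilon> (y l \<bullet> g l)) \<in> {..<i} \<rightarrow> carrier M"
    proof
      fix l assume "l \<in> {..<i}"
      then have "g l \<in> carrier (free n D)" by (rule gc(1))
      then show "\<epsilon> (y l \<bullet> g l) \<in> carrier M" by (intro A.closed free_carrier_scale yc)
    qed
  qed simp
  also have "\<dots> = \<epsilon> h"
    unfolding g(2) using gc yc by (intro A.sum[symmetric] free_carrier_scale) auto
  finally have eh: "\<epsilon>' h' = \<epsilon> h" .
  have "u \<in> free_part n D e" "\<epsilon> u = \<zero>\<^bsub>M\<^esub>" using uh(1) by (auto simp: kernel_sub_def)
  then have "\<epsilon> w = \<epsilon> h"
    unfolding uh(3) using A.add[OF free_part_carrier free_part_carrier, of u e h e] hp A.closed[OF free_part_carrier[OF hp]] by simp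
  then have "\<epsilon>' (w' - h') = \<zero>\<^bsub>M\<^esub>"
    using eh w(3) by (intro B.diff_zero free_part_carrier[OF w(2)] free_part_carrier[OF h'p]) simp
  then have "w' - h' \<in> kernel_sub n M D' \<epsilon>' e"
    using gs_diff[OF graded_sub_free_part w(2) h'p] by (simp add: kernel_sub_def)
  then show ?thesis by (rule sliceI[OF _ h'm]) (simp only: diff_add_cancel)
qed

text \<open>The torsion bound depends only on the module and not on the chosen cover. It carries the bound from a resolution of an approximating module to the cover that factors through \<open>M\<close>.\<close>

lemma torsion_bound_transfer:
  assumes e1: "free_map n M D \<epsilon>" "\<epsilon> ` carrier (free n D) = carrier M"
    and e2: "free_map n M D' \<epsilon>'" "\<epsilon>' ` carrier (free n D') = carrier M"
    and y: "\<And>l. y l \<in> hom_part n 1"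
    and bound: "torsion_bound n y D (kernel_sub n M D \<epsilon>) c"
  shows "torsion_bound n y D' (kernel_sub n M D' \<epsilon>') c"
  unfolding torsion_bound_def
proof (intro allI impI)
  interpret A: free_map n M D \<epsilon> by fact
  interpret B: free_map n M D' \<epsilon>' by fact
  fix i e v' assume i: "i \<le> Suc n" and e: "c < e" and v': "v' \<in> free_part n D' e"
    and t: "v' \<in> torsion y (Suc n) (slice n y D' (kernel_sub n M D' \<epsilon>') i) e"
  have "\<epsilon>' v' \<in> \<epsilon> ` carrier (free n D)" unfolding e1(2) by (rule B.closed[OF free_part_carrier[OF v']])
  from A.lift_graded[OF this B.graded[OF v']] obtain v where v: "v \<in> free_part n D e" "\<epsilon> v = \<epsilon>' v'" by (elim bexE)
  have "v \<in> torsion y (Suc n) (slice n y D (kernel_sub n M D \<epsilon>) i) e"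
  proof (rule torsionI)
    fix l assume "l < Suc n"
    from torsionD[OF t this] obtain k where k: "y l ^ k \<bullet> v' \<in> slice n y D' (kernel_sub n M D' \<epsilon>') i (e + int k)" by (elim exE)
    have yk: "y l ^ k \<in> carrier (poly_ring n)" by (rule hom_part_carrier[OF hom_part_power1[OF y]])
    have "y l ^ k \<bullet> v \<in> slice n y D (kernel_sub n M D \<epsilon>) i (e + int k)"
    proof (rule slice_transfer[OF e2 e1 y _ _ _ k])
      show "y l ^ k \<bullet> v' \<in> free_part n D' (e + int k)" by (rule gs_power[OF graded_sub_free_part y v']) simp
      show "y l ^ k \<bullet> v \<in> free_part n D (e + int k)" by (rule gs_power[OF graded_sub_free_part y v(1)]) simp
      show "\<epsilon>' (y l ^ k \<bullet> v') = \<epsilon> (y l ^ k \<bullet> v)"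
        using A.scale[OF yk free_part_carrier[OF v(1)]] B.scale[OF yk free_part_carrier[OF v']] v(2) by simp
    qed
    then show "\<exists>k. y l ^ k \<bullet> v \<in> slice n y D (kernel_sub n M D \<epsilon>) i (e + int k)" by (rule exI)
  qed
  then have "v \<in> slice n y D (kernel_sub n M D \<epsilon>) i e" using bound i e v(1) by (simp add: torsion_bound_def)
  then show "v' \<in> slice n y D' (kernel_sub n M D' \<epsilon>') i e" by (rule slice_transfer[OF e1 e2 y v(1) v' v(2)])
qed

lemma vcomp_multiples:
  assumes h: "h \<in> multiples y T (free_part n D) e" and q: "q \<in> carrier (poly_ring n)" and y: "\<And>l. y l \<in> hom_part n 1"
  shows "vcomp D a (q \<bullet> h) \<in> multiples y T (free_part n D) a"
proof -
  obtain g where g: "\<forall>l\<in>T. g l \<in> free_part n D (e - 1)" "h = (\<Sum>l\<in>T. y l \<bullet> g l)"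
    using h unfolding multiples_def by blast
  have "q \<bullet> h = (\<Sum>l\<in>T. y l \<bullet> q \<bullet> g l)" unfolding g(2) by (simp add: vec.scale_sum_right mult.commute)
  then have "vcomp D a (q \<bullet> h) = (\<Sum>l\<in>T. y l \<bullet> vcomp D (a - 1) (q \<bullet> g l))"
    by (simp only: vcomp_sum vcomp_scale[OF y])
  moreover have "vcomp D (a - 1) (q \<bullet> g l) \<in> free_part n D (a - 1)" if "l \<in> T" for l
    using free_part_carrier[of "g l" n D "e - 1"] g(1) that q by (intro vcomp_mem free_carrier_scale) auto
  ultimately show ?thesis unfolding multiples_def by (intro CollectI exI[of _ "\<lambda>l. vcomp D (a - 1) (q \<bullet> g l)"]) auto
qed

text \<open>The coefficients \<open>q\<^sub>a\<close> need not be homogeneous; only their sum is, so the argument passes to the component of degree \<open>e + b\<close>.\<close>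

lemma (in free_map) annihilated_slice:
  assumes A: "finite A" and q: "\<And>a. a \<in> A \<Longrightarrow> q a \<in> carrier (poly_ring n)" "(\<Sum>a\<in>A. q a) \<in> hom_part n b"
    and y: "\<And>l. y l \<in> hom_part n 1" and v: "v \<in> free_part n D e"
    and kill: "\<And>a. a \<in> A \<Longrightarrow> \<exists>u\<in>free_part n D e. \<exists>h\<in>multiples y {..<i} (free_part n D) e. v = u + h \<and> \<epsilon> (q a \<bullet> u) = \<zero>\<^bsub>M\<^esub>"
  shows "(\<Sum>a\<in>A. q a) \<bullet> v \<in> slice n y D (kernel_sub n M D \<epsilon>) i (e + b)"
proof -
  have U: "graded_sub n (kernel_sub n M D \<epsilon>)" using graded_sub_kernel by (simp add: kernel_part_eq)
  have m: "(\<Sum>a\<in>A. q a) \<bullet> v \<in> free_part n D (e + b)" by (rule gs_scale[OF graded_sub_free_part q(2) v]) simp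
  have "(\<Sum>a\<in>A. q a) \<bullet> v = vcomp D (e + b) ((\<Sum>a\<in>A. q a) \<bullet> v)" using vcomp_free_part[OF m, of "e + b"] by simp
  also have "\<dots> = (\<Sum>a\<in>A. vcomp D (e + b) (q a \<bullet> v))" by (simp only: vec.scale_sum_left vcomp_sum)
  also have "\<dots> \<in> slice n y D (kernel_sub n M D \<epsilon>) i (e + b)"
  proof (rule gs_sum[OF graded_sub_slice[OF U]])
    fix a assume a: "a \<in> A"
    from kill[OF a] obtain u h where u: "u \<in> free_part n D e" and h: "h \<in> multiples y {..<i} (free_part n D) e"
      and vuh: "v = u + h" and z: "\<epsilon> (q a \<bullet> u) = \<zero>\<^bsub>M\<^esub>" by (elim bexE conjE)
    have "vcomp D (e + b) (q a \<bullet> u) \<in> kernel_sub n M D \<epsilon> (e + b)"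
      using kernel_component[OF free_carrier_scale[OF q(1)[OF a] free_part_carrier[OF u]] z] by (simp add: kernel_part_eq)
    then show "vcomp D (e + b) (q a \<bullet> v) \<in> slice n y D (kernel_sub n M D \<epsilon>) i (e + b)"
      by (rule sliceI[OF _ vcomp_multiples[OF h q(1)[OF a] y, of "e + b"]]) (simp only: vuh vec.scale_right_distrib vcomp_add)
  qed
  finally show ?thesis .
qed

section \<open>Regularity and resolutions\<close>

lemma free_submodule_sum:
  assumes N: "submodule N (poly_ring n) (free n D)" and "finite A" and f: "\<And>i. i \<in> A \<Longrightarrow> f i \<in> N"
  shows "sum f A \<in> N"
proof -
  interpret F: graded_module n "free n D" by (rule graded_module_free)
  from assms(2) f show ?thesis
  proof (induction A rule: finite_induct)
    case empty
    then show ?case using F.submodule_zero[OF N] by simp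
  next
    case (insert a A)
    then show ?case using F.submoduleE(5)[OF N, of "f a" "sum f A"] by simp
  qed
qed

lemma unit_vec_expansion:
  assumes v: "v \<in> carrier (free n D)" shows "v = (\<Sum>j<length D. v j \<bullet> unit_vec j)"
proof
  fix i
  have "(\<Sum>j\<in>A. v j \<bullet> unit_vec j) i = (\<Sum>j\<in>A. if i = j then v j else 0)" if "finite A" for A
    using that by (induction A rule: finite_induct) (auto simp: vscale_def unit_vec_def plus_fun_apply zero_fun_apply)
  then show "v i = (\<Sum>j<length D. v j \<bullet> unit_vec j) i" using v by (simp add: carrier_free_iff)
qed

lemma generated_free_iff:
  "generated_in_degrees_le n (free n D :: (('k::field) mpol, 'k vec) graded_module) c \<longleftrightarrow> (\<forall>x\<in>set D. x \<le> c)"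
  (is "generated_in_degrees_le n ?F c \<longleftrightarrow> _")
proof
  interpret F: graded_module n ?F by (rule graded_module_free)
  assume gen: "generated_in_degrees_le n ?F c"
  define N where "N = {v \<in> carrier ?F. \<forall>j<length D. c < D ! j \<longrightarrow> v j = 0}"
  have N: "submodule N (poly_ring n) ?F"
  proof (rule F.submoduleI)
    show "N \<subseteq> carrier ?F" by (auto simp: N_def)
    show "\<zero>\<^bsub>?F\<^esub> \<in> N" by (simp add: N_def zero_fun_apply)
    show "\<ominus>\<^bsub>?F\<^esub> a \<in> N" if "a \<in> N" for a using that free_carrier_uminus[of a n D] by (simp add: N_def free_a_inv)
    show "a \<oplus>\<^bsub>?F\<^esub> b \<in> N" if "a \<in> N" "b \<in> N" for a b
      using that free_carrier_add[of a n D b] by (simp add: N_def plus_fun_apply)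
    show "p \<odot>\<^bsub>?F\<^esub> a \<in> N" if "p \<in> carrier (poly_ring n)" "a \<in> N" for p a
      using that free_carrier_scale[of p n a D] by (simp add: N_def vscale_def)
  qed
  have "(\<Union>e\<in>{..c}. graded_part ?F e) \<subseteq> N"
  proof
    fix v assume "v \<in> (\<Union>e\<in>{..c}. graded_part ?F e)"
    then obtain e where e: "e \<le> c" "v \<in> free_part n D e" by auto
    have "v j = 0" if j: "j < length D" "c < D ! j" for j
    proof -
      have "e - D ! j < 0" using e j by simp
      from free_part_hom[OF e(2) j(1), unfolded hom_part_neg[OF this]] show ?thesis by simp
    qed
    then show "v \<in> N" using free_part_carrier[OF e(2)] by (simp add: N_def)
  qed
  from F.generated_least[OF N this] have carr: "carrier ?F \<subseteq> N" using gen by (simp add: generated_in_degrees_le_def)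
  show "\<forall>x\<in>set D. x \<le> c"
  proof (rule ballI, rule ccontr)
    fix x assume "x \<in> set D" "\<not> x \<le> c"
    then obtain j where j: "j < length D" "c < D ! j" by (auto simp: in_set_conv_nth)
    have "(unit_vec j :: 'k vec) \<in> N" using carr free_part_carrier[OF unit_vec_part[OF j(1)]] by blast
    then have "(unit_vec j j :: 'k mpol) = 0" using j by (simp add: N_def)
    then show False by (simp add: unit_vec_def)
  qed
next
  interpret F: graded_module n ?F by (rule graded_module_free)
  assume D: "\<forall>x\<in>set D. x \<le> c"
  define G where "G = submodule_generated n ?F (\<Union>e\<in>{..c}. graded_part ?F e)"
  have G: "submodule G (poly_ring n) ?F"
    unfolding G_def using F.part_carrier by (intro F.generated_submodule UN_least subsetI)
  have "v \<in> G" if v: "v \<in> carrier ?F" for v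
  proof -
    have "v j \<bullet> unit_vec j \<in> G" if "j < length D" for j
    proof -
      have u: "(unit_vec j :: 'k vec) \<in> graded_part ?F (D ! j)" using unit_vec_part[OF that] by simp
      have "D ! j \<in> {..c}" using D that by simp
      then have "(unit_vec j :: 'k vec) \<in> (\<Union>e\<in>{..c}. graded_part ?F e)" using u by (rule UN_I)
      then have "unit_vec j \<in> G" unfolding G_def by (rule subsetD[OF F.generated_superset])
      then show ?thesis using F.submoduleE(4)[OF G, of "v j" "unit_vec j"] v that by (simp add: carrier_free_iff)
    qed
    then have "(\<Sum>j<length D. v j \<bullet> unit_vec j) \<in> G" by (intro free_submodule_sum[OF G]) auto
    then show ?thesis using unit_vec_expansion[OF v] by simp
  qed
  then show "generated_in_degrees_le n ?F c"
    unfolding generated_in_degrees_le_def G_def[symmetric] using F.submoduleE(1)[OF G] by (intro equalityI subsetI) auto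
qed

lemma zero_graded_hom: "(\<lambda>_. 0) \<in> graded_hom n (free n D) (free n D')"
  unfolding graded_hom_def hom_def using gs_0[OF graded_sub_free_part] by (auto simp: image_subset_iff)

lemma carrier_free_Nil: "carrier (free n []) = {0 :: ('k::field) vec}"
  by (auto simp: carrier_free_iff zero_fun_apply)

text \<open>A finite resolution is continued by zero modules, so that later arguments need no case distinction at its end.\<close>

lemma regular_resolution:
  fixes M :: "(('k::field) mpol, 'b) graded_module"
  assumes "regular n M r"
  shows "\<exists>D \<epsilon> \<delta>. free_resolution n M D \<epsilon> \<delta> \<and> (\<forall>p. \<forall>x\<in>set (D p). x \<le> r + int p)"
proof -
  from assms obtain l and D :: "nat \<Rightarrow> int list" and \<epsilon> :: "'k vec \<Rightarrow> 'b" and \<delta> :: "nat \<Rightarrow> 'k vec \<Rightarrow> 'k vec"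
    where res: "minimal_graded_free_resolution n M l D \<epsilon> \<delta>"
      and gen: "\<forall>i\<le>l. generated_in_degrees_le n (free n (D i) :: ('k mpol, 'k vec) graded_module) (r + int i)"
    unfolding regular_def by (elim exE conjE)
  define D' where "D' p = (if p \<le> l then D p else [])" for p
  define \<delta>' where "\<delta>' p = (if p < l then \<delta> p else (\<lambda>_. 0))" for p
  define kr where "kr p = (if p = 0 then {v \<in> carrier (free n (D 0)). \<epsilon> v = \<zero>\<^bsub>M\<^esub>}
      else {v \<in> carrier (free n (D p)). \<delta> (p - 1) v = 0})" for p
  have e: "\<epsilon> \<in> graded_hom n (free n (D 0)) M" "\<epsilon> ` carrier (free n (D 0)) = carrier M"
    using res by (auto simp: minimal_graded_free_resolution_def Let_def)
  have hom: "\<delta> i \<in> graded_hom n (free n (D (Suc i))) (free n (D i))" if "i < l" for i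
    using res that by (simp add: minimal_graded_free_resolution_def Let_def)
  have im: "\<delta> i ` carrier (free n (D (Suc i))) = kr i" if "i < l" for i
    using res that by (simp add: minimal_graded_free_resolution_def Let_def kr_def a_kernel_def')
  have krl: "kr l = {0}"
    using res by (simp add: minimal_graded_free_resolution_def Let_def kr_def a_kernel_def' split: if_splits)
  have "free_resolution n M D' \<epsilon> \<delta>'"
    unfolding free_resolution_def
  proof (intro conjI allI)
    show "\<epsilon> \<in> graded_hom n (free n (D' 0)) M" "\<epsilon> ` carrier (free n (D' 0)) = carrier M" using e by (simp_all add: D'_def)
    show "\<delta>' p \<in> graded_hom n (free n (D' (Suc p))) (free n (D' p))" for p
    proof (cases "p < l")
      case True
      then show ?thesis using hom[of p] by (simp add: D'_def \<delta>'_def)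
    next
      case False
      then have "\<delta>' p = (\<lambda>_. 0)" by (simp add: \<delta>'_def)
      then show ?thesis by (simp only: zero_graded_hom)
    qed
    show "\<delta>' 0 ` carrier (free n (D' (Suc 0))) = {v \<in> carrier (free n (D' 0)). \<epsilon> v = \<zero>\<^bsub>M\<^esub>}"
    proof (cases "0 < l")
      case True
      then show ?thesis using im[of 0] by (simp add: D'_def \<delta>'_def kr_def)
    next
      case False
      then show ?thesis using krl by (simp add: D'_def \<delta>'_def kr_def carrier_free_Nil)
    qed
    show "\<delta>' (Suc p) ` carrier (free n (D' (Suc (Suc p)))) = {v \<in> carrier (free n (D' (Suc p))). \<delta>' p v = 0}" for p
    proof -
      consider "Suc p < l" | "Suc p = l" | "l < Suc p" by linarith
      then show ?thesis
      proof cases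
        case 1
        then show ?thesis using im[of "Suc p"] by (simp add: D'_def \<delta>'_def kr_def)
      next
        case 2
        then have "D' (Suc (Suc p)) = []" "D' (Suc p) = D l" "\<delta>' (Suc p) = (\<lambda>_. 0)" "\<delta>' p = \<delta> p"
          by (simp_all add: D'_def \<delta>'_def)
        moreover have "{v \<in> carrier (free n (D l)). \<delta> p v = 0} = {0}" using krl unfolding kr_def 2[symmetric] by simp
        ultimately show ?thesis by (simp only: carrier_free_Nil image_insert image_empty)
      next
        case 3
        then have "D' (Suc (Suc p)) = []" "D' (Suc p) = []" "\<delta>' (Suc p) = (\<lambda>_. 0)" "\<delta>' p = (\<lambda>_. 0)"
          by (simp_all add: D'_def \<delta>'_def)
        then show ?thesis by (simp only: carrier_free_Nil image_insert image_empty) blast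
      qed
    qed
  qed
  moreover have "\<forall>x\<in>set (D' p). x \<le> r + int p" for p
    using gen by (simp add: D'_def generated_free_iff)
  ultimately show ?thesis by (intro exI conjI allI)
qed

lemma irrelevant_ideal_ideal: "ideal (irrelevant_ideal n :: ('k::field) mpol set) (poly_ring n)"
  and var_irrelevant: "l \<le> n \<Longrightarrow> var l \<in> (irrelevant_ideal n :: ('k::field) mpol set)"
proof -
  interpret R: cring "poly_ring n :: 'k mpol ring" by (rule cring_poly_ring)
  have sub: "var ` {0..n} \<subseteq> carrier (poly_ring n :: 'k mpol ring)"
  proof
    fix x :: "'k mpol" assume "x \<in> var ` {0..n}"
    then obtain l where "l \<le> n" "x = var l" by auto
    then show "x \<in> carrier (poly_ring n)" using hom_part_carrier[OF hom_part_var] by simp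
  qed
  show "ideal (irrelevant_ideal n :: 'k mpol set) (poly_ring n)"
    unfolding irrelevant_ideal_def by (rule R.genideal_ideal[OF sub])
  show "var l \<in> (irrelevant_ideal n :: 'k mpol set)" if "l \<le> n"
    unfolding irrelevant_ideal_def using R.genideal_self[OF sub] that by auto
qed

lemma positive_ideal_smult:
  fixes w :: "('k::field) vec"
  assumes w: "w \<in> carrier (free n D)" and pos: "\<And>j. Poly_Mapping.lookup (w j) 0 = 0"
  shows "w \<in> ideal_smult n (irrelevant_ideal n) (free n D)"
proof -
  interpret F: graded_module n "free n D :: ('k mpol, 'k vec) graded_module" by (rule graded_module_free)
  define X where "X = {p \<bullet> x | p x. p \<in> (irrelevant_ideal n :: 'k mpol set) \<and> x \<in> carrier (free n D)}"
  have X: "X \<subseteq> carrier (free n D)"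
  proof
    fix x assume "x \<in> X"
    then obtain p v where xv: "x = p \<bullet> v" and p: "p \<in> (irrelevant_ideal n :: 'k mpol set)" and v: "v \<in> carrier (free n D)"
      unfolding X_def by (elim CollectE exE conjE)
    show "x \<in> carrier (free n D)"
      unfolding xv by (rule free_carrier_scale[OF ideal.Icarr[OF irrelevant_ideal_ideal p] v])
  qed
  define G where "G = submodule_generated n (free n D :: ('k mpol, 'k vec) graded_module) X"
  have G: "submodule G (poly_ring n) (free n D)" unfolding G_def by (rule F.generated_submodule[OF X])
  have comp: "vcomp D e w \<in> G" for e
  proof -
    have "Poly_Mapping.lookup (vcomp D e w j) 0 = 0" for j using pos by (simp add: vcomp_def lookup_hcomp)
    from positive_multiples_var[OF vcomp_mem[OF w] this]
    obtain g where g: "\<forall>l\<in>{..n}. g l \<in> free_part n D (e - 1)" "vcomp D e w = (\<Sum>l\<in>{..n}. var l \<bullet> g l)"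
      unfolding multiples_def by blast
    have "var l \<bullet> g l \<in> G" if "l \<in> {..n}" for l
    proof -
      have "var l \<bullet> g l \<in> X" unfolding X_def
        using var_irrelevant[of l n] that g(1) free_part_carrier[of "g l" n D "e - 1"] by (intro CollectI exI conjI) auto
      then show ?thesis unfolding G_def by (rule subsetD[OF F.generated_superset])
    qed
    then show ?thesis unfolding g(2) by (intro free_submodule_sum[OF G]) auto
  qed
  obtain S where S: "finite S" "\<And>B. finite B \<Longrightarrow> S \<subseteq> B \<Longrightarrow> w = (\<Sum>e\<in>B. vcomp D e w)"
    using vcomp_sum_all[OF w] by auto
  have "(\<Sum>e\<in>S. vcomp D e w) \<in> G" using comp by (intro free_submodule_sum[OF G S(1)])
  then have "w \<in> G" using S(2)[OF S(1) subset_refl] by simp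
  then show ?thesis by (simp add: G_def X_def ideal_smult_def)
qed

lemma regularI:
  fixes M :: "(('k::field) mpol, 'b) graded_module"
  assumes M: "graded_module n M" and res: "free_resolution n M D \<epsilon> \<delta>" and minimal: "minimal_differential n D \<delta>"
    and deg: "\<And>p. \<forall>x\<in>set (D p). x \<le> r + int p"
  shows "regular n M r"
proof -
  interpret S: sliced_resolution n M D \<epsilon> \<delta> "\<lambda>_. 0"
    by (intro sliced_resolution.intro sliced_resolution_axioms.intro M res)
  have nil: "D (Suc (Suc n)) = []" by (rule S.resolution_length[OF minimal]) simp
  have small: "\<delta> i ` carrier (free n (D (Suc i))) \<subseteq> ideal_smult n (irrelevant_ideal n) (free n (D i))" for i
  proof
    fix w assume "w \<in> \<delta> i ` carrier (free n (D (Suc i)))"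
    then obtain v where v: "v \<in> carrier (free n (D (Suc i)))" "w = \<delta> i v" by (elim imageE)
    have "w \<in> carrier (free n (D i))" using free_map.closed[OF S.fm v(1)] v(2) by simp
    moreover have "Poly_Mapping.lookup (w j) 0 = 0" for j
      using minimal v by (simp add: minimal_differential_def)
    ultimately show "w \<in> ideal_smult n (irrelevant_ideal n) (free n (D i))" by (rule positive_ideal_smult)
  qed
  have im: "\<delta> i ` carrier (free n (D (Suc i))) =
      (if i = 0 then a_kernel (free n (D 0)) M \<epsilon> else a_kernel (free n (D i)) (free n (D (i - 1))) (\<delta> (i - 1)))" for i
    using S.image_0 S.image_Suc by (cases i) (simp_all add: a_kernel_def')
  have "a_kernel (free n (D (Suc n))) (free n (D n)) (\<delta> n) = {0}"
    using im[of "Suc n"] by (simp add: nil carrier_free_Nil)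
  then have "minimal_graded_free_resolution n M (Suc n) D \<epsilon> \<delta>"
    using res small im unfolding minimal_graded_free_resolution_def Let_def by (simp add: free_resolution_def)
  moreover have "\<forall>i\<le>Suc n. generated_in_degrees_le n (free n (D i) :: ('k mpol, 'k vec) graded_module) (r + int i)"
    using deg by (simp add: generated_free_iff)
  ultimately show ?thesis unfolding regular_def by (intro exI conjI)
qed

lemma regular_exists:
  fixes M :: "(('k::field) mpol, 'b) graded_module"
  assumes fg: "fg_graded_module n M" shows "\<exists>r. regular n M r"
proof -
  have M: "graded_module n M" using fg by (simp add: fg_graded_module_def)
  from minimal_resolution_exists[OF fg] obtain D and \<epsilon> :: "'k vec \<Rightarrow> 'b" and \<delta> :: "nat \<Rightarrow> 'k vec \<Rightarrow> 'k vec"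
    where res: "free_resolution n M D \<epsilon> \<delta>" and minimal: "minimal_differential n D \<delta>" by (elim exE conjE)
  interpret S: sliced_resolution n M D \<epsilon> \<delta> "\<lambda>_. 0"
    by (intro sliced_resolution.intro sliced_resolution_axioms.intro M res)
  define X where "X = insert 0 (\<Union>p\<in>{..Suc n}. set (D p))"
  have "x \<le> Max X + int p" if "x \<in> set (D p)" for x p
  proof -
    have "p \<le> Suc n" using S.resolution_length[OF minimal, of p] that by (cases "p \<le> Suc n") auto
    then have "x \<le> Max X" using that by (intro Max_ge) (auto simp: X_def)
    then show ?thesis by simp
  qed
  then have "regular n M (Max X)" by (intro regularI[OF M res minimal] ballI)
  then show ?thesis by (rule exI)
qed

text \<open>Generators of a cover in degrees where the module is zero would all map to zero. This bound makes the minimum in the definition of \<open>reg\<close> exist.\<close>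

lemma regular_bounded_below:
  fixes M :: "(('k::field) mpol, 'b) graded_module"
  assumes fg: "fg_graded_module n M" and nz: "carrier M \<noteq> {\<zero>\<^bsub>M\<^esub>}"
  shows "\<exists>e0. \<forall>r. regular n M r \<longrightarrow> e0 \<le> r"
proof -
  interpret graded_module n M using fg by (simp add: fg_graded_module_def)
  from minimal_resolution_exists[OF fg] obtain D and \<epsilon> :: "'k vec \<Rightarrow> 'b" and \<delta> :: "nat \<Rightarrow> 'k vec \<Rightarrow> 'k vec"
    where res: "free_resolution n M D \<epsilon> \<delta>" by (elim exE conjE)
  interpret S: sliced_resolution n M D \<epsilon> \<delta> "\<lambda>_. 0"
    by (intro sliced_resolution.intro sliced_resolution_axioms.intro graded_module_axioms res)
  interpret E: free_map n M "D 0" \<epsilon> by (rule S.fm0)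
  have surj: "\<epsilon> ` carrier (free n (D 0)) = carrier M" using res by (simp add: free_resolution_def)
  from free_part_bounded_below[of n "D 0"] obtain e0 where e0: "\<forall>e<e0. free_part n (D 0) e = {0 :: 'k vec}" by (elim exE)
  have low: "x = \<zero>\<^bsub>M\<^esub>" if "x \<in> graded_part M e" "e < e0" for x e
  proof -
    have "x \<in> \<epsilon> ` carrier (free n (D 0))" unfolding surj using that(1) by (rule part_carrier)
    from E.lift_graded[OF this that(1)] obtain v where v: "v \<in> free_part n (D 0) e" "\<epsilon> v = x" by (elim bexE)
    then have "v = 0" using e0 that(2) by simp
    then show ?thesis using v(2) E.zero by simp
  qed
  have "e0 \<le> r" if r: "regular n M r" for r
  proof (rule ccontr)
    assume "\<not> e0 \<le> r"
    from regular_resolution[OF r] obtain D' and \<epsilon>' :: "'k vec \<Rightarrow> 'b" and \<delta>' :: "nat \<Rightarrow> 'k vec \<Rightarrow> 'k vec"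
      where res': "free_resolution n M D' \<epsilon>' \<delta>'" and deg: "\<forall>p. \<forall>x\<in>set (D' p). x \<le> r + int p" by (elim exE conjE)
    interpret S': sliced_resolution n M D' \<epsilon>' \<delta>' "\<lambda>_. 0"
      by (intro sliced_resolution.intro sliced_resolution_axioms.intro graded_module_axioms res')
    interpret E': free_map n M "D' 0" \<epsilon>' by (rule S'.fm0)
    have unit: "\<epsilon>' (unit_vec j) = \<zero>\<^bsub>M\<^esub>" if j: "j < length (D' 0)" for j
    proof (rule low[OF E'.graded[OF unit_vec_part[OF j]]])
      have "D' 0 ! j \<le> r + int 0" using deg j nth_mem by blast
      then show "D' 0 ! j < e0" using \<open>\<not> e0 \<le> r\<close> by simp
    qed
    have "\<epsilon>' v = \<zero>\<^bsub>M\<^esub>" if v: "v \<in> carrier (free n (D' 0))" for v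
    proof -
      have uc: "(unit_vec j :: 'k vec) \<in> carrier (free n (D' 0))" if "j < length (D' 0)" for j
        by (rule free_part_carrier[OF unit_vec_part[OF that]])
      have vc: "v j \<in> carrier (poly_ring n)" if "j < length (D' 0)" for j using v that by (simp add: carrier_free_iff)
      have "\<epsilon>' v = \<epsilon>' (\<Sum>j<length (D' 0). v j \<bullet> unit_vec j)" using unit_vec_expansion[OF v] by simp
      also have "\<dots> = (\<Oplus>\<^bsub>M\<^esub>j\<in>{..<length (D' 0)}. \<epsilon>' (v j \<bullet> unit_vec j))"
        using uc vc by (intro E'.sum free_carrier_scale) auto
      also have "\<dots> = (\<Oplus>\<^bsub>M\<^esub>j\<in>{..<length (D' 0)}. \<zero>\<^bsub>M\<^esub>)"
      proof (rule M.finsum_cong')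
        fix j assume "j \<in> {..<length (D' 0)}"
        then show "\<epsilon>' (v j \<bullet> unit_vec j) = \<zero>\<^bsub>M\<^esub>" using E'.scale[OF vc uc, of j j] unit[of j] vc[of j] by simp
      qed auto
      finally show ?thesis by simp
    qed
    moreover have "\<epsilon>' ` carrier (free n (D' 0)) = carrier M" using res' by (simp add: free_resolution_def)
    ultimately have "carrier M \<subseteq> {\<zero>\<^bsub>M\<^esub>}" by (metis (no_types, lifting) imageE insertI1 subsetI)
    then show False using nz M.zero_closed by blast
  qed
  then show ?thesis by blast
qed

lemma Least_int_bounded:
  fixes P :: "int \<Rightarrow> bool"
  assumes "P r0" and low: "\<And>r. P r \<Longrightarrow> e0 \<le> r"
  shows "P (LEAST r. P r)" and "P r \<Longrightarrow> (LEAST r. P r) \<le> r"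
proof -
  have "P (e0 + int (nat (r0 - e0)))" using assms(1) low[OF assms(1)] by simp
  then have ex: "P (e0 + int (LEAST k. P (e0 + int k)))" by (rule LeastI)
  have min: "e0 + int (LEAST k. P (e0 + int k)) \<le> r" if "P r" for r
  proof -
    have "P (e0 + int (nat (r - e0)))" using that low[OF that] by simp
    then have "(LEAST k. P (e0 + int k)) \<le> nat (r - e0)" by (rule Least_le)
    then show ?thesis using low[OF that] by linarith
  qed
  have "(LEAST r. P r) = e0 + int (LEAST k. P (e0 + int k))" by (rule Least_equality[of P, OF ex min])
  then show "P (LEAST r. P r)" "P r \<Longrightarrow> (LEAST r. P r) \<le> r" using ex min by simp_all
qed

lemma reg_le_resolution:
  fixes M :: "(('k::field) mpol, 'b) graded_module"
  assumes fg: "fg_graded_module n M" and reg: "reg n M \<le> Fin r"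
  shows "\<exists>D \<epsilon> \<delta>. free_resolution n M D \<epsilon> \<delta> \<and> (\<forall>p. \<forall>x\<in>set (D p). x \<le> r + int p)"
proof (cases "carrier M = {\<zero>\<^bsub>M\<^esub>}")
  case True
  interpret graded_module n M using fg by (simp add: fg_graded_module_def)
  have "(\<lambda>_. \<zero>\<^bsub>M\<^esub>) \<in> graded_hom n (free n []) M"
    unfolding graded_hom_def hom_def using part_zero by (auto simp: image_subset_iff)
  then have "free_resolution n M (\<lambda>_. []) (\<lambda>_. \<zero>\<^bsub>M\<^esub>) (\<lambda>_ _. 0)"
    unfolding free_resolution_def carrier_free_Nil True
    by (intro conjI allI zero_graded_hom) (assumption | blast)+
  moreover have "\<forall>p. \<forall>x\<in>set ((\<lambda>_. [] :: int list) p). x \<le> r + int p" by simp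
  ultimately show ?thesis by (intro exI conjI)
next
  case False
  from regular_bounded_below[OF fg False] obtain e0 where e0: "\<forall>r. regular n M r \<longrightarrow> e0 \<le> r" by (elim exE)
  have low: "e0 \<le> r" if "regular n M r" for r using e0 that by simp
  from regular_exists[OF fg] obtain r0 where r0: "regular n M r0" by (elim exE)
  have least: "regular n M (LEAST r. regular n M r)" by (rule Least_int_bounded(1)[of "regular n M", OF r0 low])
  have le: "(LEAST r. regular n M r) \<le> r" using reg False by (simp add: reg_def)
  from regular_resolution[OF least] obtain D and \<epsilon> :: "'k vec \<Rightarrow> 'b" and \<delta> :: "nat \<Rightarrow> 'k vec \<Rightarrow> 'k vec"
    where res: "free_resolution n M D \<epsilon> \<delta>" and deg: "\<forall>p. \<forall>x\<in>set (D p). x \<le> (LEAST r. regular n M r) + int p"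
    by (elim exE conjE)
  have "\<forall>p. \<forall>x\<in>set (D p). x \<le> r + int p"
  proof (intro allI ballI)
    fix p x assume "x \<in> set (D p)"
    then have "x \<le> (LEAST r. regular n M r) + int p" using deg by blast
    then show "x \<le> r + int p" using le by linarith
  qed
  with res show ?thesis by (intro exI conjI)
qed

lemma reg_le_of_regular:
  assumes fg: "fg_graded_module n M" and "regular n M r"
  shows "reg n M \<le> Fin r"
proof (cases "carrier M = {\<zero>\<^bsub>M\<^esub>}")
  case False
  from regular_bounded_below[OF fg False] obtain e0 where e0: "\<forall>r. regular n M r \<longrightarrow> e0 \<le> r" by (elim exE)
  have low: "e0 \<le> r" if "regular n M r" for r using e0 that by simp
  show ?thesis using Least_int_bounded(2)[of "regular n M", OF assms(2) low assms(2)] False by (simp add: reg_def)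
qed (simp add: reg_def)

section \<open>Generators and ideals\<close>

text \<open>Graded Nakayama: if a basis vector of too high degree existed, its image would come from vectors without a constant coefficient there, contradicting the minimality of the cover.\<close>

lemma cover_degrees:
  assumes e: "free_map n M D \<epsilon>" "\<epsilon> ` carrier (free n D) = carrier M"
    and ker: "\<And>v j. v \<in> carrier (free n D) \<Longrightarrow> \<epsilon> v = \<zero>\<^bsub>M\<^esub> \<Longrightarrow> Poly_Mapping.lookup (v j) 0 = 0"
    and gen: "generated_in_degrees_le n (M :: (('k::field) mpol, 'b) graded_module) s"
  shows "\<forall>x\<in>set D. x \<le> s"
proof -
  interpret E: free_map n M D \<epsilon> by fact
  define V where "V = {v \<in> carrier (free n D :: ('k mpol, 'k vec) graded_module). \<forall>j<length D. s < D ! j \<longrightarrow> Poly_Mapping.lookup (v j) 0 = 0}"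
  have Vc: "v \<in> carrier (free n D)" if "v \<in> V" for v using that by (simp add: V_def)
  have N: "submodule (\<epsilon> ` V) (poly_ring n) M"
  proof (rule E.submoduleI)
    show "\<epsilon> ` V \<subseteq> carrier M" using E.closed[OF Vc] by (rule image_subsetI)
    show "\<zero>\<^bsub>M\<^esub> \<in> \<epsilon> ` V" by (rule image_eqI[of _ _ 0]) (simp_all add: V_def zero_fun_apply)
  next
    fix a assume "a \<in> \<epsilon> ` V"
    then obtain v where v: "v \<in> V" "a = \<epsilon> v" by (elim imageE)
    have "- v \<in> V" using v(1) free_carrier_uminus[of v n D] by (simp add: V_def)
    then show "\<ominus>\<^bsub>M\<^esub> a \<in> \<epsilon> ` V" using E.uminus[OF Vc[OF v(1)]] v(2) by (intro image_eqI[of _ _ "- v"]) simp_all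
  next
    fix a b assume "a \<in> \<epsilon> ` V" "b \<in> \<epsilon> ` V"
    then obtain v w where v: "v \<in> V" "a = \<epsilon> v" and w: "w \<in> V" "b = \<epsilon> w" by (elim imageE)
    have "v + w \<in> V" using v(1) w(1) free_carrier_add[of v n D w] by (simp add: V_def plus_fun_apply lookup_add)
    then show "a \<oplus>\<^bsub>M\<^esub> b \<in> \<epsilon> ` V"
      using E.add[OF Vc[OF v(1)] Vc[OF w(1)]] v(2) w(2) by (intro image_eqI[of _ _ "v + w"]) simp_all
  next
    fix p :: "'k mpol" and a assume p: "p \<in> carrier (poly_ring n)" and "a \<in> \<epsilon> ` V"
    then obtain v where v: "v \<in> V" "a = \<epsilon> v" by (elim imageE)
    have "p \<bullet> v \<in> V" using v(1) free_carrier_scale[OF p, of v D] by (simp add: V_def vscale_def lookup_mult_0)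
    then show "p \<odot>\<^bsub>M\<^esub> a \<in> \<epsilon> ` V"
      using E.scale[OF p Vc[OF v(1)]] v(2) by (intro image_eqI[of _ _ "p \<bullet> v"]) simp_all
  qed
  have "(\<Union>e\<in>{..s}. graded_part M e) \<subseteq> \<epsilon> ` V"
  proof
    fix x assume "x \<in> (\<Union>e\<in>{..s}. graded_part M e)"
    then obtain e where x: "e \<le> s" "x \<in> graded_part M e" by auto
    have "x \<in> \<epsilon> ` carrier (free n D)" unfolding e(2) by (rule E.part_carrier[OF x(2)])
    from E.lift_graded[OF this x(2)] obtain v where v: "v \<in> free_part n D e" "\<epsilon> v = x" by (elim bexE)
    have "Poly_Mapping.lookup (v j) 0 = 0" if "j < length D" "s < D ! j" for j
      using hom_part_lookup_0[OF free_part_hom[OF v(1) that(1)]] that(2) x(1) by simp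
    then have "v \<in> V" using free_part_carrier[OF v(1)] by (simp add: V_def)
    then show "x \<in> \<epsilon> ` V" using v(2) by (intro image_eqI[of _ _ v]) simp_all
  qed
  from E.generated_least[OF N this] have sub: "carrier M \<subseteq> \<epsilon> ` V" using gen by (simp add: generated_in_degrees_le_def)
  show ?thesis
  proof (rule ballI, rule ccontr)
    fix x assume "x \<in> set D" "\<not> x \<le> s"
    then obtain j where j: "j < length D" "s < D ! j" by (auto simp: in_set_conv_nth)
    have uc: "(unit_vec j :: 'k vec) \<in> carrier (free n D)" by (rule free_part_carrier[OF unit_vec_part[OF j(1)]])
    have "\<epsilon> (unit_vec j) \<in> \<epsilon> ` V" by (rule subsetD[OF sub E.closed[OF uc]])
    then obtain v where v: "v \<in> V" "\<epsilon> (unit_vec j) = \<epsilon> v" by (elim imageE)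
    have "unit_vec j - v \<in> carrier (free n D)" using free_carrier_add[OF uc free_carrier_uminus[OF Vc[OF v(1)]]] by simp
    from ker[OF this E.diff_zero[OF uc Vc[OF v(1)] v(2)], of j]
    have "Poly_Mapping.lookup (unit_vec j j :: 'k mpol) 0 = Poly_Mapping.lookup (v j) 0" by (simp add: lookup_minus)
    moreover have "Poly_Mapping.lookup (v j) 0 = 0" using v(1) j by (simp add: V_def)
    ultimately show False by (simp add: lookup_unit_vec)
  qed
qed

text \<open>A homogeneous generator with a nonzero constant coefficient is a unit.\<close>

lemma proper_homogeneous_ideal_positive:
  fixes I :: "('k::field) mpol set"
  assumes I: "proper_homogeneous_ideal n I" and p: "p \<in> I"
  shows "p \<in> carrier (poly_ring n)" and "Poly_Mapping.lookup p 0 = 0"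
proof -
  interpret R: cring "poly_ring n :: 'k mpol ring" by (rule cring_poly_ring)
  obtain A where A: "A \<subseteq> (\<Union>a. hom_part n a)" "I = Idl\<^bsub>poly_ring n\<^esub> A" and id: "ideal I (poly_ring n)" and ne: "I \<noteq> carrier (poly_ring n)"
    using I unfolding proper_homogeneous_ideal_def homogeneous_ideal_def by (elim conjE exE)
  show "p \<in> carrier (poly_ring n)" by (rule ideal.Icarr[OF id p])
  have Ac: "A \<subseteq> carrier (poly_ring n)"
  proof
    fix a assume "a \<in> A"
    with A(1) have "a \<in> (\<Union>e. hom_part n e)" by (rule subsetD)
    then obtain e where "a \<in> hom_part n e" by (elim UN_E)
    then show "a \<in> carrier (poly_ring n)" by (rule hom_part_carrier)
  qed
  define P where "P = {q \<in> carrier (poly_ring n :: 'k mpol ring). Poly_Mapping.lookup q 0 = 0}"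
  have ainv: "\<ominus>\<^bsub>poly_ring n\<^esub> q = - q" if "q \<in> carrier (poly_ring n)" for q :: "'k mpol"
    using that poly_carrier_uminus[OF that] by (intro R.minus_equality) simp_all
  have "ideal P (poly_ring n)"
  proof (rule idealI[OF R.ring_axioms])
    show "subgroup P (add_monoid (poly_ring n))"
    proof (rule subgroup.intro)
      show "P \<subseteq> carrier (add_monoid (poly_ring n))" by (auto simp: P_def)
      show "\<one>\<^bsub>add_monoid (poly_ring n)\<^esub> \<in> P" by (simp add: P_def)
      show "x \<otimes>\<^bsub>add_monoid (poly_ring n)\<^esub> y \<in> P" if "x \<in> P" "y \<in> P" for x y
        using that poly_carrier_add[of x n y] by (simp add: P_def lookup_add)
      show "inv\<^bsub>add_monoid (poly_ring n)\<^esub> x \<in> P" if "x \<in> P" for x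
        using that ainv[of x] poly_carrier_uminus[of x n] unfolding a_inv_def by (simp add: P_def)
    qed
    show "x \<otimes>\<^bsub>poly_ring n\<^esub> a \<in> P" if "a \<in> P" "x \<in> carrier (poly_ring n)" for a x
      using that poly_carrier_mult[of x n a] by (simp add: P_def lookup_mult_0)
    show "a \<otimes>\<^bsub>poly_ring n\<^esub> x \<in> P" if "a \<in> P" "x \<in> carrier (poly_ring n)" for a x
      using that poly_carrier_mult[of a n x] by (simp add: P_def lookup_mult_0)
  qed
  moreover have "A \<subseteq> P"
  proof (rule ccontr)
    assume "\<not> A \<subseteq> P"
    then obtain a where a: "a \<in> A" "Poly_Mapping.lookup a 0 \<noteq> 0" using Ac by (auto simp: P_def)
    have "a \<in> (\<Union>e. hom_part n e)" by (rule subsetD[OF A(1) a(1)])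
    then obtain e where e: "a \<in> hom_part n e" by (elim UN_E)
    then have "a \<in> hom_part n 0" using hom_part_lookup_0[OF e] a(2) by (cases "e = 0") auto
    then have ac: "a = const (Poly_Mapping.lookup a 0)" by (rule hom_part_deg0)
    have aI: "a \<in> I" unfolding A(2) using R.genideal_self[OF Ac] a(1) by blast
    have "const (1 / Poly_Mapping.lookup a 0) \<otimes>\<^bsub>poly_ring n\<^esub> a \<in> I"
      by (rule ideal.I_l_closed[OF id aI hom_part_carrier[OF hom_part_const]])
    moreover have "const (1 / Poly_Mapping.lookup a 0) * a = 1"
      by (subst (2) ac) (simp add: const_mult a(2))
    ultimately have "\<one>\<^bsub>poly_ring n\<^esub> \<in> I" by simp
    then show False using ideal.one_imp_carrier[OF id] ne by blast
  qed
  ultimately have "I \<subseteq> P" unfolding A(2) by (rule R.genideal_minimal)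
  then show "Poly_Mapping.lookup p 0 = 0" using p by (auto simp: P_def)
qed

lemma lin_form_irrelevant: "lin_form n i c \<in> (irrelevant_ideal n :: ('k::field) mpol set)"
proof -
  interpret I: ideal "irrelevant_ideal n :: 'k mpol set" "poly_ring n" by (rule irrelevant_ideal_ideal)
  have mem: "const (c ^ (j - i)) * var j \<in> (irrelevant_ideal n :: 'k mpol set)" if "j \<in> {i..n}" for j
    using I.I_l_closed[OF var_irrelevant hom_part_carrier[OF hom_part_const]] that by simp
  have "(\<Sum>j\<in>A. const (c ^ (j - i)) * var j) \<in> (irrelevant_ideal n :: 'k mpol set)" if "A \<subseteq> {i..n}" "finite A" for A
    using that(2,1)
  proof (induction A rule: finite_induct)
    case (insert j A)
    then show ?case using mem[of j] additive_subgroup.a_closed[OF I.additive_subgroup_axioms, of "const (c ^ (j - i)) * var j" "\<Sum>j\<in>A. const (c ^ (j - i)) * var j"] by simp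
  qed (use additive_subgroup.zero_closed[OF I.additive_subgroup_axioms] in simp)
  then show ?thesis unfolding lin_form_def by simp
qed

lemma power_irrelevant:
  fixes p :: "('k::field) mpol"
  assumes "p \<in> irrelevant_ideal n"
  shows "p ^ t \<in> irrelevant_ideal n [^]\<^bsub>ideals_set (poly_ring n)\<^esub> t"
proof (induction t)
  case 0
  show ?case by (simp add: nat_pow_def ideals_set_def)
next
  case (Suc t)
  have "p ^ t \<otimes>\<^bsub>poly_ring n\<^esub> p \<in> ideal_prod (poly_ring n) (irrelevant_ideal n [^]\<^bsub>ideals_set (poly_ring n)\<^esub> t) (irrelevant_ideal n)"
    by (rule ideal_prod.prod[OF Suc assms])
  then show ?case by (simp add: nat_pow_def ideals_set_def mult.commute)
qed

section \<open>Regularity by approximation\<close>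

text \<open>The case \<open>t = 0\<close> is excluded by looking at constant coefficients, which vanish on every proper homogeneous ideal.\<close>

lemma approximation_positive_degree:
  fixes M :: "(('k::field) mpol, 'a) graded_module"
  assumes proper: "\<forall>i\<in>{1..d}. proper_homogeneous_ideal n (I i)"
    and sub: "irrelevant_ideal n [^]\<^bsub>ideals_set (poly_ring n)\<^esub> t \<subseteq> ideal_sum (poly_ring n) {1..d} (I :: nat \<Rightarrow> 'k mpol set)"
  shows "1 \<le> t"
    and "p \<in> irrelevant_ideal n \<Longrightarrow> \<exists>q. (\<forall>i\<in>{1..d}. q i \<in> I i) \<and> p ^ t = (\<Sum>i\<in>{1..d}. q i)"
proof -
  interpret R: cring "poly_ring n :: 'k mpol ring" by (rule cring_poly_ring)
  have I: "proper_homogeneous_ideal n (I i)" if "i \<in> {1..d}" for i using proper that by (rule bspec)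
  have split: "\<exists>q. (\<forall>i\<in>{1..d}. q i \<in> I i) \<and> p ^ t = (\<Sum>i\<in>{1..d}. q i)" if "p \<in> irrelevant_ideal n" for p
  proof -
    have "p ^ t \<in> ideal_sum (poly_ring n) {1..d} I" by (rule subsetD[OF sub power_irrelevant[OF that]])
    then obtain q where q: "p ^ t = finsum (poly_ring n) q {1..d}" "\<forall>i\<in>{1..d}. q i \<in> I i"
      unfolding ideal_sum_def by (elim CollectE exE conjE)
    have "finsum (poly_ring n) q {1..d} = (\<Sum>i\<in>{1..d}. q i)"
      using proper_homogeneous_ideal_positive(1)[OF I] q(2) by (intro finsum_eq_sum R.abelian_monoid_axioms) simp_all
    then show ?thesis using q by (intro exI[of _ q] conjI) simp_all
  qed
  then show "p \<in> irrelevant_ideal n \<Longrightarrow> \<exists>q. (\<forall>i\<in>{1..d}. q i \<in> I i) \<and> p ^ t = (\<Sum>i\<in>{1..d}. q i)" by blast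
  show "1 \<le> t"
  proof (rule ccontr)
    assume "\<not> 1 \<le> t"
    then have t: "t = 0" by simp
    from split[OF var_irrelevant[of 0 n]] obtain q where q: "\<forall>i\<in>{1..d}. q i \<in> I i" "1 = (\<Sum>i\<in>{1..d}. q i)"
      unfolding t by auto
    have "Poly_Mapping.lookup (1 :: 'k mpol) 0 = (\<Sum>i\<in>{1..d}. Poly_Mapping.lookup (q i) 0)"
      by (subst q(2)) (simp only: lookup_sum)
    also have "\<dots> = 0" using proper_homogeneous_ideal_positive(2)[OF I] q(1) by (intro sum.neutral ballI) blast
    finally show False by simp
  qed
qed

lemma (in free_map) comp_free_map:
  assumes N: "graded_module n N" and f: "\<phi> \<in> graded_hom n M N"
  shows "free_map n N D (\<phi> \<circ> \<epsilon>)"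
proof (intro free_map.intro N free_map_axioms.intro)
  have f1: "\<And>x. x \<in> carrier M \<Longrightarrow> \<phi> x \<in> carrier N"
    "\<And>x y. x \<in> carrier M \<Longrightarrow> y \<in> carrier M \<Longrightarrow> \<phi> (x \<oplus>\<^bsub>M\<^esub> y) = \<phi> x \<oplus>\<^bsub>N\<^esub> \<phi> y"
    using f by (auto simp: graded_hom_def hom_def)
  have f2: "\<And>p x. p \<in> carrier (poly_ring n) \<Longrightarrow> x \<in> carrier M \<Longrightarrow> \<phi> (p \<odot>\<^bsub>M\<^esub> x) = p \<odot>\<^bsub>N\<^esub> \<phi> x"
    using f by (simp add: graded_hom_def)
  have f3: "\<phi> x \<in> graded_part N e" if "x \<in> graded_part M e" for x e
  proof -
    have "\<phi> ` graded_part M e \<subseteq> graded_part N e" using f by (simp add: graded_hom_def)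
    then show ?thesis using that by (rule subsetD[OF _ imageI])
  qed
  show "\<phi> \<circ> \<epsilon> \<in> graded_hom n (free n D) N"
    unfolding graded_hom_def hom_def
  proof (intro CollectI conjI ballI allI funcsetI subsetI)
    show "(\<phi> \<circ> \<epsilon>) v \<in> carrier (add_monoid N)" if "v \<in> carrier (add_monoid (free n D))" for v
      using that closed f1(1) by simp
    show "(\<phi> \<circ> \<epsilon>) (v \<otimes>\<^bsub>add_monoid (free n D)\<^esub> w) = (\<phi> \<circ> \<epsilon>) v \<otimes>\<^bsub>add_monoid N\<^esub> (\<phi> \<circ> \<epsilon>) w"
      if "v \<in> carrier (add_monoid (free n D))" "w \<in> carrier (add_monoid (free n D))" for v w
      using that add[of v w] closed f1(2) by simp
    show "(\<phi> \<circ> \<epsilon>) (p \<odot>\<^bsub>free n D\<^esub> v) = p \<odot>\<^bsub>N\<^esub> (\<phi> \<circ> \<epsilon>) v"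
      if "p \<in> carrier (poly_ring n)" "v \<in> carrier (free n D)" for p v
      using that scale[of p v] closed f2 by simp
    show "x \<in> graded_part N e" if "x \<in> (\<phi> \<circ> \<epsilon>) ` graded_part (free n D) e" for x e
    proof -
      from that obtain v where "v \<in> graded_part (free n D) e" "x = (\<phi> \<circ> \<epsilon>) v" by (elim imageE)
      then show ?thesis using f3[OF graded, of v e] by simp
    qed
  qed
qed

theorem theorem3p5:
  fixes n t d :: nat and r :: int
    and M :: "(('k::field) mpol, 'a) graded_module"
    and Ms :: "nat \<Rightarrow> ('k mpol, 'b) graded_module"
  assumes "infinite (UNIV :: 'k set)"
    and "fg_graded_module n M"
    and "generated_in_degrees_le n M (r - (int t - 1) * (int n + 1))"
    and "approximation_system n M d Ms t"
    and "\<forall>i \<in> {1..d}. reg n (Ms i) \<le> Fin (r - (int t - 1) * (int n + 1) - 1)"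
  shows "reg n M \<le> Fin r"
proof -
  define s where "s = r - (int t - 1) * (int n + 1)"
  have M: "graded_module n M" using assms(2) by (simp add: fg_graded_module_def)
  have fgs: "\<forall>i\<in>{1..d}. fg_graded_module n (Ms i)" using assms(4) by (simp add: approximation_system_def)
  obtain \<phi> I where approx: "\<forall>i\<in>{1..d}. approximation_via n M (Ms i) (\<phi> i) (I i)"
    and sub: "irrelevant_ideal n [^]\<^bsub>ideals_set (poly_ring n)\<^esub> t \<subseteq> ideal_sum (poly_ring n) {1..d} I"
    using assms(4) unfolding approximation_system_def by (elim conjE exE)
  have I: "proper_homogeneous_ideal n (I i)" if "i \<in> {1..d}" for i
    using approx that by (simp add: approximation_via_def)
  have proper: "\<forall>i\<in>{1..d}. proper_homogeneous_ideal n (I i)" using I by (rule ballI)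
  have t: "1 \<le> t" by (rule approximation_positive_degree(1)[OF proper sub])
  from minimal_resolution_exists[OF assms(2)] obtain D and \<epsilon> :: "'k vec \<Rightarrow> 'a" and \<delta> :: "nat \<Rightarrow> 'k vec \<Rightarrow> 'k vec"
    where res: "free_resolution n M D \<epsilon> \<delta>" and minimal: "minimal_differential n D \<delta>" by (elim exE conjE)
  have "\<forall>i\<in>{1..d}. \<exists>x. free_resolution n (Ms i) (fst x) (fst (snd x)) (snd (snd x)) \<and>
      (\<forall>p. \<forall>x\<in>set (fst x p). x \<le> (s - 1) + int p)"
  proof
    fix i assume i: "i \<in> {1..d}"
    from reg_le_resolution[of n "Ms i" "s - 1"] fgs assms(5) i
    obtain D' and \<epsilon>' :: "'k vec \<Rightarrow> 'b" and \<delta>' :: "nat \<Rightarrow> 'k vec \<Rightarrow> 'k vec"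
      where "free_resolution n (Ms i) D' \<epsilon>' \<delta>'" "\<forall>p. \<forall>x\<in>set (D' p). x \<le> s - 1 + int p"
      unfolding s_def by blast
    then show "\<exists>x. free_resolution n (Ms i) (fst x) (fst (snd x)) (snd (snd x)) \<and>
      (\<forall>p. \<forall>x\<in>set (fst x p). x \<le> (s - 1) + int p)" by (intro exI[of _ "(D', \<epsilon>', \<delta>')"]) simp
  qed
  from bchoice[OF this] obtain X where X: "\<forall>i\<in>{1..d}. free_resolution n (Ms i) (fst (X i)) (fst (snd (X i))) (snd (snd (X i))) \<and>
      (\<forall>p. \<forall>x\<in>set (fst (X i) p). x \<le> (s - 1) + int p)" by (elim exE)
  define Da where "Da i = fst (X i)" for i
  define ea where "ea i = fst (snd (X i))" for i
  define da where "da i = snd (snd (X i))" for i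
  have resa: "free_resolution n (Ms i) (Da i) (ea i) (da i)" and dega: "\<forall>x\<in>set (Da i p). x \<le> (s - 1) + int p"
    if "i \<in> {1..d}" for i p using X that by (simp_all add: Da_def ea_def da_def)
  \<comment> \<open>One choice of forms must serve \<open>M\<close> and all approximating modules; index \<open>0\<close> stands for \<open>M\<close>.\<close>
  define U where "U = kernel_sub n M (D 0) \<epsilon>"
  define Ua where "Ua i = kernel_sub n (Ms i) (Da i 0) (ea i)" for i
  have fm_M: "free_map n M (D 0) \<epsilon>"
    using res by (intro free_map.intro M free_map_axioms.intro) (simp add: free_resolution_def)
  have fm_a: "free_map n (Ms i) (Da i 0) (ea i)" if "i \<in> {1..d}" for i
    using resa[OF that] fgs that by (intro free_map.intro free_map_axioms.intro) (simp_all add: free_resolution_def fg_graded_module_def)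
  have gU: "graded_sub n U" unfolding U_def
    using free_map.graded_sub_kernel[OF fm_M] free_map.kernel_part_eq[OF fm_M] by simp
  have gUa: "graded_sub n (Ua i)" if "i \<in> {1..d}" for i unfolding Ua_def
    using free_map.graded_sub_kernel[OF fm_a[OF that]] free_map.kernel_part_eq[OF fm_a[OF that]] by simp
  have "\<exists>c. \<forall>a\<in>{0..d}. almost_regular n (lin_forms n c) (if a = 0 then D 0 else Da a 0) (if a = 0 then U else Ua a)"
  proof (rule almost_regular_exists[OF assms(1)])
    show "graded_sub n (if a = 0 then U else Ua a)" if "a \<in> {0..d}" for a using gU gUa[of a] that by simp
    show "(if a = 0 then U else Ua a) e \<subseteq> free_part n (if a = 0 then D 0 else Da a 0) e" if "a \<in> {0..d}" for a e
      by (auto simp: U_def Ua_def kernel_sub_def)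
  qed simp
  then obtain c where c: "\<forall>a\<in>{0..d}. almost_regular n (lin_forms n c) (if a = 0 then D 0 else Da a 0) (if a = 0 then U else Ua a)"
    by (elim exE)
  have almost: "almost_regular n (lin_forms n c) (D 0) U" using bspec[OF c, of 0] by simp
  have almost_a: "almost_regular n (lin_forms n c) (Da i 0) (Ua i)" if "i \<in> {1..d}" for i
    using bspec[OF c, of i] that by simp
  define y where "y = lin_forms n c"
  have y: "y l \<in> hom_part n 1" for l unfolding y_def by (rule hom_part_lin_form)
  interpret S: sliced_resolution n M D \<epsilon> \<delta> c
    by (intro sliced_resolution.intro sliced_resolution_axioms.intro M res)
  interpret E: free_map n M "D 0" \<epsilon> by (rule fm_M)
  have surj: "\<epsilon> ` carrier (free n (D 0)) = carrier M" using res by (simp add: free_resolution_def)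
  \<comment> \<open>The approximating modules are presented as quotients of the cover of \<open>M\<close>, with relations \<open>V i\<close> containing those of \<open>M\<close>.\<close>
  define V where "V i = kernel_sub n (Ms i) (D 0) (\<phi> i \<circ> \<epsilon>)" for i
  have V_bound: "torsion_bound n y (D 0) (V i) (s - 1)" if i: "i \<in> {1..d}" for i
  proof -
    have Mi: "graded_module n (Ms i)" using fgs i by (simp add: fg_graded_module_def)
    interpret Si: sliced_resolution n "Ms i" "Da i" "ea i" "da i" c
      by (intro sliced_resolution.intro sliced_resolution_axioms.intro Mi resa[OF i])
    have "torsion_bound n y (Da i 0) (kernel_sub n (Ms i) (Da i 0) (ea i)) (s - 1)"
      unfolding y_def using Si.torsion_bound_of_degrees[OF dega[OF i]] almost_a[OF i] by (simp add: Ua_def)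
    moreover have "ea i ` carrier (free n (Da i 0)) = carrier (Ms i)" using resa[OF i] by (simp add: free_resolution_def)
    moreover have "free_map n (Ms i) (D 0) (\<phi> i \<circ> \<epsilon>)"
      using approx i by (intro E.comp_free_map[OF Mi]) (simp add: approximation_via_def)
    moreover have "(\<phi> i \<circ> \<epsilon>) ` carrier (free n (D 0)) = carrier (Ms i)"
      using approx i surj by (simp only: approximation_via_def image_comp[symmetric])
    ultimately show ?thesis unfolding V_def using torsion_bound_transfer[OF fm_a[OF i]] y by blast
  qed
  have UV: "U e \<subseteq> V i e" if i: "i \<in> {1..d}" for i e
  proof
    fix v assume v: "v \<in> U e"
    have Mi: "graded_module n (Ms i)" using fgs i by (simp add: fg_graded_module_def)
    have "free_map n (Ms i) (D 0) (\<phi> i \<circ> \<epsilon>)"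
      using approx i by (intro E.comp_free_map[OF Mi]) (simp add: approximation_via_def)
    from free_map.zero[OF this] have "\<phi> i \<zero>\<^bsub>M\<^esub> = \<zero>\<^bsub>Ms i\<^esub>" using E.zero by simp
    then show "v \<in> V i e" using v by (simp add: U_def V_def kernel_sub_def)
  qed
  have D0: "\<forall>x\<in>set (D 0). x \<le> s"
  proof (rule cover_degrees[OF fm_M surj])
    show "generated_in_degrees_le n M s" unfolding s_def by (rule assms(3))
    fix v j assume "v \<in> carrier (free n (D 0))" "\<epsilon> v = \<zero>\<^bsub>M\<^esub>"
    then have "v \<in> \<delta> 0 ` carrier (free n (D (Suc 0)))" unfolding S.image_0 by simp
    then obtain w where "w \<in> carrier (free n (D (Suc 0)))" "v = \<delta> 0 w" by (elim imageE)
    then show "Poly_Mapping.lookup (v j) 0 = 0" using minimal by (simp add: minimal_differential_def)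
  qed
  have kill: "y i ^ t \<bullet> v \<in> slice n y (D 0) U i (e + int t)"
    if i: "i < Suc n" and e: "s \<le> e" and v: "v \<in> free_part n (D 0) e" and tors: "v \<in> torsion y (Suc n) (slice n y (D 0) U i) e" for i v e
  proof -
    have "y i \<in> irrelevant_ideal n" unfolding y_def by (rule lin_form_irrelevant)
    from approximation_positive_degree(2)[OF proper sub this] obtain q where q: "\<forall>a\<in>{1..d}. q a \<in> I a" "y i ^ t = (\<Sum>a\<in>{1..d}. q a)"
      by (elim exE conjE)
    have qc: "q a \<in> carrier (poly_ring n)" if "a \<in> {1..d}" for a
      using proper_homogeneous_ideal_positive(1)[OF I[OF that]] q(1) that by simp
    have "(\<Sum>a\<in>{1..d}. q a) \<bullet> v \<in> slice n y (D 0) (kernel_sub n M (D 0) \<epsilon>) i (e + int t)"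
    proof (rule E.annihilated_slice[OF finite_atLeastAtMost qc _ y v])
      show "(\<Sum>a\<in>{1..d}. q a) \<in> hom_part n (int t)" unfolding q(2)[symmetric] by (rule hom_part_power1[OF y])
      fix a assume a: "a \<in> {1..d}"
      have "v \<in> torsion y (Suc n) (slice n y (D 0) (V a) i) e"
        by (rule torsion_mono[OF slice_mono[OF UV[OF a]] tors])
      then have "v \<in> slice n y (D 0) (V a) i e" using V_bound[OF a] i e v by (simp add: torsion_bound_def)
      then obtain u h where u: "u \<in> V a e" and h: "h \<in> multiples y {..<i} (free_part n (D 0)) e" and vuh: "v = u + h"
        by (rule sliceE)
      have up: "u \<in> free_part n (D 0) e" "\<phi> a (\<epsilon> u) = \<zero>\<^bsub>Ms a\<^esub>" using u by (simp_all add: V_def kernel_sub_def)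
      have "\<epsilon> u \<in> a_kernel M (Ms a) (\<phi> a)" using up(2) E.closed[OF free_part_carrier[OF up(1)]] by (simp add: a_kernel_def')
      then have "q a \<odot>\<^bsub>M\<^esub> \<epsilon> u = \<zero>\<^bsub>M\<^esub>" using approx a q(1) by (simp add: approximation_via_def)
      then have "\<epsilon> (q a \<bullet> u) = \<zero>\<^bsub>M\<^esub>" using E.scale[OF qc[OF a] free_part_carrier[OF up(1)]] by simp
      then show "\<exists>u\<in>free_part n (D 0) e. \<exists>h\<in>multiples y {..<i} (free_part n (D 0)) e. v = u + h \<and> \<epsilon> (q a \<bullet> u) = \<zero>\<^bsub>M\<^esub>"
        using up(1) h vuh by (intro bexI conjI)
    qed
    then show ?thesis by (simp only: q(2) U_def)
  qed
  have "torsion_bound n y (D 0) U r"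
    unfolding torsion_bound_def
  proof (intro allI impI)
    fix i e v assume i: "i \<le> Suc n" and e: "r < e" and v: "v \<in> free_part n (D 0) e"
      and tors: "v \<in> torsion y (Suc n) (slice n y (D 0) U i) e"
    have "(int t - 1) * (int (Suc n) - int i) \<le> (int t - 1) * (int n + 1)" using t by (intro mult_left_mono) auto
    then have e': "s + (int t - 1) * (int (Suc n) - int i) < e" using e by (simp add: s_def)
    show "v \<in> slice n y (D 0) U i e"
    proof (rule torsion_vanishing_by_approximation[OF graded_sub_free_part gU _ y t _ _ _ kill i e' v tors])
      show "U e \<subseteq> free_part n (D 0) e" for e by (auto simp: U_def kernel_sub_def)
      show "slice n y (D 0) U i e = {u + h |u h. u \<in> U e \<and> h \<in> multiples y {..<i} (free_part n (D 0)) e}" for i e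
        by (simp add: slice_def)
      show "free_part n (D 0) e \<subseteq> multiples y {..<Suc n} (free_part n (D 0)) e" if "s < e" for e
      proof
        fix w :: "'k vec" assume w: "w \<in> free_part n (D 0) e"
        have "\<forall>x\<in>set (D 0). x < e" using D0 that by auto
        from multiples_lin_forms[OF w high_degree_positive[OF w this], of c]
        show "w \<in> multiples y {..<Suc n} (free_part n (D 0)) e" by (simp add: lessThan_Suc_atMost y_def)
      qed
      show "w \<in> torsion y (Suc n) (slice n y (D 0) U i) e"
        if "i < Suc n" "w \<in> free_part n (D 0) e" "y i \<bullet> w \<in> slice n y (D 0) U i (e + 1)" for i w e
        using almost that unfolding almost_regular_def y_def by simp
    qed
  qed
  moreover have "s \<le> r" using t by (simp add: s_def)
  then have "\<forall>x\<in>set (D 0). x \<le> r" using D0 by auto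
  ultimately have "\<forall>x\<in>set (D p). x \<le> r + int p" for p
    using S.degrees_of_torsion_bound[OF minimal] almost by (simp add: U_def y_def)
  then have "regular n M r" by (rule regularI[OF M res minimal])
  then show ?thesis by (rule reg_le_of_regular[OF assms(2)])
qed


end
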